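(* Let $K\Subset(0,4)$ (that is, $K$ is a compact subset of $(0,4)$). There exist $\rho_K>0$ and $C_K>0$ such that, for every $\alpha\in K$ and every $\Psi\in H^2(\mathbb S^4)$ satisfying $$\Psi\perp_{L^2}\mathcal H_0,\qquad\|\Psi\|_{H^2(\mathbb S^4)}\le\rho_K,$$ one has $$\left|\mathcal D_\alpha(\Psi)-\frac12\langle\mathcal L_\alpha\Psi,\Psi\rangle_{L^2(\mathbb S^4)}\right|\le C_K\|\Psi\|_{H^2(\mathbb S^4)}^3 .$$
   Context: All functions are real-valued. $\mathbb S^4\subset\mathbb R^5$ is the unit round sphere with surface measure $d\xi$ and chordal distance $|\xi-\eta|$; $|\mathbb S^4|=8\pi^2/3$; $\mathcal H_0$ is the space of constants; $\overline\Phi=|\mathbb S^4|^{-1}\int\Phi\,d\xi$. $P_4^{\mathbb S^4}=(-\Delta_{\mathbb S^4})(-\Delta_{\mathbb S^4}+2)$; $\mathcal R_\alpha\Phi(\xi)=\int_{\mathbb S^4}|\xi-\eta|^{-\alpha}\Phi(\eta)d\eta$; $\mu_0(\alpha)=\int_{\mathbb S^4}|\xi-\eta|^{-\alpha}d\eta=\frac{2^{6-\alpha}\pi^2}{(6-\alpha)(4-\alpha)}$; $\kappa_\alpha=\frac{12(8-\alpha)(6-\alpha)(4-\alpha)}{\pi^2}2^{-(8-\alpha)}$; $$\mathcal L_\alpha=P_4^{\mathbb S^4}-\kappa_\alpha(\mathcal R_\alpha+\mu_0(\alpha)I),$$ with $\langle\mathcal L_\alpha\Psi,\Psi\rangle$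 and $\int\Psi P_4^{\mathbb S^4}\Psi$ understood as quadratic forms on $H^2(\mathbb S^4)$. With $\mathcal I_\alpha(\Phi)=\iint_{\mathbb S^4\times\mathbb S^4}\frac{e^{\Phi(\xi)}e^{\Phi(\eta)}}{|\xi-\eta|^\alpha}d\xi d\eta$, $$\mathcal D_\alpha(\Phi)=\frac12\int_{\mathbb S^4}\Phi P_4^{\mathbb S^4}\Phi\,d\xi+8\pi^2(8-\alpha)\overline\Phi-4\pi^2(8-\alpha)\log\frac{\mathcal I_\alpha(\Phi)}{|\mathbb S^4|\mu_0(\alpha)} .$$ *)

theory Defs
  imports "HOL-Analysis.Analysis"
begin

section \<open>Surface measure on the unit sphere of \<open>\<real>\<^sup>5\<close>\<close>

abbreviation S4 :: "(real^5) set" where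
  "S4 \<equiv> sphere 0 1"

text \<open>
  Polar-coordinate normalisation: a Borel set \<open>A\<close> of the sphere has measure
  \<open>5\<close> times the volume of the cone \<open>{t *\<^sub>R x | x \<in> A, 0 < t < 1}\<close>.  Here \<open>sgn x = x /\<^sub>R norm x\<close>.
\<close>

definition sphere_measure :: "(real^5) measure" where
  "sphere_measure =
     scale_measure 5
       (distr (restrict_space lborel (ball 0 1 - {0})) (restrict_space borel S4) sgn)"

lemma space_sphere_measure [simp]: "space sphere_measure = S4"
  by (simp add: sphere_measure_def space_scale_measure space_restrict_space)

lemma sets_sphere_measure [simp]: "sets sphere_measure = sets (restrict_space borel S4)"
  by (simp add: sphere_measure_def)

lemma sgn_measurable_S4:
  "sgn \<in> measurable (restrict_space lborel (ball 0 1 - {0 :: real^5})) (restrict_space borel S4)"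
proof (rule measurable_restrict_space2)
  have "(\<lambda>x :: real^5. x /\<^sub>R norm x) \<in> borel_measurable lborel"
    by measurable
  then show "sgn \<in> borel_measurable (restrict_space lborel (ball 0 1 - {0 :: real^5}))"
    by (intro measurable_restrict_space1) (simp add: sgn_div_norm[abs_def])
qed (auto simp: space_restrict_space norm_sgn)

lemma measure_S4: "measure sphere_measure S4 = 8 * pi\<^sup>2 / 3"
proof -
  let ?B = "ball 0 1 - {0 :: real^5}"
  have B: "?B \<in> sets lborel" by simp
  have "emeasure lborel ?B = emeasure lborel (ball 0 1 :: (real^5) set)"
    by (rule emeasure_Diff_null_set) (auto simp: null_sets_def)
  also have "\<dots> = ennreal (8 / 15 * pi\<^sup>2)"
    by (simp add: emeasure_ball unit_ball_vol_5)
  finally have vol: "emeasure lborel ?B = ennreal (8 / 15 * pi\<^sup>2)" .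
  have "emeasure sphere_measure S4 =
          5 * emeasure (restrict_space lborel ?B) (sgn -` S4 \<inter> space (restrict_space lborel ?B))"
    unfolding sphere_measure_def emeasure_scale_measure
    by (subst emeasure_distr[OF sgn_measurable_S4]) (auto simp: sets_restrict_space)
  also have "sgn -` S4 \<inter> space (restrict_space lborel ?B) = ?B"
    by (auto simp: space_restrict_space norm_sgn)
  also have "emeasure (restrict_space lborel ?B) ?B = emeasure lborel ?B"
    using B by (intro emeasure_restrict_space) auto
  also have "5 * emeasure lborel ?B = ennreal (8 * pi\<^sup>2 / 3)"
    unfolding vol by (simp flip: ennreal_numeral ennreal_mult)
  finally show ?thesis by (simp add: measure_def)
qed

section \<open>Differential operators on the sphere\<close>

text \<open>
  A function on the sphere is represented by a function on \<open>\<real>\<^sup>5\<close> of which only the values on the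
  sphere matter.  It is differentiated through its extension \<open>f \<circ> sgn\<close>, homogeneous of degree
  \<open>0\<close>, on \<open>\<real>\<^sup>5 - {0}\<close>.  The Euclidean gradient of this extension at a point of the
  sphere is tangential and equals the Riemannian gradient of \<open>f\<close>.  Since the extension has
  vanishing normal derivative, the second fundamental form does not contribute to second
  derivatives, and the covariant Hessian is the tangential part of the Euclidean one.
\<close>

definition pd :: "5 \<Rightarrow> (real^5 \<Rightarrow> real) \<Rightarrow> real^5 \<Rightarrow> real" where
  "pd i F x = frechet_derivative F (at x) (axis i 1)"

fun C_k_on :: "nat \<Rightarrow> (real^5) set \<Rightarrow> (real^5 \<Rightarrow> real) \<Rightarrow> bool" where
  "C_k_on 0 U F \<longleftrightarrow> continuous_on U F"
| "C_k_on (Suc k) U F \<longleftrightarrow> (\<forall>x\<in>U. F differentiable at x) \<and> (\<forall>i. C_k_on k U (pd i F))"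

definition smooth_S4 :: "(real^5 \<Rightarrow> real) \<Rightarrow> bool" where
  "smooth_S4 f \<longleftrightarrow> (\<forall>k. C_k_on k (- {0}) (f \<circ> sgn))"

definition grad_S4 :: "(real^5 \<Rightarrow> real) \<Rightarrow> real^5 \<Rightarrow> real^5" where
  "grad_S4 f x = (\<chi> i. pd i (f \<circ> sgn) x)"

definition tangent_proj :: "real^5 \<Rightarrow> real^5^5" where
  "tangent_proj x = mat 1 - (\<chi> i j. x $ i * x $ j)"

definition hess_S4 :: "(real^5 \<Rightarrow> real) \<Rightarrow> real^5 \<Rightarrow> real^5^5" where
  "hess_S4 f x = tangent_proj x ** (\<chi> i j. pd i (pd j (f \<circ> sgn)) x) ** tangent_proj x"

definition laplace_S4 :: "(real^5 \<Rightarrow> real) \<Rightarrow> real^5 \<Rightarrow> real" where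
  "laplace_S4 f x = trace (hess_S4 f x)"

definition paneitz_S4 :: "(real^5 \<Rightarrow> real) \<Rightarrow> real^5 \<Rightarrow> real" where
  "paneitz_S4 f = (let g = (\<lambda>x. - laplace_S4 f x + 2 * f x) in (\<lambda>x. - laplace_S4 g x))"

section \<open>The Sobolev space \<open>H\<^sup>2\<close> and quadratic forms on it\<close>

definition L2_S4 :: "(real^5 \<Rightarrow> real) set" where
  "L2_S4 = {f \<in> borel_measurable sphere_measure. integrable sphere_measure (\<lambda>x. (f x)\<^sup>2)}"

definition L2_inner :: "(real^5 \<Rightarrow> real) \<Rightarrow> (real^5 \<Rightarrow> real) \<Rightarrow> real" where
  "L2_inner f g = (\<integral>x. f x * g x \<partial>sphere_measure)"

text \<open>The norm on \<open>real^5^5\<close> is the Frobenius norm.\<close>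

definition H2_norm_smooth :: "(real^5 \<Rightarrow> real) \<Rightarrow> real" where
  "H2_norm_smooth f =
     sqrt (\<integral>x. (f x)\<^sup>2 + (norm (grad_S4 f x))\<^sup>2 + (norm (hess_S4 f x))\<^sup>2 \<partial>sphere_measure)"

text \<open>
  \<open>H\<^sup>2\<close> is the completion of the smooth functions in the \<open>H\<^sup>2\<close> norm, realised inside \<open>L\<^sup>2\<close>: it
  consists of the \<open>L\<^sup>2\<close> limits of \<open>H\<^sup>2\<close>-Cauchy sequences of smooth functions.
\<close>

definition H2_approx :: "(nat \<Rightarrow> real^5 \<Rightarrow> real) \<Rightarrow> (real^5 \<Rightarrow> real) \<Rightarrow> bool" where
  "H2_approx \<phi> f \<longleftrightarrow>
     (\<forall>n. smooth_S4 (\<phi> n)) \<and>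
     (\<forall>e>0. \<exists>N. \<forall>m\<ge>N. \<forall>n\<ge>N. H2_norm_smooth (\<lambda>x. \<phi> m x - \<phi> n x) < e) \<and>
     (\<lambda>n. \<integral>x. (\<phi> n x - f x)\<^sup>2 \<partial>sphere_measure) \<longlonglongrightarrow> 0"

definition H2_S4 :: "(real^5 \<Rightarrow> real) set" where
  "H2_S4 = {f \<in> L2_S4. \<exists>\<phi>. H2_approx \<phi> f}"

text \<open>Extension by continuity to \<open>H\<^sup>2\<close> of a functional \<open>q\<close> given on smooth functions.\<close>

definition H2_extend :: "((real^5 \<Rightarrow> real) \<Rightarrow> real) \<Rightarrow> (real^5 \<Rightarrow> real) \<Rightarrow> real" where
  "H2_extend q f = (THE r. \<forall>\<phi>. H2_approx \<phi> f \<longrightarrow> (\<lambda>n. q (\<phi> n)) \<longlonglongrightarrow> r)"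

definition H2_norm :: "(real^5 \<Rightarrow> real) \<Rightarrow> real" where
  "H2_norm = H2_extend H2_norm_smooth"

definition paneitz_form :: "(real^5 \<Rightarrow> real) \<Rightarrow> real" where
  "paneitz_form = H2_extend (\<lambda>\<phi>. L2_inner \<phi> (paneitz_S4 \<phi>))"

definition H0_S4 :: "(real^5 \<Rightarrow> real) set" where
  "H0_S4 = range (\<lambda>c x. c)"

section \<open>The functional and its second variation at the origin\<close>

definition riesz :: "real \<Rightarrow> (real^5 \<Rightarrow> real) \<Rightarrow> real^5 \<Rightarrow> real" where
  "riesz \<alpha> f x = (\<integral>y. dist x y powr (- \<alpha>) * f y \<partial>sphere_measure)"

text \<open>
  By rotation invariance the integral does not depend on the point \<open>x\<close>; for \<open>\<alpha> < 4\<close> its value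
  is \<open>2 powr (6 - \<alpha>) * pi\<^sup>2 / ((6 - \<alpha>) * (4 - \<alpha>))\<close>.
\<close>

definition mu0 :: "real \<Rightarrow> real" where
  "mu0 \<alpha> = (THE m. \<forall>x\<in>S4. (\<integral>y. dist x y powr (- \<alpha>) \<partial>sphere_measure) = m)"

definition kappa :: "real \<Rightarrow> real" where
  "kappa \<alpha> = 12 * (8 - \<alpha>) * (6 - \<alpha>) * (4 - \<alpha>) / pi\<^sup>2 * 2 powr (- (8 - \<alpha>))"

definition L_op :: "real \<Rightarrow> (real^5 \<Rightarrow> real) \<Rightarrow> real^5 \<Rightarrow> real" where
  "L_op \<alpha> f x = paneitz_S4 f x - kappa \<alpha> * (riesz \<alpha> f x + mu0 \<alpha> * f x)"

definition L_form :: "real \<Rightarrow> (real^5 \<Rightarrow> real) \<Rightarrow> real" where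
  "L_form \<alpha> = H2_extend (\<lambda>\<phi>. L2_inner (L_op \<alpha> \<phi>) \<phi>)"

definition mean_S4 :: "(real^5 \<Rightarrow> real) \<Rightarrow> real" where
  "mean_S4 f = (\<integral>x. f x \<partial>sphere_measure) / measure sphere_measure S4"

definition I_fun :: "real \<Rightarrow> (real^5 \<Rightarrow> real) \<Rightarrow> real" where
  "I_fun \<alpha> f =
     (\<integral>(x, y). exp (f x) * exp (f y) / dist x y powr \<alpha> \<partial>(sphere_measure \<Otimes>\<^sub>M sphere_measure))"

definition D_fun :: "real \<Rightarrow> (real^5 \<Rightarrow> real) \<Rightarrow> real" where
  "D_fun \<alpha> f =
     1 / 2 * paneitz_form f + 8 * pi\<^sup>2 * (8 - \<alpha>) * mean_S4 f
     - 4 * pi\<^sup>2 * (8 - \<alpha>) * ln (I_fun \<alpha> f / (measure sphere_measure S4 * mu0 \<alpha>))"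

end

theory Submission
  imports Defs
begin

text \<open>
  The Paneitz parts of \<open>D_fun\<close> and \<open>L_form\<close> cancel, and \<open>kappa \<alpha>\<close> is chosen so that the quadratic parts of
  the logarithm and of the Riesz form agree; what remains is the Taylor remainder of the exponential,
  which a Schur estimate bounds by a multiple of \<open>mu0 \<alpha>\<close> times \<open>\<integral> \<bar>\<Psi>\<bar> ^ 3 * exp (2 * \<bar>\<Psi>\<bar>)\<close>.  All constants
  turn out to be uniform in \<open>\<alpha> \<in> {0<..<4}\<close>.  The cubic integral is controlled by exponential integrability
  of \<open>\<Psi>\<^sup>2 / N\<^sup>2\<close> for \<open>N\<close> above the \<open>H\<^sup>2\<close> norm (a weak form of Adams' inequality).  This comes from the bound of
  \<open>\<bar>f\<bar>\<close> by the Riesz potential, with kernel \<open>d powr (- 2)\<close>, of \<open>4 * \<bar>f\<bar> + \<bar>lap f\<bar>\<close>, which yields \<open>L\<^sup>p\<close> bounds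
  with constants growing like \<open>sqrt p\<close>.

  Calculus on the sphere is done with the tangential derivatives \<open>pd i (f \<circ> sgn)\<close>.  Rotation invariance of
  the surface measure gives integration by parts; applied to powers of \<open>x \<bullet> y\<close> it determines all zonal
  integrals and hence \<open>mu0\<close>.
\<close>

subsection \<open>Calculus of smooth functions on the sphere\<close>

text \<open>In dimension four H^2 just fails to embed into the bounded functions, so the Taylor
  remainder of the exponential has no pointwise bound; this obstacle is what forces exponential
  integrability.

  \<open>H2_norm\<close>, \<open>paneitz_form\<close> and \<open>L_form\<close> are definite
  descriptions over all approximating sequences. Nothing can be said about them before the limits
  are known to be independent of the sequence, which is the purpose of the closability of the H^2
  norm. The Paneitz term then cancels as a number that is never evaluated.

  Uniformity in \<alpha> has a concrete source. The mass \<open>mu0 \<alpha>\<close> has a pole at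
  \<open>\<alpha> = 4\<close>, but the quadratic term and the remainder of \<open>I_fun\<close> are
  both bounded by multiples of it and enter only after division by it, while
  \<open>kappa \<alpha>\<close> has a zero there.

  The estimate is proved with any \<open>N\<close> strictly above the norm in place of the norm, and
  \<open>N\<close> decreases to the norm at the end. This leaves room for the smooth approximants
  and covers functions of norm \<open>0\<close>.\<close>

lemma pd_eqI:
  assumes "(F has_derivative F') (at x)"
  shows "pd i F x = F' (axis i 1)"
  using frechet_derivative_at[OF assms] by (simp add: pd_def)

lemma pd_transform:
  assumes "open U" "x \<in> U" "\<And>y. y \<in> U \<Longrightarrow> F y = G y"
  shows "pd i F x = pd i G x"
proof -
  have "(F has_derivative D) (at x) \<longleftrightarrow> (G has_derivative D) (at x)" for D
    using has_derivative_transform_within_open[OF _ assms(1,2)] assms(3) by metis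
  then show ?thesis
    by (simp add: pd_def frechet_derivative_def)
qed

lemma differentiable_transform_open:
  assumes "open U" "x \<in> U" "\<And>y. y \<in> U \<Longrightarrow> F y = G y"
  shows "F differentiable at x \<longleftrightarrow> G differentiable at x"
  using has_derivative_transform_within_open[OF _ assms(1,2)] assms(3)
  unfolding differentiable_def by metis

text \<open>On an open set a partial derivative depends only on nearby values, so agreement on
  \<open>U\<close> passes to all derivatives. The closure rules below use this to replace
  \<open>pd i\<close> of a compound function by a formula valid on \<open>U\<close> only.\<close>

lemma C_k_on_cong:
  assumes "open U" "\<And>y. y \<in> U \<Longrightarrow> F y = G y"
  shows "C_k_on k U F \<longleftrightarrow> C_k_on k U G"
  using assms(2)
proof (induction k arbitrary: F G)
  case 0
  then show ?case by (simp cong: continuous_on_cong)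
next
  case (Suc k)
  have "C_k_on k U (pd i F) \<longleftrightarrow> C_k_on k U (pd i G)" for i
    using Suc.IH pd_transform[OF assms(1)] Suc.prems by blast
  then show ?case
    using differentiable_transform_open[OF assms(1) _ Suc.prems] by simp
qed

lemma C_k_on_imp_continuous_on: "C_k_on k U F \<Longrightarrow> continuous_on U F"
  by (cases k)
     (auto intro: continuous_at_imp_continuous_on differentiable_imp_continuous_within)

lemma C_k_on_SucD: "C_k_on (Suc k) U F \<Longrightarrow> C_k_on k U F"
proof (induction k arbitrary: F)
  case 0
  then show ?case using C_k_on_imp_continuous_on C_k_on.simps(1) by blast
next
  case (Suc k)
  then show ?case by (metis C_k_on.simps(2))
qed

lemma C_k_on_const: "C_k_on k U (\<lambda>x. c)"
proof (induction k arbitrary: c)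
  case (Suc k)
  have "pd i (\<lambda>x. c) = (\<lambda>x. 0)" for i
    by (simp add: pd_def fun_eq_iff)
  with Suc show ?case by simp
qed simp

lemma C_k_on_component: "C_k_on k U (\<lambda>x. x $ j)"
proof (cases k)
  case (Suc m)
  have d: "((\<lambda>x. x $ j) has_derivative (\<lambda>h. h $ j)) (at x)" for x :: "real^5"
    by (rule bounded_linear_imp_has_derivative) (rule bounded_linear_vec_nth)
  have "pd i (\<lambda>x. x $ j) = (\<lambda>x. axis i 1 $ j)" for i
    using pd_eqI[OF d] by (simp add: fun_eq_iff)
  moreover have "(\<lambda>x. x $ j) differentiable at x" for x :: "real^5"
    using d unfolding differentiable_def by blast
  ultimately show ?thesis
    using C_k_on_const Suc by simp
qed (auto intro!: continuous_intros)

lemma pd_add: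
  assumes "F differentiable at x" "G differentiable at x"
  shows "pd i (\<lambda>x. F x + G x) x = pd i F x + pd i G x"
proof -
  obtain F' G' where "(F has_derivative F') (at x)" "(G has_derivative G') (at x)"
    using assms by (auto simp: differentiable_def)
  from pd_eqI[OF has_derivative_add[OF this]] pd_eqI[OF this(1)] pd_eqI[OF this(2)]
  show ?thesis by simp
qed

lemma pd_mult:
  assumes "F differentiable at x" "G differentiable at x"
  shows "pd i (\<lambda>x. F x * G x) x = F x * pd i G x + pd i F x * G x"
proof -
  obtain F' G' where "(F has_derivative F') (at x)" "(G has_derivative G') (at x)"
    using assms by (auto simp: differentiable_def)
  from pd_eqI[OF has_derivative_mult[OF this]] pd_eqI[OF this(1)] pd_eqI[OF this(2)]
  show ?thesis by simp
qed

text \<open>The derivative is left as a product with the constant \<open>- 1\<close>, the shape to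
  which \<open>C_k_on_mult\<close> and \<open>C_k_on_const\<close> apply in
  \<open>C_k_on_inverse\<close>.\<close>

lemma pd_inverse:
  assumes "F differentiable at x" "F x \<noteq> 0"
  shows "pd i (\<lambda>x. inverse (F x)) x = - 1 * (pd i F x * (inverse (F x) * inverse (F x)))"
proof -
  obtain F' where F': "(F has_derivative F') (at x)"
    using assms(1) by (auto simp: differentiable_def)
  show ?thesis
    using pd_eqI[OF Deriv.has_derivative_inverse[OF assms(2) F'], of i] pd_eqI[OF F', of i]
    by (simp add: algebra_simps)
qed

lemma C_k_on_add:
  assumes "open U" "C_k_on k U F" "C_k_on k U G"
  shows "C_k_on k U (\<lambda>x. F x + G x)"
  using assms(2,3)
proof (induction k arbitrary: F G)
  case (Suc k)
  then have "C_k_on k U (\<lambda>x. pd i F x + pd i G x)" for i by auto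
  moreover have "C_k_on k U (pd i (\<lambda>x. F x + G x)) \<longleftrightarrow> C_k_on k U (\<lambda>x. pd i F x + pd i G x)" for i
    using Suc.prems by (intro C_k_on_cong[OF assms(1)] pd_add) auto
  ultimately show ?case using Suc.prems by auto
qed (auto intro: continuous_intros)

lemma C_k_on_mult:
  assumes "open U" "C_k_on k U F" "C_k_on k U G"
  shows "C_k_on k U (\<lambda>x. F x * G x)"
  using assms(2,3)
proof (induction k arbitrary: F G)
  case (Suc k)
  have "C_k_on k U (\<lambda>x. F x * pd i G x + pd i F x * G x)" for i
    using Suc.prems
    by (intro C_k_on_add assms(1) Suc.IH) (auto intro: C_k_on_SucD simp del: C_k_on.simps(1))
  moreover have "C_k_on k U (pd i (\<lambda>x. F x * G x))
      \<longleftrightarrow> C_k_on k U (\<lambda>x. F x * pd i G x + pd i F x * G x)" for i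
    using Suc.prems by (intro C_k_on_cong[OF assms(1)] pd_mult) auto
  ultimately show ?case using Suc.prems by auto
qed (auto intro: continuous_intros)

lemma C_k_on_inverse:
  assumes "open U" "C_k_on k U F" "\<And>x. x \<in> U \<Longrightarrow> F x \<noteq> 0"
  shows "C_k_on k U (\<lambda>x. inverse (F x))"
  using assms(2)
proof (induction k)
  case 0
  then show ?case using assms(3) by (auto intro!: continuous_intros)
next
  case (Suc k)
  have inv: "C_k_on k U (\<lambda>x. inverse (F x))"
    using Suc C_k_on_SucD by blast
  have "C_k_on k U (\<lambda>x. - 1 * (pd i F x * (inverse (F x) * inverse (F x))))" for i
    using Suc.prems by (intro C_k_on_mult assms(1) inv C_k_on_const) auto
  moreover have "C_k_on k U (pd i (\<lambda>x. inverse (F x)))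
      \<longleftrightarrow> C_k_on k U (\<lambda>x. - 1 * (pd i F x * (inverse (F x) * inverse (F x))))" for i
    using Suc.prems assms(3) by (intro C_k_on_cong[OF assms(1)] pd_inverse) auto
  ultimately show ?case using Suc.prems assms(3) by auto
qed

lemma has_derivative_norm_powr:
  fixes x :: "real^5"
  assumes "x \<noteq> 0"
  shows "((\<lambda>x. norm x powr a) has_derivative (\<lambda>h. a * norm x powr (a - 2) * (x \<bullet> h))) (at x)"
proof -
  have "((\<lambda>x. norm x powr a) has_derivative
      (\<lambda>h. norm x powr a * (0 * ln (norm x) + (h \<bullet> sgn x) * a / norm x))) (at x)"
    using assms by (intro has_derivative_powr has_derivative_norm) auto
  moreover have "norm x powr a * (0 * ln (norm x) + (h \<bullet> sgn x) * a / norm x)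
      = a * norm x powr (a - 2) * (x \<bullet> h)" for h
    using assms by (simp add: sgn_div_norm powr_diff field_simps power2_eq_square inner_commute)
  ultimately show ?thesis by simp
qed

lemma pd_norm_powr:
  assumes "x \<noteq> 0"
  shows "pd i (\<lambda>x. norm x powr a) x = a * (norm x powr (a - 2) * (x $ i))"
  using pd_eqI[OF has_derivative_norm_powr[OF assms], of i a] by (simp add: inner_axis)

text \<open>The exponent is generalised in the induction because each derivative lowers it by two
  and produces a factor \<open>x $ i\<close>.\<close>

lemma C_k_on_norm_powr: "C_k_on k (- {0}) (\<lambda>x. norm x powr a)"
proof (induction k arbitrary: a)
  case 0
  show ?case by (auto intro!: continuous_intros)
next
  case (Suc k)
  have "C_k_on k (- {0}) (\<lambda>x. a * (norm x powr (a - 2) * (x $ i)))" for i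
    by (intro C_k_on_mult C_k_on_const C_k_on_component Suc) auto
  moreover have "C_k_on k (- {0}) (pd i (\<lambda>x. norm x powr a))
      \<longleftrightarrow> C_k_on k (- {0}) (\<lambda>x. a * (norm x powr (a - 2) * (x $ i)))" for i
    by (intro C_k_on_cong) (auto simp: pd_norm_powr)
  moreover have "(\<lambda>x. norm x powr a) differentiable at x" if "x \<noteq> 0" for x :: "real^5"
    using has_derivative_norm_powr[OF that] by (auto simp: differentiable_def)
  ultimately show ?case by auto
qed

section \<open>Closure properties of smooth functions on the sphere\<close>

lemma smooth_S4_const [simp]: "smooth_S4 (\<lambda>x. c)"
  by (simp add: smooth_S4_def comp_def C_k_on_const)

lemma smooth_S4_add: "smooth_S4 f \<Longrightarrow> smooth_S4 g \<Longrightarrow> smooth_S4 (\<lambda>x. f x + g x)"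
  unfolding smooth_S4_def comp_def
  by (rule allI, rule C_k_on_add[OF open_Compl[OF closed_singleton]]; erule spec)

lemma smooth_S4_mult: "smooth_S4 f \<Longrightarrow> smooth_S4 g \<Longrightarrow> smooth_S4 (\<lambda>x. f x * g x)"
  unfolding smooth_S4_def comp_def
  by (rule allI, rule C_k_on_mult[OF open_Compl[OF closed_singleton]]; erule spec)

lemma smooth_S4_minus: "smooth_S4 f \<Longrightarrow> smooth_S4 (\<lambda>x. - f x)"
  using smooth_S4_mult[OF smooth_S4_const[of "- 1"]] by simp

lemma smooth_S4_diff: "smooth_S4 f \<Longrightarrow> smooth_S4 g \<Longrightarrow> smooth_S4 (\<lambda>x. f x - g x)"
  using smooth_S4_add[of f "\<lambda>x. - g x"] smooth_S4_minus[of g] by simp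

lemma smooth_S4_sum:
  assumes "\<And>a. a \<in> A \<Longrightarrow> smooth_S4 (f a)"
  shows "smooth_S4 (\<lambda>x. \<Sum>a\<in>A. f a x)"
  using assms
proof (induction A rule: infinite_finite_induct)
  case (insert a A)
  then show ?case
    using smooth_S4_add[of "f a" "\<lambda>x. \<Sum>a\<in>A. f a x"] by simp
qed simp_all

lemma smooth_S4_power: "smooth_S4 f \<Longrightarrow> smooth_S4 (\<lambda>x. f x ^ n)"
  by (induction n) (auto intro: smooth_S4_mult)

lemma sgn_S4: "x \<in> S4 \<Longrightarrow> sgn x = x"
  by (simp add: sgn_div_norm)

lemma sgn_in_S4: "x \<noteq> 0 \<Longrightarrow> sgn x \<in> S4"
  by (simp add: norm_sgn)

lemma S4_neq_0: "x \<in> S4 \<Longrightarrow> x \<noteq> 0"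
  by auto

lemma smooth_S4_inverse:
  assumes "smooth_S4 f" "\<And>x. x \<in> S4 \<Longrightarrow> f x \<noteq> 0"
  shows "smooth_S4 (\<lambda>x. inverse (f x))"
  using assms C_k_on_inverse[of "- {0}" _ "f \<circ> sgn"] sgn_in_S4 by (auto simp: smooth_S4_def comp_def)

lemma smooth_S4_component [simp]: "smooth_S4 (\<lambda>x. x $ j)"
  unfolding smooth_S4_def
proof
  fix k
  have "C_k_on k (- {0}) (\<lambda>x. norm x powr (- 1) * x $ j)"
    by (intro C_k_on_mult C_k_on_norm_powr C_k_on_component) auto
  moreover have "C_k_on k (- {0}) ((\<lambda>x. x $ j) \<circ> sgn) \<longleftrightarrow> C_k_on k (- {0}) (\<lambda>x. norm x powr (- 1) * x $ j)"
    by (intro C_k_on_cong) (auto simp: sgn_div_norm powr_minus)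
  ultimately show "C_k_on k (- {0}) ((\<lambda>x. x $ j) \<circ> sgn)" by simp
qed

lemma smooth_S4_inner [simp]: "smooth_S4 (\<lambda>y. x \<bullet> y)"
  unfolding inner_vec_def by (intro smooth_S4_sum) (auto intro: smooth_S4_mult)

lemma smooth_S4_continuous_on: "smooth_S4 f \<Longrightarrow> continuous_on S4 f"
proof -
  assume "smooth_S4 f"
  then have "continuous_on (- {0}) (f \<circ> sgn)"
    using C_k_on_imp_continuous_on unfolding smooth_S4_def by blast
  then have "continuous_on S4 (f \<circ> sgn)"
    by (rule continuous_on_subset) auto
  then show "continuous_on S4 f"
    by (rule continuous_on_eq) (auto simp: sgn_div_norm)
qed

lemma smooth_S4_differentiable:
  assumes "smooth_S4 f" "x \<noteq> 0"
  shows "(f \<circ> sgn) differentiable at x"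
proof -
  have "C_k_on (Suc 0) (- {0}) (f \<circ> sgn)"
    using assms(1) unfolding smooth_S4_def by blast
  then have "\<forall>x\<in>- {0}. (f \<circ> sgn) differentiable at x"
    unfolding C_k_on.simps by (rule conjunct1)
  with assms(2) show ?thesis by blast
qed

section \<open>Tangential derivatives: homogeneity, tangency and differentiation rules\<close>

definition tang_deriv :: "5 \<Rightarrow> (real^5 \<Rightarrow> real) \<Rightarrow> real^5 \<Rightarrow> real" where
  "tang_deriv i f = pd i (f \<circ> sgn)"

lemma has_derivative_tang_deriv:
  assumes "smooth_S4 f" "x \<noteq> 0"
  shows "((f \<circ> sgn) has_derivative (\<lambda>h. \<Sum>i\<in>UNIV. h $ i * tang_deriv i f x)) (at x)"
proof -
  let ?D = "frechet_derivative (f \<circ> sgn) (at x)"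
  have D: "((f \<circ> sgn) has_derivative ?D) (at x)"
    using smooth_S4_differentiable[OF assms] frechet_derivative_works by blast
  then have lin: "linear ?D"
    using has_derivative_linear by blast
  have "?D h = (\<Sum>i\<in>UNIV. h $ i * tang_deriv i f x)" for h
  proof -
    have "?D h = ?D (\<Sum>i\<in>UNIV. h $ i *\<^sub>R axis i 1)"
      by (metis (no_types, lifting) basis_expansion scalar_mult_eq_scaleR sum.cong)
    also have "\<dots> = (\<Sum>i\<in>UNIV. h $ i * tang_deriv i f x)"
      by (simp add: linear_sum[OF lin] linear_cmul[OF lin] tang_deriv_def pd_def)
    finally show ?thesis .
  qed
  then have "?D = (\<lambda>h. \<Sum>i\<in>UNIV. h $ i * tang_deriv i f x)" by blast
  with D show ?thesis by simp
qed

lemma tang_deriv_eqI: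
  assumes "((f \<circ> sgn) has_derivative F') (at x)"
  shows "tang_deriv i f x = F' (axis i 1)"
  using pd_eqI[OF assms] by (simp add: tang_deriv_def)

lemma tang_deriv_cong:
  assumes "\<And>y. y \<in> S4 \<Longrightarrow> f y = g y" "x \<noteq> 0"
  shows "tang_deriv i f x = tang_deriv i g x"
  unfolding tang_deriv_def
  using assms sgn_in_S4 by (intro pd_transform[of "- {0}"]) auto

text \<open>\<open>f \<circ> sgn\<close> is invariant under dilations, so its partial derivatives
  are homogeneous of degree \<open>- 1\<close>. Hence \<open>tang_deriv i f\<close> differs from its
  own degree \<open>0\<close> extension by a power of the norm, which has to be accounted for in
  second derivatives.\<close>

lemma tang_deriv_scale:
  assumes "smooth_S4 f" "x \<noteq> 0"
  shows "tang_deriv i f (sgn x) = norm x * tang_deriv i f x"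
proof -
  let ?c = "inverse (norm x)"
  have c: "?c > 0" using assms(2) by simp
  have sx: "sgn x = ?c *\<^sub>R x" by (simp add: sgn_div_norm)
  have "sgn x \<noteq> 0" using assms(2) by (simp add: sgn_zero_iff)
  then have "((f \<circ> sgn) has_derivative (\<lambda>h. \<Sum>i\<in>UNIV. h $ i * tang_deriv i f (sgn x))) (at (sgn x))"
    by (rule has_derivative_tang_deriv[OF assms(1)])
  then have outer: "((f \<circ> sgn) has_derivative (\<lambda>h. \<Sum>i\<in>UNIV. h $ i * tang_deriv i f (sgn x))) (at (?c *\<^sub>R x))"
    by (subst sx[symmetric])
  have "((f \<circ> sgn \<circ> (\<lambda>y. ?c *\<^sub>R y)) has_derivative
      ((\<lambda>h. \<Sum>i\<in>UNIV. h $ i * tang_deriv i f (sgn x)) \<circ> (\<lambda>y. ?c *\<^sub>R y))) (at x)"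
    by (intro diff_chain_at outer) (auto intro!: derivative_eq_intros)
  moreover have "f \<circ> sgn \<circ> (\<lambda>y. ?c *\<^sub>R y) = f \<circ> sgn"
    using c by (auto simp: fun_eq_iff sgn_scaleR)
  ultimately have "tang_deriv i f x = (\<Sum>j\<in>UNIV. (?c *\<^sub>R axis i 1 :: real^5) $ j * tang_deriv j f (sgn x))"
    using tang_deriv_eqI[of f "(\<lambda>h. \<Sum>i\<in>UNIV. h $ i * tang_deriv i f (sgn x)) \<circ> (\<lambda>y. ?c *\<^sub>R y)" x i]
    by simp
  also have "\<dots> = ?c * tang_deriv i f (sgn x)"
    by (subst sum.remove[of _ i]) (simp_all add: axis_def)
  finally show ?thesis using assms(2) by (simp add: field_simps)
qed

lemma smooth_S4_tang_deriv [simp]: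
  assumes "smooth_S4 f"
  shows "smooth_S4 (tang_deriv i f)"
  unfolding smooth_S4_def
proof
  fix k
  have "C_k_on k (- {0}) (pd i (f \<circ> sgn))"
    using assms C_k_on.simps(2) unfolding smooth_S4_def by blast
  then have "C_k_on k (- {0}) (\<lambda>x. norm x powr 1 * tang_deriv i f x)"
    by (intro C_k_on_mult C_k_on_norm_powr) (auto simp: tang_deriv_def)
  moreover have "C_k_on k (- {0}) (tang_deriv i f \<circ> sgn)
      \<longleftrightarrow> C_k_on k (- {0}) (\<lambda>x. norm x powr 1 * tang_deriv i f x)"
    by (intro C_k_on_cong) (auto simp: tang_deriv_scale assms)
  ultimately show "C_k_on k (- {0}) (tang_deriv i f \<circ> sgn)" by simp
qed

text \<open>\<open>f \<circ> sgn\<close> is constant along the ray through \<open>x\<close>; its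
  derivative along that ray at parameter \<open>1\<close> is the sum in question.\<close>

lemma tang_deriv_normal:
  assumes "smooth_S4 f" "x \<noteq> 0"
  shows "(\<Sum>i\<in>UNIV. x $ i * tang_deriv i f x) = 0"
proof -
  have "((f \<circ> sgn \<circ> (\<lambda>t. t *\<^sub>R x)) has_derivative
     ((\<lambda>h. \<Sum>i\<in>UNIV. h $ i * tang_deriv i f x) \<circ> (\<lambda>t. t *\<^sub>R x))) (at 1)"
    using has_derivative_tang_deriv[OF assms]
    by (intro diff_chain_at) (auto intro!: derivative_eq_intros)
  moreover have "((f \<circ> sgn \<circ> (\<lambda>t. t *\<^sub>R x)) has_derivative (\<lambda>t. 0)) (at 1)"
    by (rule has_derivative_transform_within_open[of "\<lambda>t. f (sgn x)" _ _ _ "{0<..}"])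
       (auto simp: sgn_scaleR)
  ultimately have "(\<lambda>h. \<Sum>i\<in>UNIV. h $ i * tang_deriv i f x) \<circ> (\<lambda>t. t *\<^sub>R x) = (\<lambda>t. 0)"
    using has_derivative_unique by blast
  from fun_cong[OF this, of 1] show ?thesis by simp
qed

lemma tang_deriv_const [simp]: "tang_deriv i (\<lambda>x. c) x = 0"
  by (simp add: tang_deriv_def comp_def pd_def)

lemma tang_deriv_add:
  assumes "smooth_S4 f" "smooth_S4 g" "x \<noteq> 0"
  shows "tang_deriv i (\<lambda>x. f x + g x) x = tang_deriv i f x + tang_deriv i g x"
  using pd_add[of "f \<circ> sgn" x "g \<circ> sgn" i] assms smooth_S4_differentiable
  by (auto simp: tang_deriv_def comp_def)

lemma tang_deriv_mult:
  assumes "smooth_S4 f" "smooth_S4 g" "x \<in> S4"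
  shows "tang_deriv i (\<lambda>x. f x * g x) x = f x * tang_deriv i g x + tang_deriv i f x * g x"
  using pd_mult[of "f \<circ> sgn" x "g \<circ> sgn" i] assms smooth_S4_differentiable S4_neq_0
  by (auto simp: tang_deriv_def comp_def sgn_div_norm)

lemma tang_deriv_cmult:
  assumes "smooth_S4 f" "x \<noteq> 0"
  shows "tang_deriv i (\<lambda>x. c * f x) x = c * tang_deriv i f x"
  using pd_mult[of "\<lambda>x. c" x "f \<circ> sgn" i] assms smooth_S4_differentiable
  by (auto simp: tang_deriv_def comp_def pd_def)

lemma tang_deriv_diff:
  assumes "smooth_S4 f" "smooth_S4 g" "x \<noteq> 0"
  shows "tang_deriv i (\<lambda>x. f x - g x) x = tang_deriv i f x - tang_deriv i g x"
  using tang_deriv_add[OF assms(1) smooth_S4_minus[OF assms(2)] assms(3), of i]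
    tang_deriv_cmult[OF assms(2,3), of i "- 1"] by simp

lemma tang_deriv_sum:
  assumes "\<And>a. a \<in> A \<Longrightarrow> smooth_S4 (f a)" "x \<noteq> 0"
  shows "tang_deriv i (\<lambda>x. \<Sum>a\<in>A. f a x) x = (\<Sum>a\<in>A. tang_deriv i (f a) x)"
  using assms(1)
  by (induction A rule: infinite_finite_induct)
     (auto simp: tang_deriv_add smooth_S4_sum assms(2))

lemma tang_deriv_inverse:
  assumes "smooth_S4 f" "x \<in> S4" "f x \<noteq> 0"
  shows "tang_deriv i (\<lambda>x. inverse (f x)) x = - tang_deriv i f x / (f x)\<^sup>2"
  using pd_inverse[of "f \<circ> sgn" x i] assms smooth_S4_differentiable S4_neq_0
  by (auto simp: tang_deriv_def comp_def sgn_div_norm field_simps power2_eq_square)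

text \<open>The gradient of a coordinate is the projected basis vector, so these are the entries of
  \<open>tangent_proj x\<close>.\<close>

lemma tang_deriv_component:
  assumes "x \<in> S4"
  shows "tang_deriv i (\<lambda>x. x $ j) x = (if i = j then 1 else 0) - x $ i * x $ j"
proof -
  have x: "x \<noteq> 0" using assms by auto
  have "tang_deriv i (\<lambda>x. x $ j) x = pd i (\<lambda>x. norm x powr (- 1) * x $ j) x"
    unfolding tang_deriv_def
    using x by (intro pd_transform[of "- {0}"]) (auto simp: sgn_div_norm powr_minus)
  also have "\<dots> = norm x powr (- 1) * pd i (\<lambda>x. x $ j) x + pd i (\<lambda>x. norm x powr (- 1)) x * x $ j"
    using has_derivative_norm_powr[OF x] bounded_linear_imp_has_derivative[OF bounded_linear_vec_nth]
    by (intro pd_mult) (unfold differentiable_def, blast+)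
  also have "pd i (\<lambda>x. x $ j) x = axis i 1 $ j"
    by (intro pd_eqI bounded_linear_imp_has_derivative bounded_linear_vec_nth)
  also have "pd i (\<lambda>x. norm x powr (- 1)) x = - x $ i"
    using assms by (simp only: pd_norm_powr[OF x]) simp
  finally show ?thesis
    using assms by (simp add: axis_def)
qed

lemma sum_S4_squares: "x \<in> S4 \<Longrightarrow> (\<Sum>i\<in>UNIV. x $ i * x $ i) = 1"
  by (metis dist_0_norm inner_real_def inner_vec_def mem_sphere norm_eq_1)

subsection \<open>Rotation invariance and integration by parts\<close>

abbreviation \<sigma> :: "(real^5) measure" where "\<sigma> \<equiv> sphere_measure"

lemma finite_measure_sphere: "finite_measure \<sigma>"
proof
  show "emeasure \<sigma> (space \<sigma>) \<noteq> \<infinity>"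
    using measure_S4 by (auto simp: measure_def)
qed

interpretation sphere: finite_measure \<sigma>
  by (rule finite_measure_sphere)

interpretation sphere_pair: pair_sigma_finite \<sigma> \<sigma> ..

lemma measurable_sphere_ident [measurable]: "(\<lambda>x. x) \<in> borel_measurable \<sigma>"
proof -
  have "(\<lambda>x. x) \<in> measurable (restrict_space borel S4) borel"
    by (intro measurable_restrict_space1) simp
  then show ?thesis by (simp cong: measurable_cong_sets)
qed

lemma continuous_on_S4_measurable [measurable (raw)]:
  fixes f :: "real^5 \<Rightarrow> 'b::topological_space"
  assumes "continuous_on S4 f"
  shows "f \<in> borel_measurable \<sigma>"
  using borel_measurable_continuous_on_restrict[OF assms] by (simp cong: measurable_cong_sets)

lemma continuous_on_S4_bounded:
  fixes f :: "real^5 \<Rightarrow> real"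
  assumes "continuous_on S4 f"
  obtains B where "B > 0" "\<And>x. x \<in> S4 \<Longrightarrow> \<bar>f x\<bar> \<le> B"
  using compact_imp_bounded[OF compact_continuous_image[OF assms compact_sphere]]
  by (metis bounded_pos imageI real_norm_def)

lemma continuous_on_S4_integrable:
  fixes f :: "real^5 \<Rightarrow> real"
  assumes "continuous_on S4 f"
  shows "integrable \<sigma> f"
proof -
  obtain B where "B > 0" "\<And>x. x \<in> S4 \<Longrightarrow> \<bar>f x\<bar> \<le> B"
    using continuous_on_S4_bounded[OF assms] by blast
  with assms show ?thesis
    by (intro sphere.integrable_const_bound[of _ B]) (auto intro!: continuous_on_S4_measurable)
qed

lemma orthogonal_transformation_sgn:
  "orthogonal_transformation T \<Longrightarrow> sgn (T x) = T (sgn x)"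
  by (simp add: sgn_div_norm orthogonal_transformation_norm orthogonal_transformation_scaleR)

lemma emeasure_sphere:
  assumes "A \<in> sets \<sigma>"
  shows "emeasure \<sigma> A = 5 * emeasure lborel (sgn -` A \<inter> (ball 0 1 - {0}))"
    and "sgn -` A \<inter> (ball 0 1 - {0}) \<in> sets lborel"
proof -
  let ?B = "ball 0 1 - {0 :: real^5}"
  have A: "A \<in> sets (restrict_space borel S4)" using assms by simp
  have m: "sgn -` A \<inter> ?B \<in> sets (restrict_space lborel ?B)"
    using measurable_sets[OF sgn_measurable_S4 A] by (simp add: space_restrict_space)
  show "sgn -` A \<inter> ?B \<in> sets lborel"
    using m by (subst (asm) sets_restrict_space_iff) auto
  have "emeasure \<sigma> A = 5 * emeasure (restrict_space lborel ?B) (sgn -` A \<inter> ?B)"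
    unfolding sphere_measure_def emeasure_scale_measure
    by (subst emeasure_distr[OF sgn_measurable_S4 A]) (simp add: space_restrict_space)
  also have "emeasure (restrict_space lborel ?B) (sgn -` A \<inter> ?B) = emeasure lborel (sgn -` A \<inter> ?B)"
    by (intro emeasure_restrict_space) auto
  finally show "emeasure \<sigma> A = 5 * emeasure lborel (sgn -` A \<inter> ?B)" .
qed

lemma measurable_orthogonal_sphere:
  assumes "orthogonal_transformation (T :: real^5 \<Rightarrow> real^5)"
  shows "T \<in> measurable \<sigma> \<sigma>"
proof -
  have "continuous_on S4 T"
    using assms linear_continuous_on linear_conv_bounded_linear orthogonal_transformation_linear by blast
  then have "T \<in> borel_measurable \<sigma>" by (rule continuous_on_S4_measurable)
  then have "T \<in> measurable \<sigma> (restrict_space borel S4)"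
    by (rule measurable_restrict_space2[rotated]) (auto simp: orthogonal_transformation_norm assms)
  then show ?thesis by (simp cong: measurable_cong_sets)
qed

text \<open>An orthogonal map commutes with \<open>sgn\<close> and carries the cone over the
  preimage of \<open>A\<close> onto the cone over \<open>A\<close>; Lebesgue measure is invariant
  under it.\<close>

lemma distr_orthogonal_sphere:
  fixes T :: "real^5 \<Rightarrow> real^5"
  assumes T: "orthogonal_transformation T"
  shows "distr \<sigma> \<sigma> T = \<sigma>"
proof (rule measure_eqI)
  fix A assume "A \<in> sets (distr \<sigma> \<sigma> T)"
  then have A: "A \<in> sets \<sigma>" by simp
  let ?B = "ball 0 1 - {0 :: real^5}"
  let ?C = "\<lambda>A. sgn -` A \<inter> ?B"
  have TA: "T -` A \<inter> space \<sigma> \<in> sets \<sigma>"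
    using measurable_sets[OF measurable_orthogonal_sphere[OF T] A] .
  have A1: "A \<subseteq> S4" using sets.sets_into_space[OF A] by simp
  \<comment> \<open>The invariance of volume is available for \<open>lmeasurable\<close> sets, hence
    the detour from \<open>lborel\<close> through \<open>lebesgue\<close>; the cones have finite
    measure because they are bounded.\<close>
  have lm: "?C A \<in> lmeasurable" if "A \<in> sets \<sigma>" for A
    using emeasure_sphere(2)[OF that]
    by (intro bounded_set_imp_lmeasurable) (auto intro: bounded_subset[OF bounded_ball])
  have inj: "T x = 0 \<longleftrightarrow> x = 0" for x
    using orthogonal_transformation_norm[OF T, of x] by (metis norm_eq_zero)
  have img: "T ` ?C (T -` A \<inter> space \<sigma>) = ?C A"
  proof (intro equalityI subsetI)
    fix y assume "y \<in> T ` ?C (T -` A \<inter> space \<sigma>)"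
    then show "y \<in> ?C A"
      by (auto simp: orthogonal_transformation_norm[OF T] orthogonal_transformation_sgn[OF T] inj)
  next
    fix y assume y: "y \<in> ?C A"
    obtain x where x: "y = T x"
      using orthogonal_transformation_surj[OF T] by (metis surjD)
    have "x \<in> ?C (T -` A \<inter> space \<sigma>)"
      using y x inj
      by (auto simp: orthogonal_transformation_norm[OF T] orthogonal_transformation_sgn[OF T] norm_sgn)
    then show "y \<in> T ` ?C (T -` A \<inter> space \<sigma>)" using x by blast
  qed
  have "measure lebesgue (?C A) = measure lebesgue (?C (T -` A \<inter> space \<sigma>))"
    using measure_orthogonal_image[OF T lm[OF TA]] img by simp
  then have "emeasure lebesgue (?C A) = emeasure lebesgue (?C (T -` A \<inter> space \<sigma>))"
    unfolding emeasure_eq_measure2[OF lm[OF A]] emeasure_eq_measure2[OF lm[OF TA]] by (rule arg_cong)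
  then have "emeasure lborel (?C A) = emeasure lborel (?C (T -` A \<inter> space \<sigma>))"
    using emeasure_sphere(2)[OF A] emeasure_sphere(2)[OF TA] by simp
  then have "emeasure \<sigma> (T -` A \<inter> space \<sigma>) = emeasure \<sigma> A"
    using emeasure_sphere(1)[OF A] emeasure_sphere(1)[OF TA] by simp
  then show "emeasure (distr \<sigma> \<sigma> T) A = emeasure \<sigma> A"
    by (simp add: emeasure_distr[OF measurable_orthogonal_sphere[OF T] A])
qed simp

lemma integral_orthogonal_sphere:
  fixes T :: "real^5 \<Rightarrow> real^5" and f :: "real^5 \<Rightarrow> real"
  assumes "orthogonal_transformation T" "f \<in> borel_measurable \<sigma>"
  shows "(\<integral>x. f (T x) \<partial>\<sigma>) = (\<integral>x. f x \<partial>\<sigma>)"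
  using integral_distr[OF measurable_orthogonal_sphere[OF assms(1)] assms(2)]
    distr_orthogonal_sphere[OF assms(1)] by simp

section \<open>Coordinate rotations, their generating fields and integration by parts\<close>

definition plane_rotation :: "5 \<Rightarrow> 5 \<Rightarrow> real \<Rightarrow> real^5 \<Rightarrow> real^5" where
  "plane_rotation i j t x = (\<chi> k. if k = i then cos t * x $ i - sin t * x $ j
     else if k = j then sin t * x $ i + cos t * x $ j else x $ k)"

lemma orthogonal_plane_rotation:
  assumes "i \<noteq> j"
  shows "orthogonal_transformation (plane_rotation i j t)"
proof -
  have lin: "linear (plane_rotation i j t)"
    by (rule linearI) (auto simp: plane_rotation_def vec_eq_iff algebra_simps)
  have "plane_rotation i j t x \<bullet> plane_rotation i j t x = x \<bullet> x" for x
  proof -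
    have split: "(\<Sum>k\<in>UNIV. f k) = f i + (f j + (\<Sum>k\<in>UNIV - {i} - {j}. f k))" for f :: "5 \<Rightarrow> real"
      using assms by (simp add: sum.remove[of _ i] sum.remove[of _ j])
    have "(\<Sum>k\<in>UNIV - {i} - {j}. plane_rotation i j t x $ k * plane_rotation i j t x $ k)
        = (\<Sum>k\<in>UNIV - {i} - {j}. x $ k * x $ k)"
      by (intro sum.cong) (auto simp: plane_rotation_def)
    moreover have "(cos t * x $ i - sin t * x $ j)\<^sup>2 + (sin t * x $ i + cos t * x $ j)\<^sup>2
        = ((sin t)\<^sup>2 + (cos t)\<^sup>2) * ((x $ i)\<^sup>2 + (x $ j)\<^sup>2)"
      by algebra
    then have "(cos t * x $ i - sin t * x $ j)\<^sup>2 + (sin t * x $ i + cos t * x $ j)\<^sup>2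
        = (x $ i)\<^sup>2 + (x $ j)\<^sup>2"
      by simp
    ultimately show ?thesis
      using assms unfolding inner_vec_def split
      by (simp add: plane_rotation_def power2_eq_square)
  qed
  with lin show ?thesis
    by (simp add: orthogonal_transformation norm_eq_sqrt_inner)
qed

lemma has_derivative_plane_rotation:
  "((\<lambda>t. plane_rotation i j t x) has_vector_derivative
     (\<chi> k. if k = i then - (plane_rotation i j t x $ j)
           else if k = j then plane_rotation i j t x $ i else 0)) (at t)" if "i \<noteq> j"
proof -
  have "((\<lambda>t. plane_rotation i j t x $ k) has_vector_derivative
     (if k = i then - (plane_rotation i j t x $ j)
           else if k = j then plane_rotation i j t x $ i else 0)) (at t)" for k
    unfolding has_real_derivative_iff_has_vector_derivative[symmetric] plane_rotation_def
    using that by (auto intro!: derivative_eq_intros simp: algebra_simps)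
  then show ?thesis
    unfolding has_vector_derivative_def
    by (subst has_derivative_componentwise_within) (simp add: Basis_vec_def inner_axis image_iff)
qed

text \<open>The field is the infinitesimal generator of the rotation, evaluated at the moving point.
  The formula is stated for every \<open>t\<close>, not only \<open>t = 0\<close>, because
  \<open>integral_rotation_field\<close> applies the mean value theorem to it.\<close>

lemma has_derivative_along_rotation:
  assumes "smooth_S4 f" "x \<in> S4" "i \<noteq> j"
  defines "R \<equiv> \<lambda>t. plane_rotation i j t x"
  shows "((\<lambda>t. f (R t)) has_real_derivative
     (R t $ i * tang_deriv j f (R t) - R t $ j * tang_deriv i f (R t))) (at t)"
proof -
  have nR: "norm (R t) = 1" for t
    using assms orthogonal_transformation_norm[OF orthogonal_plane_rotation[OF assms(3)]]
    by simp
  then have "R t \<noteq> 0" by (metis norm_zero zero_neq_one)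
  let ?V = "\<chi> k. if k = i then - (R t $ j) else if k = j then R t $ i else 0"
  have "(R has_derivative (\<lambda>s. s *\<^sub>R ?V)) (at t)"
    using has_derivative_plane_rotation[OF assms(3)] unfolding R_def has_vector_derivative_def by simp
  then have "((f \<circ> sgn \<circ> R) has_derivative
      ((\<lambda>h. \<Sum>k\<in>UNIV. h $ k * tang_deriv k f (R t)) \<circ> (\<lambda>s. s *\<^sub>R ?V))) (at t)"
    by (intro diff_chain_at has_derivative_tang_deriv assms(1) \<open>R t \<noteq> 0\<close>)
  moreover have "f \<circ> sgn \<circ> R = (\<lambda>t. f (R t))"
    using nR by (auto simp: fun_eq_iff sgn_div_norm)
  moreover have "(\<Sum>k\<in>UNIV. ?V $ k * tang_deriv k f (R t))
     = R t $ i * tang_deriv j f (R t) - R t $ j * tang_deriv i f (R t)"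
    using assms(3)
    by (subst sum.remove[of _ i], simp, simp, subst sum.remove[of _ j]) (auto intro!: sum.neutral)
  then have "(\<lambda>h. \<Sum>k\<in>UNIV. h $ k * tang_deriv k f (R t)) \<circ> (\<lambda>s. s *\<^sub>R ?V)
     = (*) (R t $ i * tang_deriv j f (R t) - R t $ j * tang_deriv i f (R t))"
    by (simp only: fun_eq_iff comp_def vector_scaleR_component real_scaleR_def mult.assoc
        sum_distrib_left[symmetric] mult.commute[of _ "R t $ i * _ - _"]) simp
  ultimately show ?thesis
    unfolding has_field_derivative_def by simp
qed

lemma smooth_S4_integrable: "smooth_S4 f \<Longrightarrow> integrable \<sigma> f"
  by (intro continuous_on_S4_integrable smooth_S4_continuous_on)

lemma smooth_S4_measurable: "smooth_S4 f \<Longrightarrow> f \<in> borel_measurable \<sigma>"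
  by (intro continuous_on_S4_measurable smooth_S4_continuous_on)

text \<open>The integral of \<open>f\<close> composed with the rotation by \<open>t\<close> is
  independent of \<open>t\<close>; differentiate under the integral at \<open>t = 0\<close>.\<close>

lemma integral_rotation_field:
  assumes "smooth_S4 f" "i \<noteq> j"
  shows "(\<integral>x. x $ i * tang_deriv j f x - x $ j * tang_deriv i f x \<partial>\<sigma>) = 0"
proof -
  let ?L = "\<lambda>x. x $ i * tang_deriv j f x - x $ j * tang_deriv i f x"
  let ?R = "\<lambda>t x. plane_rotation i j t x"
  have smL: "smooth_S4 ?L"
    by (intro smooth_S4_diff smooth_S4_mult) (auto simp: assms)
  obtain B where B: "B > 0" "\<And>x. x \<in> S4 \<Longrightarrow> \<bar>?L x\<bar> \<le> B"
    using continuous_on_S4_bounded[OF smooth_S4_continuous_on[OF smL]] by blast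
  have RS: "?R t x \<in> S4" if "x \<in> S4" for t x
    using that orthogonal_transformation_norm[OF orthogonal_plane_rotation[OF assms(2)]] by simp
  have R0: "?R 0 x = x" for x
    by (auto simp: plane_rotation_def vec_eq_iff)
  have smm: "f \<in> borel_measurable \<sigma>"
    by (intro smooth_S4_measurable assms)
  have mR: "(\<lambda>x. f (?R t x)) \<in> borel_measurable \<sigma>" for t
    using measurable_compose[OF measurable_orthogonal_sphere[OF orthogonal_plane_rotation[OF assms(2)]] smm] .
  define t where "t n = inverse (real (Suc n))" for n
  have t0: "t n > 0" for n by (simp add: t_def)
  have tl: "t \<longlonglongrightarrow> 0" unfolding t_def by (rule LIMSEQ_inverse_real_of_nat)
  \<comment> \<open>By the mean value theorem each difference quotient is a value of the continuous
    field at another point of the sphere, so the one bound \<open>B\<close> dominates them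
    all.\<close>
  define q where "q n x = (f (?R (t n) x) - f x) / t n" for n x
  have bound: "\<bar>q n x\<bar> \<le> B" if "x \<in> S4" for n x
  proof -
    have "\<exists>z. 0 < z \<and> z < t n \<and> f (?R (t n) x) - f (?R 0 x) = (t n - 0) * ?L (?R z x)"
      by (rule MVT2[OF t0]) (use has_derivative_along_rotation[OF assms(1) that assms(2)] in blast)
    then obtain z where "f (?R (t n) x) - f x = t n * ?L (?R z x)"
      by (auto simp: R0)
    then have "q n x = ?L (?R z x)" using t0[of n] by (simp add: q_def)
    with B(2)[OF RS[OF that]] show ?thesis by simp
  qed
  have lim: "(\<lambda>n. q n x) \<longlonglongrightarrow> ?L x" if "x \<in> S4" for x
  proof -
    have "((\<lambda>h. (f (?R (0 + h) x) - f (?R 0 x)) / h) \<longlongrightarrow> ?L (?R 0 x)) (at 0)"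
      using has_derivative_along_rotation[OF assms(1) that assms(2), of 0] by (simp add: DERIV_def)
    then have "((\<lambda>h. (f (?R h x) - f x) / h) \<longlongrightarrow> ?L x) (at 0)"
      by (simp add: R0)
    moreover have "filterlim t (at 0) sequentially"
      using tl t0 by (auto simp: filterlim_at intro!: always_eventually) (metis less_irrefl)
    ultimately show ?thesis
      unfolding q_def by (rule filterlim_compose)
  qed
  have "(\<lambda>n. \<integral>x. q n x \<partial>\<sigma>) \<longlonglongrightarrow> (\<integral>x. ?L x \<partial>\<sigma>)"
  proof (rule integral_dominated_convergence[where w = "\<lambda>_. B"])
    show "?L \<in> borel_measurable \<sigma>" by (rule smooth_S4_measurable[OF smL])
    show "q n \<in> borel_measurable \<sigma>" for n
      unfolding q_def using mR smm by measurable
  qed (auto intro!: AE_I2 lim bound)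
  moreover have "(\<integral>x. q n x \<partial>\<sigma>) = 0" for n
  proof -
    have i1: "integrable \<sigma> f" by (intro smooth_S4_integrable assms)
    have i2: "integrable \<sigma> (\<lambda>x. f (?R (t n) x))"
      using integrable_distr[OF measurable_orthogonal_sphere[OF orthogonal_plane_rotation[OF assms(2)]], where f = f]
        i1 distr_orthogonal_sphere[OF orthogonal_plane_rotation[OF assms(2)]] by simp
    show ?thesis
      unfolding q_def
      using i1 i2 integral_orthogonal_sphere[OF orthogonal_plane_rotation[OF assms(2)] smm]
      by simp
  qed
  ultimately show ?thesis
    by (simp add: LIMSEQ_const_iff)
qed

text \<open>Apply the rotation fields of the planes \<open>i\<close>, \<open>j\<close> to
  \<open>x $ j * f\<close> and sum over \<open>j\<close>. The derivatives of \<open>f\<close>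
  combine to \<open>- tang_deriv i f\<close> because the gradient is orthogonal to the unit vector
  \<open>x\<close>, and each of the four indices \<open>j \<noteq> i\<close> contributes
  \<open>x $ i * f x\<close>. The factor \<open>4\<close> is the mean curvature of the
  sphere.\<close>

lemma integral_tang_deriv:
  assumes "smooth_S4 f"
  shows "(\<integral>x. tang_deriv i f x \<partial>\<sigma>) = 4 * (\<integral>x. x $ i * f x \<partial>\<sigma>)"
proof -
  let ?g = "\<lambda>j x. x $ j * f x"
  let ?L = "\<lambda>j x. x $ i * tang_deriv j (?g j) x - x $ j * tang_deriv i (?g j) x"
  have smg: "smooth_S4 (?g j)" for j
    by (intro smooth_S4_mult) (auto simp: assms)
  have smL: "smooth_S4 (?L j)" for j
    by (intro smooth_S4_diff smooth_S4_mult smooth_S4_component smooth_S4_tang_deriv smg)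
  have ptw: "(\<Sum>j\<in>UNIV - {i}. ?L j x) = 4 * (x $ i * f x) - tang_deriv i f x" if x: "x \<in> S4" for x
  proof -
    have L: "?L j x = x $ j * (x $ i * tang_deriv j f x) - (x $ j * x $ j) * tang_deriv i f x
        + (if j = i then 0 else x $ i * f x)" for j
      using x assms
      by (auto simp: tang_deriv_mult tang_deriv_component algebra_simps)
    have "(\<Sum>j\<in>UNIV. ?L j x) = x $ i * (\<Sum>j\<in>UNIV. x $ j * tang_deriv j f x)
        - (\<Sum>j\<in>UNIV. x $ j * x $ j) * tang_deriv i f x
        + (\<Sum>j\<in>UNIV. if j = i then 0 else x $ i * f x)"
      unfolding L sum.distrib sum_subtractf
      by (simp add: sum_distrib_left sum_distrib_right algebra_simps)
    also have "(\<Sum>j\<in>(UNIV :: 5 set). if j = i then 0 else x $ i * f x) = 4 * (x $ i * f x)"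
      by (simp add: sum.remove[of _ i])
    finally have "(\<Sum>j\<in>UNIV. ?L j x) = 4 * (x $ i * f x) - tang_deriv i f x"
      using tang_deriv_normal[OF assms S4_neq_0[OF x]] sum_S4_squares[OF x] by simp
    then show ?thesis
      using L[of i] by (simp add: sum.remove[of _ i])
  qed
  have "0 = (\<Sum>j\<in>UNIV - {i}. \<integral>x. ?L j x \<partial>\<sigma>)"
    using integral_rotation_field[OF smg] by (intro sum.neutral[symmetric]) auto
  also have "\<dots> = (\<integral>x. (\<Sum>j\<in>UNIV - {i}. ?L j x) \<partial>\<sigma>)"
    by (intro Bochner_Integration.integral_sum[symmetric] smooth_S4_integrable smL)
  also have "\<dots> = (\<integral>x. 4 * (x $ i * f x) - tang_deriv i f x \<partial>\<sigma>)"
    by (intro Bochner_Integration.integral_cong refl) (use ptw in simp)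
  also have "\<dots> = 4 * (\<integral>x. x $ i * f x \<partial>\<sigma>) - (\<integral>x. tang_deriv i f x \<partial>\<sigma>)"
    using smg assms by (simp add: smooth_S4_integrable)
  finally show ?thesis by simp
qed

lemma integral_by_parts_S4:
  assumes "smooth_S4 f" "smooth_S4 g"
  shows "(\<integral>x. tang_deriv i f x * g x \<partial>\<sigma>) = (\<integral>x. f x * (4 * x $ i * g x - tang_deriv i g x) \<partial>\<sigma>)"
proof -
  have "(\<integral>x. f x * tang_deriv i g x + tang_deriv i f x * g x \<partial>\<sigma>) = (\<integral>x. tang_deriv i (\<lambda>x. f x * g x) x \<partial>\<sigma>)"
    by (intro Bochner_Integration.integral_cong) (auto simp: tang_deriv_mult assms)
  also have "\<dots> = 4 * (\<integral>x. x $ i * (f x * g x) \<partial>\<sigma>)"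
    by (intro integral_tang_deriv smooth_S4_mult assms)
  finally have "(\<integral>x. f x * tang_deriv i g x + tang_deriv i f x * g x \<partial>\<sigma>)
     = (\<integral>x. 4 * (x $ i * (f x * g x)) \<partial>\<sigma>)" by simp
  moreover have "integrable \<sigma> (\<lambda>x. f x * tang_deriv i g x)" "integrable \<sigma> (\<lambda>x. tang_deriv i f x * g x)"
     "integrable \<sigma> (\<lambda>x. x $ i * (f x * g x))"
    by (intro smooth_S4_integrable smooth_S4_mult; simp add: assms)+
  ultimately have "(\<integral>x. tang_deriv i f x * g x \<partial>\<sigma>)
     = (\<integral>x. 4 * (x $ i * (f x * g x)) - f x * tang_deriv i g x \<partial>\<sigma>)"
    by simp
  then show ?thesis by (simp add: algebra_simps)
qed

subsection \<open>Hessian, Laplacian and the Paneitz operator in terms of tangential derivatives\<close>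

text \<open>The first term is the second derivative projected on the left only. The second is what
  the projection on the right adds: the normal component still present there is
  \<open>- tang_deriv k f\<close>, by \<open>sum_normal_tang_deriv2\<close>.\<close>

definition hess_entry :: "5 \<Rightarrow> 5 \<Rightarrow> (real^5 \<Rightarrow> real) \<Rightarrow> real^5 \<Rightarrow> real" where
  "hess_entry k l f x = tang_deriv k (tang_deriv l f) x + x $ l * tang_deriv k f x"

definition lap :: "(real^5 \<Rightarrow> real) \<Rightarrow> real^5 \<Rightarrow> real" where
  "lap f x = (\<Sum>k\<in>UNIV. tang_deriv k (tang_deriv k f) x)"

lemma smooth_hess_entry [simp]: "smooth_S4 f \<Longrightarrow> smooth_S4 (hess_entry k l f)"
  unfolding hess_entry_def[abs_def]
  by (intro smooth_S4_add smooth_S4_mult) auto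

lemma smooth_lap [simp]: "smooth_S4 f \<Longrightarrow> smooth_S4 (lap f)"
  unfolding lap_def[abs_def] by (intro smooth_S4_sum) auto

text \<open>\<open>pd j (f \<circ> sgn)\<close> is \<open>tang_deriv j f \<circ> sgn\<close> divided
  by the norm, and differentiating the norm factor produces the correction term.\<close>

lemma pd_pd_sgn:
  assumes "smooth_S4 f" "x \<in> S4"
  shows "pd i (pd j (f \<circ> sgn)) x = tang_deriv i (tang_deriv j f) x - x $ i * tang_deriv j f x"
proof -
  have x: "x \<noteq> 0" using assms(2) by auto
  have "pd i (pd j (f \<circ> sgn)) x = pd i (\<lambda>y. norm y powr (- 1) * (tang_deriv j f \<circ> sgn) y) x"
  proof (rule pd_transform[of "- {0}"])
    show "pd j (f \<circ> sgn) y = norm y powr (- 1) * (tang_deriv j f \<circ> sgn) y" if "y \<in> - {0}" for y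
      using that tang_deriv_scale[OF assms(1), of y j] by (simp add: tang_deriv_def powr_minus)
  qed (use x in auto)
  also have "\<dots> = norm x powr (- 1) * pd i (tang_deriv j f \<circ> sgn) x
      + pd i (\<lambda>x. norm x powr (- 1)) x * (tang_deriv j f \<circ> sgn) x"
    using has_derivative_norm_powr[OF x] smooth_S4_differentiable[OF smooth_S4_tang_deriv[OF assms(1)] x]
    by (intro pd_mult) (unfold differentiable_def, blast+)
  also have "pd i (\<lambda>x. norm x powr (- 1)) x = - x $ i"
    using assms(2) by (simp only: pd_norm_powr[OF x]) simp
  finally have "pd i (pd j (f \<circ> sgn)) x = norm x powr (- 1) * pd i (tang_deriv j f \<circ> sgn) x
      + - x $ i * (tang_deriv j f \<circ> sgn) x" .
  moreover have "norm x powr (- 1) = 1" "(tang_deriv j f \<circ> sgn) x = tang_deriv j f x"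
    using assms(2) by (simp_all add: sgn_S4)
  ultimately show ?thesis
    by (simp add: tang_deriv_def[of i "tang_deriv j f"])
qed

text \<open>Differentiate the identity \<open>tang_deriv_normal\<close> tangentially.\<close>

lemma sum_normal_tang_deriv2:
  assumes "smooth_S4 f" "x \<in> S4"
  shows "(\<Sum>b\<in>UNIV. x $ b * tang_deriv k (tang_deriv b f) x) = - tang_deriv k f x"
proof -
  have x: "x \<noteq> 0" using assms(2) by auto
  have "0 = tang_deriv k (\<lambda>x. 0) x" by simp
  also have "\<dots> = tang_deriv k (\<lambda>x. \<Sum>b\<in>UNIV. x $ b * tang_deriv b f x) x"
    by (intro tang_deriv_cong x) (rule tang_deriv_normal[OF assms(1) S4_neq_0, symmetric])
  also have "\<dots> = (\<Sum>b\<in>UNIV. tang_deriv k (\<lambda>x. x $ b * tang_deriv b f x) x)"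
    by (intro tang_deriv_sum x smooth_S4_mult) (auto simp: assms)
  also have "\<dots> = (\<Sum>b\<in>UNIV. x $ b * tang_deriv k (tang_deriv b f) x
       + ((if k = b then tang_deriv b f x else 0) - x $ k * (x $ b * tang_deriv b f x)))"
    by (intro sum.cong refl, subst tang_deriv_mult[OF smooth_S4_component smooth_S4_tang_deriv[OF assms(1)] assms(2)])
       (auto simp: tang_deriv_component[OF assms(2)] algebra_simps)
  also have "\<dots> = (\<Sum>b\<in>UNIV. x $ b * tang_deriv k (tang_deriv b f) x)
      + (tang_deriv k f x - x $ k * (\<Sum>b\<in>UNIV. x $ b * tang_deriv b f x))"
    unfolding sum.distrib sum_subtractf by (simp add: sum_distrib_left)
  finally show ?thesis using tang_deriv_normal[OF assms(1) x] by simp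
qed

text \<open>\<open>tang_deriv a (tang_deriv b f)\<close> is already tangential in \<open>a\<close>,
  so the left projection removes exactly the correction term of \<open>pd_pd_sgn\<close>; the right
  projection acts through \<open>sum_normal_tang_deriv2\<close>.\<close>

lemma hess_S4_component:
  assumes "smooth_S4 f" "x \<in> S4"
  shows "hess_S4 f x $ k $ l = hess_entry k l f x"
proof -
  have x: "x \<noteq> 0" using assms(2) by auto
  let ?M = "\<lambda>a b. tang_deriv a (tang_deriv b f) x - x $ a * tang_deriv b f x"
  have P: "tangent_proj x $ a $ b = (if a = b then 1 else 0) - x $ a * x $ b" for a b
    by (simp add: tangent_proj_def mat_def)
  have left: "(\<Sum>a\<in>UNIV. tangent_proj x $ k $ a * ?M a b) = tang_deriv k (tang_deriv b f) x" for b
  proof -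
    have "(\<Sum>a\<in>UNIV. tangent_proj x $ k $ a * ?M a b)
      = (\<Sum>a\<in>UNIV. (if k = a then ?M a b else 0)
          - x $ k * (x $ a * tang_deriv a (tang_deriv b f) x - (x $ a * x $ a) * tang_deriv b f x))"
      unfolding P by (intro sum.cong refl) (auto simp: algebra_simps)
    also have "\<dots> = ?M k b - x $ k * ((\<Sum>a\<in>UNIV. x $ a * tang_deriv a (tang_deriv b f) x)
        - (\<Sum>a\<in>UNIV. x $ a * x $ a) * tang_deriv b f x)"
      unfolding sum_subtractf sum_distrib_left[symmetric] sum_distrib_right[symmetric] by simp
    also have "\<dots> = tang_deriv k (tang_deriv b f) x"
      using tang_deriv_normal[OF smooth_S4_tang_deriv[OF assms(1)] x] sum_S4_squares[OF assms(2)]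
      by simp
    finally show ?thesis .
  qed
  have "hess_S4 f x $ k $ l = (\<Sum>b\<in>UNIV. (\<Sum>a\<in>UNIV. tangent_proj x $ k $ a * ?M a b) * tangent_proj x $ b $ l)"
    unfolding hess_S4_def matrix_matrix_mult_def by (simp add: pd_pd_sgn[OF assms])
  also have "\<dots> = (\<Sum>b\<in>UNIV. (if b = l then tang_deriv k (tang_deriv b f) x else 0)
      - x $ l * (x $ b * tang_deriv k (tang_deriv b f) x))"
    by (intro sum.cong refl, subst left, subst P) (simp add: algebra_simps)
  also have "\<dots> = tang_deriv k (tang_deriv l f) x - x $ l * (\<Sum>b\<in>UNIV. x $ b * tang_deriv k (tang_deriv b f) x)"
    unfolding sum_subtractf sum_distrib_left[symmetric] by simp
  also have "\<dots> = hess_entry k l f x"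
    unfolding sum_normal_tang_deriv2[OF assms] hess_entry_def by simp
  finally show ?thesis .
qed

lemma lap_eq_trace:
  assumes "smooth_S4 f" "x \<in> S4"
  shows "lap f x = (\<Sum>k\<in>UNIV. hess_entry k k f x)"
  using tang_deriv_normal[OF assms(1) S4_neq_0[OF assms(2)]]
  by (simp add: lap_def hess_entry_def sum.distrib)

lemma laplace_S4_eq_lap:
  assumes "smooth_S4 f" "x \<in> S4"
  shows "laplace_S4 f x = lap f x"
  using assms by (simp add: laplace_S4_def trace_def hess_S4_component lap_eq_trace)

text \<open>\<open>paneitz_S4\<close> applies \<open>laplace_S4\<close> to a function containing
  \<open>laplace_S4 f\<close>, and this agrees with \<open>lap f\<close> on the sphere only.\<close>

lemma laplace_S4_cong:
  assumes "\<And>y. y \<in> S4 \<Longrightarrow> f y = g y" "x \<in> S4"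
  shows "laplace_S4 f x = laplace_S4 g x"
proof -
  have 1: "pd j (f \<circ> sgn) y = pd j (g \<circ> sgn) y" if "y \<noteq> 0" for j y
    by (rule tang_deriv_cong[OF assms(1) that, unfolded tang_deriv_def])
  have "pd i (pd j (f \<circ> sgn)) x = pd i (pd j (g \<circ> sgn)) x" for i j
    by (rule pd_transform[of "- {0}"]) (use S4_neq_0[OF assms(2)] 1 in blast)+
  then show ?thesis by (simp add: laplace_S4_def hess_S4_def)
qed

lemma lap_add:
  assumes "smooth_S4 f" "smooth_S4 g" "x \<in> S4"
  shows "lap (\<lambda>x. f x + g x) x = lap f x + lap g x"
proof -
  have x: "x \<noteq> 0" using assms(3) by auto
  have "tang_deriv k (tang_deriv k (\<lambda>x. f x + g x)) x
      = tang_deriv k (\<lambda>x. tang_deriv k f x + tang_deriv k g x) x" for k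
    by (intro tang_deriv_cong x tang_deriv_add assms) auto
  then show ?thesis
    by (simp add: lap_def tang_deriv_add assms x sum.distrib)
qed

lemma lap_cmult:
  assumes "smooth_S4 f" "x \<in> S4"
  shows "lap (\<lambda>x. c * f x) x = c * lap f x"
proof -
  have x: "x \<noteq> 0" using assms(2) by auto
  have "tang_deriv k (tang_deriv k (\<lambda>x. c * f x)) x = tang_deriv k (\<lambda>x. c * tang_deriv k f x) x" for k
    by (intro tang_deriv_cong x tang_deriv_cmult assms) auto
  then show ?thesis
    by (simp add: lap_def tang_deriv_cmult assms x sum_distrib_left)
qed

lemma lap_diff:
  assumes "smooth_S4 f" "smooth_S4 g" "x \<in> S4"
  shows "lap (\<lambda>x. f x - g x) x = lap f x - lap g x"
  using lap_add[OF assms(1) smooth_S4_minus[OF assms(2)] assms(3)] lap_cmult[OF assms(2,3), of "- 1"]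
  by simp

section \<open>The Paneitz operator and Green's formula\<close>

lemma paneitz_S4_eq:
  assumes "smooth_S4 f" "x \<in> S4"
  shows "paneitz_S4 f x = lap (lap f) x - 2 * lap f x"
proof -
  let ?g = "\<lambda>x. 2 * f x - lap f x"
  have sm: "smooth_S4 ?g"
    by (intro smooth_S4_diff smooth_S4_mult) (auto simp: assms)
  have "paneitz_S4 f x = - laplace_S4 (\<lambda>x. - laplace_S4 f x + 2 * f x) x"
    by (simp add: paneitz_S4_def Let_def)
  also have "laplace_S4 (\<lambda>x. - laplace_S4 f x + 2 * f x) x = laplace_S4 ?g x"
    using assms by (intro laplace_S4_cong) (auto simp: laplace_S4_eq_lap)
  also have "\<dots> = lap ?g x" by (rule laplace_S4_eq_lap[OF sm assms(2)])
  also have "\<dots> = 2 * lap f x - lap (lap f) x"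
    using lap_diff[OF smooth_S4_mult[OF smooth_S4_const assms(1)] smooth_lap[OF assms(1)] assms(2), of 2]
      lap_cmult[OF assms] by simp
  finally show ?thesis by simp
qed

lemma integral_lap_mult:
  assumes "smooth_S4 f" "smooth_S4 g"
  shows "(\<integral>x. lap f x * g x \<partial>\<sigma>) = - (\<integral>x. (\<Sum>k\<in>UNIV. tang_deriv k f x * tang_deriv k g x) \<partial>\<sigma>)"
proof -
  have "(\<integral>x. lap f x * g x \<partial>\<sigma>) = (\<Sum>k\<in>UNIV. \<integral>x. tang_deriv k (tang_deriv k f) x * g x \<partial>\<sigma>)"
    unfolding lap_def sum_distrib_right
    by (intro Bochner_Integration.integral_sum smooth_S4_integrable smooth_S4_mult) (auto simp: assms)
  also have "\<dots> = (\<Sum>k\<in>UNIV. \<integral>x. tang_deriv k f x * (4 * x $ k * g x - tang_deriv k g x) \<partial>\<sigma>)"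
    by (intro sum.cong refl integral_by_parts_S4) (auto simp: assms)
  also have "\<dots> = (\<integral>x. (\<Sum>k\<in>UNIV. tang_deriv k f x * (4 * x $ k * g x - tang_deriv k g x)) \<partial>\<sigma>)"
    by (intro Bochner_Integration.integral_sum[symmetric] smooth_S4_integrable smooth_S4_mult smooth_S4_diff)
       (auto simp: assms)
  also have "\<dots> = (\<integral>x. - (\<Sum>k\<in>UNIV. tang_deriv k f x * tang_deriv k g x) \<partial>\<sigma>)"
  proof (intro Bochner_Integration.integral_cong refl)
    fix x assume "x \<in> space \<sigma>"
    then have x: "x \<noteq> 0" by auto
    have "(\<Sum>k\<in>UNIV. tang_deriv k f x * (4 * x $ k * g x - tang_deriv k g x))
       = 4 * g x * (\<Sum>k\<in>UNIV. x $ k * tang_deriv k f x) - (\<Sum>k\<in>UNIV. tang_deriv k f x * tang_deriv k g x)"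
      by (simp add: sum_distrib_left sum_subtractf algebra_simps)
    then show "(\<Sum>k\<in>UNIV. tang_deriv k f x * (4 * x $ k * g x - tang_deriv k g x))
       = - (\<Sum>k\<in>UNIV. tang_deriv k f x * tang_deriv k g x)"
      using tang_deriv_normal[OF assms(1) x] by simp
  qed
  finally show ?thesis by simp
qed

lemma integral_lap_sym:
  assumes "smooth_S4 f" "smooth_S4 g"
  shows "(\<integral>x. lap f x * g x \<partial>\<sigma>) = (\<integral>x. f x * lap g x \<partial>\<sigma>)"
  using integral_lap_mult[OF assms] integral_lap_mult[OF assms(2,1)]
  by (simp add: mult.commute)

text \<open>Two of the four derivatives are moved to the other factor. In this form the quadratic
  form is continuous in the H^2 norm.\<close>

lemma L2_inner_paneitz:
  assumes "smooth_S4 f"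
  shows "L2_inner f (paneitz_S4 f) = (\<integral>x. lap f x * lap f x - 2 * (f x * lap f x) \<partial>\<sigma>)"
proof -
  have "L2_inner f (paneitz_S4 f) = (\<integral>x. lap (lap f) x * f x - 2 * (f x * lap f x) \<partial>\<sigma>)"
    unfolding L2_inner_def
    by (intro Bochner_Integration.integral_cong refl) (simp add: paneitz_S4_eq assms algebra_simps)
  also have "\<dots> = (\<integral>x. lap (lap f) x * f x \<partial>\<sigma>) - (\<integral>x. 2 * (f x * lap f x) \<partial>\<sigma>)"
    by (intro Bochner_Integration.integral_diff smooth_S4_integrable smooth_S4_mult) (auto simp: assms)
  also have "(\<integral>x. lap (lap f) x * f x \<partial>\<sigma>) = (\<integral>x. lap f x * lap f x \<partial>\<sigma>)"
    by (intro integral_lap_sym) (auto simp: assms)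
  also have "\<dots> - (\<integral>x. 2 * (f x * lap f x) \<partial>\<sigma>) = (\<integral>x. lap f x * lap f x - 2 * (f x * lap f x) \<partial>\<sigma>)"
    by (intro Bochner_Integration.integral_diff[symmetric] smooth_S4_integrable smooth_S4_mult) (auto simp: assms)
  finally show ?thesis .
qed

subsection \<open>The Sobolev norm and extension by continuity\<close>

lemma nonneg_quadratic_discriminant:
  fixes a b c :: real
  assumes "\<And>t. a + 2 * b * t + c * t\<^sup>2 \<ge> 0" "c \<ge> 0"
  shows "b\<^sup>2 \<le> a * c"
proof (cases "c = 0")
  case True
  then have "a + 2 * b * t \<ge> 0" for t using assms(1)[of t] by simp
  \<comment> \<open>For \<open>b \<noteq> 0\<close> the affine function takes the value
    \<open>- 1\<close> at \<open>- (a + 1) / (2 * b)\<close>.\<close>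
  then have "b = 0"
    using \<open>\<And>t. a + 2 * b * t \<ge> 0\<close>[of "- (a + 1) / (2 * b)"] by (cases "b = 0") (auto simp: field_simps)
  then show ?thesis by (simp add: True)
next
  case False
  then have "a + 2 * b * (- b / c) + c * (- b / c)\<^sup>2 = (a * c - b\<^sup>2) / c"
    by (simp add: field_simps power2_eq_square)
  then show ?thesis using assms(1)[of "- b / c"] assms(2) False by (simp add: zero_le_divide_iff)
qed

lemma integrable_mult_L2:
  fixes f g :: "'a \<Rightarrow> real"
  assumes "f \<in> borel_measurable M" "g \<in> borel_measurable M"
    "integrable M (\<lambda>x. (f x)\<^sup>2)" "integrable M (\<lambda>x. (g x)\<^sup>2)"
  shows "integrable M (\<lambda>x. f x * g x)"
proof (rule Bochner_Integration.integrable_bound)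
  show "integrable M (\<lambda>x. (f x)\<^sup>2 + (g x)\<^sup>2)" using assms by simp
  have "\<bar>f x * g x\<bar> \<le> (f x)\<^sup>2 + (g x)\<^sup>2" for x
    using sum_squares_bound[of "\<bar>f x\<bar>" "\<bar>g x\<bar>"] abs_ge_zero[of "f x * g x"]
    unfolding abs_mult power2_abs by linarith
  then show "AE x in M. norm (f x * g x) \<le> norm ((f x)\<^sup>2 + (g x)\<^sup>2)"
    by simp
qed (use assms in simp)

lemma integral_Cauchy_Schwarz:
  fixes f g :: "'a \<Rightarrow> real"
  assumes "f \<in> borel_measurable M" "g \<in> borel_measurable M"
    "integrable M (\<lambda>x. (f x)\<^sup>2)" "integrable M (\<lambda>x. (g x)\<^sup>2)"
  shows "\<bar>\<integral>x. f x * g x \<partial>M\<bar> \<le> sqrt (\<integral>x. (f x)\<^sup>2 \<partial>M) * sqrt (\<integral>x. (g x)\<^sup>2 \<partial>M)"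
proof -
  note fg = integrable_mult_L2[OF assms]
  have "(\<integral>x. (f x)\<^sup>2 \<partial>M) + 2 * (\<integral>x. f x * g x \<partial>M) * t + (\<integral>x. (g x)\<^sup>2 \<partial>M) * t\<^sup>2 \<ge> 0" for t
  proof -
    have "0 \<le> (\<integral>x. (f x + t * g x)\<^sup>2 \<partial>M)" by simp
    also have "\<dots> = (\<integral>x. (f x)\<^sup>2 + 2 * t * (f x * g x) + t\<^sup>2 * (g x)\<^sup>2 \<partial>M)"
      by (intro Bochner_Integration.integral_cong refl) (simp add: power2_sum power_mult_distrib algebra_simps)
    also have "\<dots> = (\<integral>x. (f x)\<^sup>2 \<partial>M) + 2 * t * (\<integral>x. f x * g x \<partial>M) + t\<^sup>2 * (\<integral>x. (g x)\<^sup>2 \<partial>M)"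
      using fg assms by simp
    finally show ?thesis by (simp add: algebra_simps)
  qed
  then have "(\<integral>x. f x * g x \<partial>M)\<^sup>2 \<le> (\<integral>x. (f x)\<^sup>2 \<partial>M) * (\<integral>x. (g x)\<^sup>2 \<partial>M)"
    by (rule nonneg_quadratic_discriminant) simp
  then show ?thesis
    by (metis real_sqrt_abs real_sqrt_le_iff real_sqrt_mult)
qed

abbreviation L2_norm :: "(real^5 \<Rightarrow> real) \<Rightarrow> real" where
  "L2_norm f \<equiv> sqrt (\<integral>x. (f x)\<^sup>2 \<partial>\<sigma>)"

lemma smooth_S4_L2:
  assumes "smooth_S4 f"
  shows "f \<in> L2_S4"
  using smooth_S4_measurable[OF assms] smooth_S4_integrable[OF smooth_S4_power[OF assms]]
  by (simp add: L2_S4_def)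

lemma L2_S4_D:
  assumes "f \<in> L2_S4"
  shows "f \<in> borel_measurable \<sigma>" "integrable \<sigma> (\<lambda>x. (f x)\<^sup>2)"
  using assms by (auto simp: L2_S4_def)

lemma L2_mult_integrable: "f \<in> L2_S4 \<Longrightarrow> g \<in> L2_S4 \<Longrightarrow> integrable \<sigma> (\<lambda>x. f x * g x)"
  by (intro integrable_mult_L2) (auto dest: L2_S4_D)

lemma L2_add:
  assumes "f \<in> L2_S4" "g \<in> L2_S4"
  shows "(\<lambda>x. f x + g x) \<in> L2_S4"
proof -
  note fg = L2_mult_integrable[OF assms]
  have "integrable \<sigma> (\<lambda>x. (f x)\<^sup>2 + 2 * (f x * g x) + (g x)\<^sup>2)"
    using fg L2_S4_D(2)[OF assms(1)] L2_S4_D(2)[OF assms(2)] by simp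
  then show ?thesis
    using L2_S4_D(1)[OF assms(1)] L2_S4_D(1)[OF assms(2)]
    by (simp add: L2_S4_def power2_sum algebra_simps)
qed

lemma L2_diff:
  assumes "f \<in> L2_S4" "g \<in> L2_S4"
  shows "(\<lambda>x. f x - g x) \<in> L2_S4"
proof -
  have "(\<lambda>x. - g x) \<in> L2_S4" using assms(2) by (simp add: L2_S4_def)
  from L2_add[OF assms(1) this] show ?thesis by simp
qed

lemma L2_Cauchy_Schwarz:
  assumes "f \<in> L2_S4" "g \<in> L2_S4"
  shows "\<bar>\<integral>x. f x * g x \<partial>\<sigma>\<bar> \<le> L2_norm f * L2_norm g"
  by (intro integral_Cauchy_Schwarz L2_S4_D assms)

section \<open>The Sobolev inner product on smooth functions\<close>

definition sob_density :: "(real^5 \<Rightarrow> real) \<Rightarrow> (real^5 \<Rightarrow> real) \<Rightarrow> real^5 \<Rightarrow> real" where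
  "sob_density f g x = f x * g x + (\<Sum>i\<in>UNIV. tang_deriv i f x * tang_deriv i g x)
     + (\<Sum>k\<in>UNIV. \<Sum>l\<in>UNIV. hess_entry k l f x * hess_entry k l g x)"

definition sob_inner :: "(real^5 \<Rightarrow> real) \<Rightarrow> (real^5 \<Rightarrow> real) \<Rightarrow> real" where
  "sob_inner f g = (\<integral>x. sob_density f g x \<partial>\<sigma>)"

lemma smooth_sob_density: "smooth_S4 f \<Longrightarrow> smooth_S4 g \<Longrightarrow> smooth_S4 (sob_density f g)"
  unfolding sob_density_def[abs_def]
  by (intro smooth_S4_add smooth_S4_sum smooth_S4_mult) auto

lemma sob_density_self:
  assumes "smooth_S4 f" "x \<in> S4"
  shows "(f x)\<^sup>2 + (norm (grad_S4 f x))\<^sup>2 + (norm (hess_S4 f x))\<^sup>2 = sob_density f f x"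
proof -
  have "grad_S4 f x \<bullet> grad_S4 f x = (\<Sum>i\<in>UNIV. tang_deriv i f x * tang_deriv i f x)"
    by (simp add: inner_vec_def grad_S4_def tang_deriv_def)
  moreover have "hess_S4 f x \<bullet> hess_S4 f x = (\<Sum>k\<in>UNIV. \<Sum>l\<in>UNIV. hess_entry k l f x * hess_entry k l f x)"
    by (simp add: inner_vec_def hess_S4_component[OF assms])
  ultimately show ?thesis
    by (simp add: power2_norm_eq_inner sob_density_def power2_eq_square[of "f x"])
qed

lemma H2_norm_smooth_eq:
  assumes "smooth_S4 f"
  shows "H2_norm_smooth f = sqrt (sob_inner f f)"
  unfolding H2_norm_smooth_def sob_inner_def
  by (intro arg_cong[of _ _ sqrt] Bochner_Integration.integral_cong refl) (simp add: sob_density_self assms)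

lemma sob_density_commute: "sob_density f g x = sob_density g f x"
  by (simp add: sob_density_def mult.commute)

lemma sob_inner_commute: "sob_inner f g = sob_inner g f"
  by (simp add: sob_inner_def sob_density_commute)

lemma sob_inner_add_cmult:
  assumes "smooth_S4 f" "smooth_S4 g" "smooth_S4 h"
  shows "sob_inner (\<lambda>x. f x + c * g x) h = sob_inner f h + c * sob_inner g h"
proof -
  have cg: "smooth_S4 (\<lambda>x. c * g x)" by (intro smooth_S4_mult smooth_S4_const assms)
  have D: "tang_deriv i (\<lambda>x. f x + c * g x) x = tang_deriv i f x + c * tang_deriv i g x" if "x \<noteq> 0" for i x
    using that by (simp add: tang_deriv_add[OF assms(1) cg] tang_deriv_cmult[OF assms(2)])
  have DD: "tang_deriv k (tang_deriv i (\<lambda>x. f x + c * g x)) x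
      = tang_deriv k (tang_deriv i f) x + c * tang_deriv k (tang_deriv i g) x" if "x \<noteq> 0" for i k x
  proof -
    have "tang_deriv k (tang_deriv i (\<lambda>x. f x + c * g x)) x
        = tang_deriv k (\<lambda>x. tang_deriv i f x + c * tang_deriv i g x) x"
      by (rule tang_deriv_cong[OF D[OF S4_neq_0] that])
    also have "\<dots> = tang_deriv k (tang_deriv i f) x + tang_deriv k (\<lambda>x. c * tang_deriv i g x) x"
      by (intro tang_deriv_add smooth_S4_mult that) (auto simp: assms)
    finally show ?thesis
      by (simp only: tang_deriv_cmult[OF smooth_S4_tang_deriv[OF assms(2)] that])
  qed
  have H: "hess_entry k l (\<lambda>x. f x + c * g x) x = hess_entry k l f x + c * hess_entry k l g x"
    if "x \<noteq> 0" for k l x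
    unfolding hess_entry_def D[OF that] DD[OF that] by (simp add: algebra_simps)
  have "sob_inner (\<lambda>x. f x + c * g x) h = (\<integral>x. sob_density f h x + c * sob_density g h x \<partial>\<sigma>)"
    unfolding sob_inner_def
  proof (intro Bochner_Integration.integral_cong refl)
    fix x assume "x \<in> space \<sigma>"
    then have x: "x \<noteq> 0" by auto
    show "sob_density (\<lambda>x. f x + c * g x) h x = sob_density f h x + c * sob_density g h x"
      unfolding sob_density_def D[OF x] H[OF x]
      by (simp add: distrib_right distrib_left sum.distrib sum_distrib_left mult.assoc)
  qed
  also have "\<dots> = sob_inner f h + c * sob_inner g h"
    unfolding sob_inner_def
    using smooth_S4_integrable[OF smooth_sob_density[OF assms(1,3)]]
      smooth_S4_integrable[OF smooth_sob_density[OF assms(2,3)]] by simp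
  finally show ?thesis .
qed

lemma sob_density_self_nonneg: "sob_density f f x \<ge> 0"
  unfolding sob_density_def by (intro add_nonneg_nonneg sum_nonneg) auto

lemma sob_inner_self_nonneg: "sob_inner f f \<ge> 0"
  unfolding sob_inner_def by (intro integral_nonneg_AE) (simp add: sob_density_self_nonneg)

lemma H2_norm_smooth_nonneg: "H2_norm_smooth f \<ge> 0"
  unfolding H2_norm_smooth_def by (intro real_sqrt_ge_zero integral_nonneg_AE) simp

lemma H2_norm_smooth_square:
  assumes "smooth_S4 f"
  shows "(H2_norm_smooth f)\<^sup>2 = sob_inner f f"
  by (simp add: H2_norm_smooth_eq assms sob_inner_self_nonneg)

lemma sob_inner_expand:
  assumes "smooth_S4 f" "smooth_S4 g"
  shows "sob_inner (\<lambda>x. f x + t * g x) (\<lambda>x. f x + t * g x)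
     = sob_inner f f + 2 * sob_inner f g * t + sob_inner g g * t\<^sup>2"
proof -
  have s: "smooth_S4 (\<lambda>x. f x + t * g x)"
    by (intro smooth_S4_add smooth_S4_mult smooth_S4_const assms)
  have r: "sob_inner h (\<lambda>x. f x + t * g x) = sob_inner f h + t * sob_inner g h" if "smooth_S4 h" for h
    using sob_inner_add_cmult[OF assms that] by (simp add: sob_inner_commute)
  show ?thesis
    unfolding sob_inner_add_cmult[OF assms s] r[OF assms(1)] r[OF assms(2)]
    by (simp add: sob_inner_commute[of g f] algebra_simps power2_eq_square)
qed

lemma sob_Cauchy_Schwarz:
  assumes "smooth_S4 f" "smooth_S4 g"
  shows "\<bar>sob_inner f g\<bar> \<le> H2_norm_smooth f * H2_norm_smooth g"
proof -
  have "sob_inner f f + 2 * sob_inner f g * t + sob_inner g g * t\<^sup>2 \<ge> 0" for t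
    using sob_inner_self_nonneg sob_inner_expand[OF assms] by metis
  then have "(sob_inner f g)\<^sup>2 \<le> sob_inner f f * sob_inner g g"
    by (rule nonneg_quadratic_discriminant) (rule sob_inner_self_nonneg)
  then show ?thesis
    unfolding H2_norm_smooth_eq[OF assms(1)] H2_norm_smooth_eq[OF assms(2)]
    by (metis real_sqrt_abs real_sqrt_le_iff real_sqrt_mult)
qed

lemma H2_norm_smooth_triangle:
  assumes "smooth_S4 f" "smooth_S4 g" "\<bar>t\<bar> = 1"
  shows "H2_norm_smooth (\<lambda>x. f x + t * g x) \<le> H2_norm_smooth f + H2_norm_smooth g"
proof (rule power2_le_imp_le)
  have s: "smooth_S4 (\<lambda>x. f x + t * g x)"
    by (intro smooth_S4_add smooth_S4_mult smooth_S4_const assms)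
  have "sob_inner f g * t \<le> H2_norm_smooth f * H2_norm_smooth g"
    using sob_Cauchy_Schwarz[OF assms(1,2)] assms(3) by (auto simp: abs_if split: if_splits)
  moreover have "t\<^sup>2 = 1" using assms(3) by (simp add: power2_eq_1_iff abs_if split: if_splits)
  ultimately show "(H2_norm_smooth (\<lambda>x. f x + t * g x))\<^sup>2 \<le> (H2_norm_smooth f + H2_norm_smooth g)\<^sup>2"
    unfolding H2_norm_smooth_square[OF s] sob_inner_expand[OF assms(1,2)]
    by (simp add: power2_sum H2_norm_smooth_square assms)
qed (simp add: H2_norm_smooth_nonneg)

lemma H2_norm_smooth_add:
  assumes "smooth_S4 f" "smooth_S4 g"
  shows "H2_norm_smooth (\<lambda>x. f x + g x) \<le> H2_norm_smooth f + H2_norm_smooth g"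
  using H2_norm_smooth_triangle[OF assms, of 1] by simp

lemma H2_norm_smooth_diff:
  assumes "smooth_S4 f" "smooth_S4 g"
  shows "H2_norm_smooth (\<lambda>x. f x - g x) \<le> H2_norm_smooth f + H2_norm_smooth g"
  using H2_norm_smooth_triangle[OF assms, of "- 1"] by simp

lemma H2_norm_smooth_diff_lower:
  assumes "smooth_S4 f" "smooth_S4 g"
  shows "\<bar>H2_norm_smooth f - H2_norm_smooth g\<bar> \<le> H2_norm_smooth (\<lambda>x. f x - g x)"
proof -
  have s: "smooth_S4 (\<lambda>x. f x - g x)" by (intro smooth_S4_diff assms)
  show ?thesis
    using H2_norm_smooth_add[OF s assms(2)] H2_norm_smooth_diff[OF assms(1) s] by simp
qed

lemma L2_norm_le_H2:
  assumes "smooth_S4 f" "smooth_S4 g" "c \<ge> 0"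
    "\<And>x. x \<in> S4 \<Longrightarrow> (g x)\<^sup>2 \<le> c\<^sup>2 * sob_density f f x"
  shows "L2_norm g \<le> c * H2_norm_smooth f"
proof -
  have "(\<integral>x. (g x)\<^sup>2 \<partial>\<sigma>) \<le> (\<integral>x. c\<^sup>2 * sob_density f f x \<partial>\<sigma>)"
    by (intro integral_mono smooth_S4_integrable smooth_S4_mult smooth_S4_const smooth_S4_power
        smooth_sob_density assms) (use assms(4) in simp)
  then have "L2_norm g \<le> sqrt (c\<^sup>2 * sob_inner f f)"
    by (simp add: sob_inner_def)
  also have "\<dots> = c * H2_norm_smooth f"
    using assms(3) by (simp add: H2_norm_smooth_eq assms(1) real_sqrt_mult)
  finally show ?thesis .
qed

lemma L2_norm_le_H2_norm_smooth:
  assumes "smooth_S4 f"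
  shows "L2_norm f \<le> H2_norm_smooth f"
proof -
  have "(f x)\<^sup>2 \<le> 1\<^sup>2 * sob_density f f x" for x
    unfolding sob_density_def power2_eq_square[of "f x"]
    by (simp add: add_nonneg_nonneg sum_nonneg)
  from L2_norm_le_H2[OF assms assms _ this] show ?thesis by simp
qed

text \<open>The Laplacian is the trace of a five by five matrix, so Cauchy-Schwarz costs
  \<open>sqrt 5\<close>, rounded up to \<open>5\<close>.\<close>

lemma L2_norm_lap_le:
  assumes "smooth_S4 f"
  shows "L2_norm (lap f) \<le> 5 * H2_norm_smooth f"
proof (rule L2_norm_le_H2)
  fix x assume x: "x \<in> S4"
  have "(lap f x)\<^sup>2 = (\<Sum>k\<in>UNIV. hess_entry k k f x)\<^sup>2"
    by (simp only: lap_eq_trace[OF assms x])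
  also have "\<dots> \<le> (\<Sum>k\<in>(UNIV :: 5 set). (hess_entry k k f x)\<^sup>2) * card (UNIV :: 5 set)"
    by (rule sum_squared_le_sum_of_squares)
  also have "\<dots> = 5 * (\<Sum>k\<in>UNIV. (hess_entry k k f x)\<^sup>2)" by simp
  also have "(\<Sum>k\<in>UNIV. (hess_entry k k f x)\<^sup>2) \<le> (\<Sum>k\<in>UNIV. \<Sum>l\<in>UNIV. (hess_entry k l f x)\<^sup>2)"
    by (intro sum_mono member_le_sum) auto
  also have "\<dots> \<le> sob_density f f x"
    unfolding sob_density_def power2_eq_square[of "hess_entry _ _ _ _"]
    by (simp add: add_nonneg_nonneg sum_nonneg)
  finally show "(lap f x)\<^sup>2 \<le> 5\<^sup>2 * sob_density f f x"
    using sob_density_self_nonneg[of f x] by simp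
qed (auto simp: assms)

section \<open>Formal adjoints and closability of the Sobolev norm\<close>

definition tang_adjoint :: "5 \<Rightarrow> (real^5 \<Rightarrow> real) \<Rightarrow> real^5 \<Rightarrow> real" where
  "tang_adjoint i u x = 4 * x $ i * u x - tang_deriv i u x"

lemma smooth_tang_adjoint: "smooth_S4 u \<Longrightarrow> smooth_S4 (tang_adjoint i u)"
  unfolding tang_adjoint_def[abs_def] by (intro smooth_S4_diff smooth_S4_mult) auto

lemma integral_tang_adjoint:
  "smooth_S4 f \<Longrightarrow> smooth_S4 u \<Longrightarrow> (\<integral>x. tang_deriv i f x * u x \<partial>\<sigma>) = (\<integral>x. f x * tang_adjoint i u x \<partial>\<sigma>)"
  unfolding tang_adjoint_def by (rule integral_by_parts_S4)

lemma hess_entry_adjoint: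
  assumes "smooth_S4 f" "smooth_S4 u"
  shows "(\<integral>x. hess_entry k l f x * u x \<partial>\<sigma>)
    = (\<integral>x. f x * (tang_adjoint l (tang_adjoint k u) x + tang_adjoint k (\<lambda>x. x $ l * u x) x) \<partial>\<sigma>)"
proof -
  have xu: "smooth_S4 (\<lambda>x. x $ l * u x)" by (intro smooth_S4_mult smooth_S4_component assms)
  have "(\<integral>x. hess_entry k l f x * u x \<partial>\<sigma>)
     = (\<integral>x. tang_deriv k (tang_deriv l f) x * u x + tang_deriv k f x * (x $ l * u x) \<partial>\<sigma>)"
    by (intro Bochner_Integration.integral_cong refl) (simp add: hess_entry_def algebra_simps)
  also have "\<dots> = (\<integral>x. tang_deriv k (tang_deriv l f) x * u x \<partial>\<sigma>)
      + (\<integral>x. tang_deriv k f x * (x $ l * u x) \<partial>\<sigma>)"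
    by (intro Bochner_Integration.integral_add smooth_S4_integrable smooth_S4_mult xu smooth_S4_tang_deriv assms)
  also have "\<dots> = (\<integral>x. f x * tang_adjoint l (tang_adjoint k u) x \<partial>\<sigma>)
      + (\<integral>x. f x * tang_adjoint k (\<lambda>x. x $ l * u x) x \<partial>\<sigma>)"
    by (simp only: integral_tang_adjoint smooth_S4_tang_deriv smooth_tang_adjoint assms xu)
  also have "\<dots> = (\<integral>x. f x * tang_adjoint l (tang_adjoint k u) x + f x * tang_adjoint k (\<lambda>x. x $ l * u x) x \<partial>\<sigma>)"
    by (intro Bochner_Integration.integral_add[symmetric] smooth_S4_integrable smooth_S4_mult
        smooth_tang_adjoint xu assms)
  finally show ?thesis by (simp add: distrib_left)
qed

text \<open>Integration by parts moves all derivatives from \<open>f\<close> onto \<open>g\<close>.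
  \<open>A\<close> involves derivatives of \<open>g\<close> up to order four, so the H^2 norm of
  \<open>g\<close> gives no control of its size; what counts is that \<open>A\<close> stays fixed
  while \<open>f\<close> varies.\<close>

lemma sob_inner_adjoint:
  assumes g: "smooth_S4 g"
  obtains A where "smooth_S4 A" "\<And>f. smooth_S4 f \<Longrightarrow> sob_inner f g = (\<integral>x. f x * A x \<partial>\<sigma>)"
proof
  let ?H = "\<lambda>k l x. tang_adjoint l (tang_adjoint k (hess_entry k l g)) x
      + tang_adjoint k (\<lambda>x. x $ l * hess_entry k l g x) x"
  let ?A = "\<lambda>x. g x + (\<Sum>i\<in>UNIV. tang_adjoint i (tang_deriv i g) x) + (\<Sum>k\<in>UNIV. \<Sum>l\<in>UNIV. ?H k l x)"
  have H: "smooth_S4 (?H k l)" for k l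
    by (intro smooth_S4_add smooth_tang_adjoint smooth_S4_mult smooth_S4_component smooth_hess_entry g)
  have T: "smooth_S4 (tang_adjoint i (tang_deriv i g))" for i
    by (intro smooth_tang_adjoint smooth_S4_tang_deriv g)
  have SH: "smooth_S4 (\<lambda>x. \<Sum>k\<in>UNIV. \<Sum>l\<in>UNIV. ?H k l x)"
    by (intro smooth_S4_sum H)
  have ST: "smooth_S4 (\<lambda>x. \<Sum>i\<in>UNIV. tang_adjoint i (tang_deriv i g) x)"
    by (intro smooth_S4_sum T)
  show "smooth_S4 ?A" by (intro smooth_S4_add g SH ST)
  fix f assume f: "smooth_S4 f"
  have 1: "(\<integral>x. (\<Sum>i\<in>UNIV. tang_deriv i f x * tang_deriv i g x) \<partial>\<sigma>)
     = (\<integral>x. f x * (\<Sum>i\<in>UNIV. tang_adjoint i (tang_deriv i g) x) \<partial>\<sigma>)"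
  proof -
    have "(\<integral>x. (\<Sum>i\<in>UNIV. tang_deriv i f x * tang_deriv i g x) \<partial>\<sigma>)
       = (\<Sum>i\<in>UNIV. \<integral>x. tang_deriv i f x * tang_deriv i g x \<partial>\<sigma>)"
      by (intro Bochner_Integration.integral_sum smooth_S4_integrable smooth_S4_mult smooth_S4_tang_deriv f g)
    also have "\<dots> = (\<Sum>i\<in>UNIV. \<integral>x. f x * tang_adjoint i (tang_deriv i g) x \<partial>\<sigma>)"
      by (intro sum.cong refl integral_tang_adjoint smooth_S4_tang_deriv f g)
    also have "\<dots> = (\<integral>x. (\<Sum>i\<in>UNIV. f x * tang_adjoint i (tang_deriv i g) x) \<partial>\<sigma>)"
      by (intro Bochner_Integration.integral_sum[symmetric] smooth_S4_integrable smooth_S4_mult T f)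
    finally show ?thesis by (simp add: sum_distrib_left)
  qed
  have 2: "(\<integral>x. (\<Sum>k\<in>UNIV. \<Sum>l\<in>UNIV. hess_entry k l f x * hess_entry k l g x) \<partial>\<sigma>)
     = (\<integral>x. f x * (\<Sum>k\<in>UNIV. \<Sum>l\<in>UNIV. ?H k l x) \<partial>\<sigma>)"
  proof -
    have "(\<integral>x. (\<Sum>k\<in>UNIV. \<Sum>l\<in>UNIV. hess_entry k l f x * hess_entry k l g x) \<partial>\<sigma>)
       = (\<Sum>k\<in>UNIV. \<integral>x. (\<Sum>l\<in>UNIV. hess_entry k l f x * hess_entry k l g x) \<partial>\<sigma>)"
      by (intro Bochner_Integration.integral_sum smooth_S4_integrable smooth_S4_sum smooth_S4_mult smooth_hess_entry f g)
    also have "\<dots> = (\<Sum>k\<in>UNIV. \<Sum>l\<in>UNIV. \<integral>x. hess_entry k l f x * hess_entry k l g x \<partial>\<sigma>)"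
      by (intro sum.cong refl Bochner_Integration.integral_sum smooth_S4_integrable smooth_S4_mult smooth_hess_entry f g)
    also have "\<dots> = (\<Sum>k\<in>UNIV. \<Sum>l\<in>UNIV. \<integral>x. f x * ?H k l x \<partial>\<sigma>)"
      by (intro sum.cong refl hess_entry_adjoint smooth_hess_entry f g)
    also have "\<dots> = (\<Sum>k\<in>UNIV. \<integral>x. (\<Sum>l\<in>UNIV. f x * ?H k l x) \<partial>\<sigma>)"
      by (intro sum.cong refl Bochner_Integration.integral_sum[symmetric] smooth_S4_integrable smooth_S4_mult H f)
    also have "\<dots> = (\<integral>x. (\<Sum>k\<in>UNIV. \<Sum>l\<in>UNIV. f x * ?H k l x) \<partial>\<sigma>)"
      by (intro Bochner_Integration.integral_sum[symmetric] smooth_S4_integrable smooth_S4_sum smooth_S4_mult H f)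
    finally show ?thesis by (simp only: sum_distrib_left)
  qed
  have i: "integrable \<sigma> (\<lambda>x. f x * g x)"
    "integrable \<sigma> (\<lambda>x. \<Sum>i\<in>UNIV. tang_deriv i f x * tang_deriv i g x)"
    "integrable \<sigma> (\<lambda>x. \<Sum>k\<in>UNIV. \<Sum>l\<in>UNIV. hess_entry k l f x * hess_entry k l g x)"
    "integrable \<sigma> (\<lambda>x. f x * (\<Sum>i\<in>UNIV. tang_adjoint i (tang_deriv i g) x))"
    "integrable \<sigma> (\<lambda>x. f x * (\<Sum>k\<in>UNIV. \<Sum>l\<in>UNIV. ?H k l x))"
    by (intro smooth_S4_integrable smooth_S4_sum smooth_S4_mult smooth_S4_tang_deriv smooth_hess_entry f g SH ST)+
  have "sob_inner f g = (\<integral>x. f x * g x \<partial>\<sigma>)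
      + (\<integral>x. (\<Sum>i\<in>UNIV. tang_deriv i f x * tang_deriv i g x) \<partial>\<sigma>)
      + (\<integral>x. (\<Sum>k\<in>UNIV. \<Sum>l\<in>UNIV. hess_entry k l f x * hess_entry k l g x) \<partial>\<sigma>)"
    unfolding sob_inner_def sob_density_def using i(1-3)
    by (simp only: Bochner_Integration.integral_add Bochner_Integration.integrable_add)
  also have "\<dots> = (\<integral>x. f x * g x + f x * (\<Sum>i\<in>UNIV. tang_adjoint i (tang_deriv i g) x)
      + f x * (\<Sum>k\<in>UNIV. \<Sum>l\<in>UNIV. ?H k l x) \<partial>\<sigma>)"
    unfolding 1 2 using i(1,4,5)
    by (simp only: Bochner_Integration.integral_add Bochner_Integration.integrable_add)
  finally show "sob_inner f g = (\<integral>x. f x * ?A x \<partial>\<sigma>)" by (simp only: distrib_left)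
qed

lemma H2_approxD:
  assumes "H2_approx \<phi> f"
  shows "smooth_S4 (\<phi> n)"
    "e > 0 \<Longrightarrow> \<exists>N. \<forall>m\<ge>N. \<forall>n\<ge>N. H2_norm_smooth (\<lambda>x. \<phi> m x - \<phi> n x) < e"
    "(\<lambda>n. \<integral>x. (\<phi> n x - f x)\<^sup>2 \<partial>\<sigma>) \<longlonglongrightarrow> 0"
  using assms unfolding H2_approx_def by auto

lemma H2_approx_bounded:
  assumes "H2_approx \<phi> f"
  obtains K where "K > 0" "\<forall>\<^sub>F n in sequentially. H2_norm_smooth (\<phi> n) \<le> K"
proof -
  note sm = H2_approxD(1)[OF assms]
  obtain N where N: "\<forall>m\<ge>N. \<forall>n\<ge>N. H2_norm_smooth (\<lambda>x. \<phi> m x - \<phi> n x) < 1"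
    using H2_approxD(2)[OF assms, of 1] by auto
  have "H2_norm_smooth (\<phi> n) \<le> H2_norm_smooth (\<phi> N) + 1" if "n \<ge> N" for n
    using H2_norm_smooth_diff_lower[OF sm sm, of n N] N that by fastforce
  then have "\<forall>\<^sub>F n in sequentially. H2_norm_smooth (\<phi> n) \<le> H2_norm_smooth (\<phi> N) + 1"
    unfolding eventually_sequentially by blast
  moreover have "H2_norm_smooth (\<phi> N) + 1 > 0"
    using H2_norm_smooth_nonneg[of "\<phi> N"] by linarith
  ultimately show ?thesis using that by blast
qed

text \<open>
  The \<open>H\<^sup>2\<close> norm is closable in \<open>L\<^sup>2\<close>: for smooth \<open>g\<close> the functional \<open>sob_inner _ g\<close> is bounded
  on \<open>L\<^sup>2\<close>, hence an \<open>H\<^sup>2\<close>-Cauchy sequence tending to \<open>0\<close> in \<open>L\<^sup>2\<close> tends to \<open>0\<close> in \<open>H\<^sup>2\<close>.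
\<close>

lemma H2_closable:
  assumes sm: "\<And>n. smooth_S4 (\<delta> n)"
    and cauchy: "\<And>e. e > 0 \<Longrightarrow> \<exists>N. \<forall>m\<ge>N. \<forall>n\<ge>N. H2_norm_smooth (\<lambda>x. \<delta> m x - \<delta> n x) < e"
    and lim: "(\<lambda>n. L2_norm (\<delta> n)) \<longlonglongrightarrow> 0"
  shows "(\<lambda>n. H2_norm_smooth (\<delta> n)) \<longlonglongrightarrow> 0"
proof (rule LIMSEQ_I)
  fix r :: real assume r: "r > 0"
  obtain M0 where M0: "\<forall>m\<ge>M0. \<forall>n\<ge>M0. H2_norm_smooth (\<lambda>x. \<delta> m x - \<delta> n x) < 1"
    using cauchy[of 1] by auto
  define K where "K = H2_norm_smooth (\<delta> M0) + 1"
  have K: "K > 0" using H2_norm_smooth_nonneg[of "\<delta> M0"] unfolding K_def by linarith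
  have bd: "H2_norm_smooth (\<delta> n) \<le> K" if "n \<ge> M0" for n
    using H2_norm_smooth_diff_lower[OF sm sm, of n M0] M0 that unfolding K_def by fastforce
  define e where "e = r\<^sup>2 / (2 * K)"
  have e: "e > 0" using r K by (simp add: e_def)
  obtain M1 where M1: "\<forall>m\<ge>M1. \<forall>n\<ge>M1. H2_norm_smooth (\<lambda>x. \<delta> m x - \<delta> n x) < e"
    using cauchy[OF e] by auto
  \<comment> \<open>\<open>M\<close> is frozen before \<open>n\<close> grows, because the function
    \<open>A\<close> representing the pairing with \<open>\<delta> M\<close> depends on
    \<open>M\<close>. In \<open>sob_inner (\<delta> n) (\<delta> n)\<close> the difference of
    \<open>\<delta> n\<close> and \<open>\<delta> M\<close> contributes at most
    \<open>e * K = r\<^sup>2 / 2\<close>, and the pairing with \<open>\<delta> M\<close> vanishes in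
    the limit together with the L^2 norm.\<close>
  define M where "M = max M0 M1"
  obtain A where A: "smooth_S4 A" "\<And>f. smooth_S4 f \<Longrightarrow> sob_inner f (\<delta> M) = (\<integral>x. f x * A x \<partial>\<sigma>)"
    using sob_inner_adjoint[OF sm] by blast
  have "(\<lambda>n. L2_norm (\<delta> n) * L2_norm A) \<longlonglongrightarrow> 0 * L2_norm A"
    by (intro tendsto_mult lim tendsto_const)
  then have "\<forall>\<^sub>F n in sequentially. L2_norm (\<delta> n) * L2_norm A < r\<^sup>2 / 2"
    using r by (intro order_tendstoD(2)[where y = "0 * L2_norm A"]) auto
  then obtain N where N: "\<And>n. n \<ge> N \<Longrightarrow> L2_norm (\<delta> n) * L2_norm A < r\<^sup>2 / 2"
    unfolding eventually_sequentially by blast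
  have "norm (H2_norm_smooth (\<delta> n) - 0) < r" if n: "n \<ge> max M N" for n
  proof -
    have sd: "smooth_S4 (\<lambda>x. \<delta> n x - \<delta> M x)" by (intro smooth_S4_diff sm)
    have "sob_inner (\<delta> n) (\<delta> n) = sob_inner (\<lambda>x. \<delta> n x - \<delta> M x) (\<delta> n) + sob_inner (\<delta> n) (\<delta> M)"
      using sob_inner_add_cmult[OF sm sm sm, of n "- 1" M n] by (simp add: sob_inner_commute)
    also have "sob_inner (\<lambda>x. \<delta> n x - \<delta> M x) (\<delta> n) \<le> H2_norm_smooth (\<lambda>x. \<delta> n x - \<delta> M x) * H2_norm_smooth (\<delta> n)"
      using sob_Cauchy_Schwarz[OF sd sm] by (rule order_trans[OF abs_ge_self])
    also have "\<dots> \<le> e * K"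
    proof (rule mult_mono)
      show "H2_norm_smooth (\<lambda>x. \<delta> n x - \<delta> M x) \<le> e"
        using M1 n unfolding M_def by (intro less_imp_le) auto
      show "H2_norm_smooth (\<delta> n) \<le> K" using bd n unfolding M_def by simp
    qed (use e H2_norm_smooth_nonneg in auto)
    also have "e * K = r\<^sup>2 / 2" using K by (simp add: e_def)
    also have "sob_inner (\<delta> n) (\<delta> M) \<le> L2_norm (\<delta> n) * L2_norm A"
      unfolding A(2)[OF sm] using L2_Cauchy_Schwarz[OF smooth_S4_L2[OF sm] smooth_S4_L2[OF A(1)]]
      by (rule order_trans[OF abs_ge_self])
    also have "\<dots> < r\<^sup>2 / 2" using N n by simp
    finally have "(H2_norm_smooth (\<delta> n))\<^sup>2 < r\<^sup>2"
      by (simp add: H2_norm_smooth_square[OF sm])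
    then have "H2_norm_smooth (\<delta> n) < r" using r by (simp add: power2_less_imp_less)
    then show ?thesis using H2_norm_smooth_nonneg[of "\<delta> n"] by simp
  qed
  then show "\<exists>no. \<forall>n\<ge>no. norm (H2_norm_smooth (\<delta> n) - 0) < r" by blast
qed

text \<open>The difference of the two sequences is H^2-Cauchy and tends to \<open>0\<close> in L^2,
  so closability applies.\<close>

lemma H2_approx_unique:
  assumes "H2_approx \<phi> f" "H2_approx \<psi> f" "f \<in> L2_S4"
  shows "(\<lambda>n. H2_norm_smooth (\<lambda>x. \<phi> n x - \<psi> n x)) \<longlonglongrightarrow> 0"
proof (rule H2_closable)
  note s1 = H2_approxD(1)[OF assms(1)] and s2 = H2_approxD(1)[OF assms(2)]
  show "smooth_S4 (\<lambda>x. \<phi> n x - \<psi> n x)" for n by (intro smooth_S4_diff s1 s2)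
  show "\<exists>N. \<forall>m\<ge>N. \<forall>n\<ge>N. H2_norm_smooth (\<lambda>x. \<phi> m x - \<psi> m x - (\<phi> n x - \<psi> n x)) < e" if "e > 0" for e
  proof -
    have e2: "e / 2 > 0" using that by simp
    obtain N1 where N1: "\<forall>m\<ge>N1. \<forall>n\<ge>N1. H2_norm_smooth (\<lambda>x. \<phi> m x - \<phi> n x) < e / 2"
      using H2_approxD(2)[OF assms(1) e2] by blast
    obtain N2 where N2: "\<forall>m\<ge>N2. \<forall>n\<ge>N2. H2_norm_smooth (\<lambda>x. \<psi> m x - \<psi> n x) < e / 2"
      using H2_approxD(2)[OF assms(2) e2] by blast
    have "H2_norm_smooth (\<lambda>x. \<phi> m x - \<psi> m x - (\<phi> n x - \<psi> n x)) < e"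
      if "m \<ge> max N1 N2" "n \<ge> max N1 N2" for m n
    proof -
      have "H2_norm_smooth (\<lambda>x. (\<phi> m x - \<phi> n x) - (\<psi> m x - \<psi> n x))
         \<le> H2_norm_smooth (\<lambda>x. \<phi> m x - \<phi> n x) + H2_norm_smooth (\<lambda>x. \<psi> m x - \<psi> n x)"
        by (intro H2_norm_smooth_diff smooth_S4_diff s1 s2)
      also have "\<dots> < e / 2 + e / 2"
        using N1 N2 that by (intro add_strict_mono) auto
      finally show ?thesis by (simp add: algebra_simps)
    qed
    then show ?thesis by blast
  qed
  have L1: "(\<lambda>x. \<phi> n x - f x) \<in> L2_S4" and L2: "(\<lambda>x. \<psi> n x - f x) \<in> L2_S4" for n
    by (intro L2_diff smooth_S4_L2 s1 s2 assms)+
  have "(\<lambda>n. \<integral>x. (\<phi> n x - \<psi> n x)\<^sup>2 \<partial>\<sigma>) \<longlonglongrightarrow> 0"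
  proof (rule tendsto_sandwich[where f = "\<lambda>_. 0"])
    show "(\<lambda>n. 2 * (\<integral>x. (\<phi> n x - f x)\<^sup>2 \<partial>\<sigma>) + 2 * (\<integral>x. (\<psi> n x - f x)\<^sup>2 \<partial>\<sigma>)) \<longlonglongrightarrow> 0"
      using tendsto_add[OF tendsto_mult[OF tendsto_const H2_approxD(3)[OF assms(1)], of 2]
        tendsto_mult[OF tendsto_const H2_approxD(3)[OF assms(2)], of 2]] by simp
    have "(\<integral>x. (\<phi> n x - \<psi> n x)\<^sup>2 \<partial>\<sigma>) \<le> 2 * (\<integral>x. (\<phi> n x - f x)\<^sup>2 \<partial>\<sigma>) + 2 * (\<integral>x. (\<psi> n x - f x)\<^sup>2 \<partial>\<sigma>)" for n
    proof -
      have sq: "(a - b)\<^sup>2 \<le> 2 * (a - c)\<^sup>2 + 2 * (b - c)\<^sup>2" for a b c :: real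
        using zero_le_power2[of "a + b - 2 * c"] by (simp add: power2_eq_square algebra_simps)
      have "(\<integral>x. (\<phi> n x - \<psi> n x)\<^sup>2 \<partial>\<sigma>) \<le> (\<integral>x. 2 * (\<phi> n x - f x)\<^sup>2 + 2 * (\<psi> n x - f x)\<^sup>2 \<partial>\<sigma>)"
        using L2_S4_D(2)[OF L1] L2_S4_D(2)[OF L2] L2_S4_D(2)[OF L2_diff[OF smooth_S4_L2[OF s1] smooth_S4_L2[OF s2]]]
        by (intro integral_mono) (auto intro: sq)
      also have "\<dots> = 2 * (\<integral>x. (\<phi> n x - f x)\<^sup>2 \<partial>\<sigma>) + 2 * (\<integral>x. (\<psi> n x - f x)\<^sup>2 \<partial>\<sigma>)"
        using L2_S4_D(2)[OF L1] L2_S4_D(2)[OF L2] by simp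
      finally show ?thesis .
    qed
    then show "\<forall>\<^sub>F n in sequentially. (\<integral>x. (\<phi> n x - \<psi> n x)\<^sup>2 \<partial>\<sigma>)
       \<le> 2 * (\<integral>x. (\<phi> n x - f x)\<^sup>2 \<partial>\<sigma>) + 2 * (\<integral>x. (\<psi> n x - f x)\<^sup>2 \<partial>\<sigma>)" by simp
  qed auto
  then show "(\<lambda>n. L2_norm (\<lambda>x. \<phi> n x - \<psi> n x)) \<longlonglongrightarrow> 0"
    using tendsto_real_sqrt by fastforce
qed

section \<open>Functionals extended by continuity: the Sobolev norm and the Paneitz form\<close>

lemma H2_extend_eqI:
  assumes "f \<in> H2_S4" "\<And>\<phi>. H2_approx \<phi> f \<Longrightarrow> (\<lambda>n. q (\<phi> n)) \<longlonglongrightarrow> r"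
  shows "H2_extend q f = r"
proof -
  obtain \<phi> where "H2_approx \<phi> f" using assms(1) by (auto simp: H2_S4_def)
  with assms(2) show ?thesis
    unfolding H2_extend_def by (intro the_equality) (auto intro: LIMSEQ_unique)
qed

text \<open>The hypothesis on \<open>q\<close> is the Lipschitz bound satisfied by a bounded
  quadratic form. Approximating sequences are bounded in H^2, so the values of \<open>q\<close> are
  Cauchy, and \<open>H2_approx_unique\<close> gives all sequences the same limit; the description in
  \<open>H2_extend\<close> is then proper.\<close>

lemma H2_extend_tendsto:
  assumes f: "f \<in> H2_S4" and \<phi>: "H2_approx \<phi> f"
    and q: "\<And>u v. smooth_S4 u \<Longrightarrow> smooth_S4 v \<Longrightarrow>
      \<bar>q u - q v\<bar> \<le> C * H2_norm_smooth (\<lambda>x. u x - v x) * (1 + H2_norm_smooth u + H2_norm_smooth v)"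
    and C: "C > 0"
  shows "(\<lambda>n. q (\<phi> n)) \<longlonglongrightarrow> H2_extend q f"
proof -
  have fL: "f \<in> L2_S4" using f by (simp add: H2_S4_def)
  have "convergent (\<lambda>n. q (\<phi> n))"
  proof (rule Cauchy_convergent, rule metric_CauchyI)
    fix e :: real assume e: "e > 0"
    obtain K where K: "K > 0" "\<forall>\<^sub>F n in sequentially. H2_norm_smooth (\<phi> n) \<le> K"
      using H2_approx_bounded[OF \<phi>] by blast
    obtain N1 where N1: "\<And>n. n \<ge> N1 \<Longrightarrow> H2_norm_smooth (\<phi> n) \<le> K"
      using K(2) unfolding eventually_sequentially by blast
    have e': "e / (C * (1 + K + K)) > 0" using e C K by simp
    obtain N2 where N2: "\<forall>m\<ge>N2. \<forall>n\<ge>N2. H2_norm_smooth (\<lambda>x. \<phi> m x - \<phi> n x) < e / (C * (1 + K + K))"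
      using H2_approxD(2)[OF \<phi> e'] by blast
    have "dist (q (\<phi> m)) (q (\<phi> n)) < e" if "m \<ge> max N1 N2" "n \<ge> max N1 N2" for m n
    proof -
      have "\<bar>q (\<phi> m) - q (\<phi> n)\<bar> \<le> C * H2_norm_smooth (\<lambda>x. \<phi> m x - \<phi> n x)
          * (1 + H2_norm_smooth (\<phi> m) + H2_norm_smooth (\<phi> n))"
        by (intro q H2_approxD(1)[OF \<phi>])
      also have "\<dots> \<le> C * H2_norm_smooth (\<lambda>x. \<phi> m x - \<phi> n x) * (1 + K + K)"
        using C N1 that H2_norm_smooth_nonneg by (intro mult_left_mono add_mono) auto
      also have "\<dots> = H2_norm_smooth (\<lambda>x. \<phi> m x - \<phi> n x) * (C * (1 + K + K))" by simp
      also have "\<dots> < e / (C * (1 + K + K)) * (C * (1 + K + K))"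
        using N2 that C K by (intro mult_strict_right_mono) auto
      also have "\<dots> = e" using C K by simp
      finally show ?thesis by (simp add: dist_real_def)
    qed
    then show "\<exists>M. \<forall>m\<ge>M. \<forall>n\<ge>M. dist (q (\<phi> m)) (q (\<phi> n)) < e" by blast
  qed
  then obtain r where r: "(\<lambda>n. q (\<phi> n)) \<longlonglongrightarrow> r" by (auto simp: convergent_def)
  have "(\<lambda>n. q (\<psi> n)) \<longlonglongrightarrow> r" if \<psi>: "H2_approx \<psi> f" for \<psi>
  proof -
    obtain K1 where K1: "K1 > 0" "\<forall>\<^sub>F n in sequentially. H2_norm_smooth (\<phi> n) \<le> K1"
      using H2_approx_bounded[OF \<phi>] by blast
    obtain K2 where K2: "K2 > 0" "\<forall>\<^sub>F n in sequentially. H2_norm_smooth (\<psi> n) \<le> K2"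
      using H2_approx_bounded[OF \<psi>] by blast
    have "(\<lambda>n. q (\<psi> n) - q (\<phi> n)) \<longlonglongrightarrow> 0"
    proof (rule tendsto_rabs_zero_cancel, rule tendsto_sandwich[where f = "\<lambda>_. 0"])
      show "(\<lambda>n. C * H2_norm_smooth (\<lambda>x. \<psi> n x - \<phi> n x) * (1 + K2 + K1)) \<longlonglongrightarrow> 0"
        using tendsto_mult[OF tendsto_mult[OF tendsto_const H2_approx_unique[OF \<psi> \<phi> fL], of C] tendsto_const]
        by simp
      show "\<forall>\<^sub>F n in sequentially. \<bar>q (\<psi> n) - q (\<phi> n)\<bar> \<le> C * H2_norm_smooth (\<lambda>x. \<psi> n x - \<phi> n x) * (1 + K2 + K1)"
        using K1(2) K2(2)
      proof eventually_elim
        case (elim n)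
        have "\<bar>q (\<psi> n) - q (\<phi> n)\<bar> \<le> C * H2_norm_smooth (\<lambda>x. \<psi> n x - \<phi> n x)
          * (1 + H2_norm_smooth (\<psi> n) + H2_norm_smooth (\<phi> n))"
          by (intro q H2_approxD(1)[OF \<phi>] H2_approxD(1)[OF \<psi>])
        also have "\<dots> \<le> C * H2_norm_smooth (\<lambda>x. \<psi> n x - \<phi> n x) * (1 + K2 + K1)"
          using C elim H2_norm_smooth_nonneg by (intro mult_left_mono add_mono) auto
        finally show ?case .
      qed
    qed auto
    from tendsto_add[OF this r] show ?thesis by simp
  qed
  then have "H2_extend q f = r" by (rule H2_extend_eqI[OF f])
  with r show ?thesis by simp
qed

lemma H2_norm_tendsto:
  assumes "f \<in> H2_S4" "H2_approx \<phi> f"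
  shows "(\<lambda>n. H2_norm_smooth (\<phi> n)) \<longlonglongrightarrow> H2_norm f"
  unfolding H2_norm_def
proof (rule H2_extend_tendsto[OF assms, of _ 1])
  fix u v assume uv: "smooth_S4 u" "smooth_S4 v"
  have "\<bar>H2_norm_smooth u - H2_norm_smooth v\<bar> \<le> H2_norm_smooth (\<lambda>x. u x - v x) * 1"
    using H2_norm_smooth_diff_lower[OF uv] by simp
  also have "\<dots> \<le> H2_norm_smooth (\<lambda>x. u x - v x) * (1 + H2_norm_smooth u + H2_norm_smooth v)"
    using H2_norm_smooth_nonneg by (intro mult_left_mono) (auto simp: add_nonneg_nonneg)
  finally show "\<bar>H2_norm_smooth u - H2_norm_smooth v\<bar>
     \<le> 1 * H2_norm_smooth (\<lambda>x. u x - v x) * (1 + H2_norm_smooth u + H2_norm_smooth v)" by simp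
qed simp

lemma paneitz_form_tendsto:
  assumes "f \<in> H2_S4" "H2_approx \<phi> f"
  shows "(\<lambda>n. L2_inner (\<phi> n) (paneitz_S4 (\<phi> n))) \<longlonglongrightarrow> paneitz_form f"
  unfolding paneitz_form_def
\<comment> \<open>\<open>35 = 5 * 5 + 5 + 5\<close>: one summand for each term of the polarised
  difference, every Laplacian costing a factor \<open>5\<close>.\<close>
proof (rule H2_extend_tendsto[OF assms, of _ 35])
  fix u v assume uv: "smooth_S4 u" "smooth_S4 v"
  let ?d = "\<lambda>x. u x - v x" and ?s = "\<lambda>x. u x + v x"
  let ?N = "H2_norm_smooth"
  have d: "smooth_S4 ?d" and s: "smooth_S4 ?s"
    using uv by (auto intro: smooth_S4_diff smooth_S4_add)
  have i: "integrable \<sigma> (\<lambda>x. lap f x * lap f x - 2 * (f x * lap f x))" if "smooth_S4 f" for f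
    by (intro smooth_S4_integrable smooth_S4_diff smooth_S4_mult smooth_S4_const smooth_lap that)
  have j: "integrable \<sigma> (\<lambda>x. f x * g x)" if "smooth_S4 f" "smooth_S4 g" for f g
    by (intro smooth_S4_integrable smooth_S4_mult that)
  have b: "\<bar>\<integral>x. f x * g x \<partial>\<sigma>\<bar> \<le> L2_norm f * L2_norm g" if "smooth_S4 f" "smooth_S4 g" for f g
    by (intro L2_Cauchy_Schwarz smooth_S4_L2 that)
  have "L2_inner u (paneitz_S4 u) - L2_inner v (paneitz_S4 v)
     = (\<integral>x. (lap u x * lap u x - 2 * (u x * lap u x)) - (lap v x * lap v x - 2 * (v x * lap v x)) \<partial>\<sigma>)"
    unfolding L2_inner_paneitz[OF uv(1)] L2_inner_paneitz[OF uv(2)]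
    by (intro Bochner_Integration.integral_diff[symmetric] i uv)
  \<comment> \<open>Polarisation: the difference of two values of a quadratic form is its symmetric
    bilinear form at \<open>u - v\<close> and \<open>u + v\<close>.\<close>
  also have "\<dots> = (\<integral>x. lap ?d x * lap ?s x - ?d x * lap ?s x - ?s x * lap ?d x \<partial>\<sigma>)"
    by (intro Bochner_Integration.integral_cong refl)
       (simp add: lap_add[OF uv] lap_diff[OF uv] algebra_simps)
  also have "\<dots> = (\<integral>x. lap ?d x * lap ?s x \<partial>\<sigma>) - (\<integral>x. ?d x * lap ?s x \<partial>\<sigma>) - (\<integral>x. ?s x * lap ?d x \<partial>\<sigma>)"
    using j[OF smooth_lap[OF d] smooth_lap[OF s]] j[OF d smooth_lap[OF s]] j[OF s smooth_lap[OF d]]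
    by (simp only: Bochner_Integration.integral_diff Bochner_Integration.integrable_diff)
  finally have eq: "L2_inner u (paneitz_S4 u) - L2_inner v (paneitz_S4 v)
     = (\<integral>x. lap ?d x * lap ?s x \<partial>\<sigma>) - (\<integral>x. ?d x * lap ?s x \<partial>\<sigma>) - (\<integral>x. ?s x * lap ?d x \<partial>\<sigma>)" .
  have mm: "L2_norm f * L2_norm g \<le> a * b" if "L2_norm f \<le> a" "L2_norm g \<le> b" for f g a b
  proof -
    have "0 \<le> L2_norm f" "0 \<le> L2_norm g" by simp_all
    then show ?thesis using that by (intro mult_mono) linarith+
  qed
  have "\<bar>\<integral>x. lap ?d x * lap ?s x \<partial>\<sigma>\<bar> \<le> (5 * ?N ?d) * (5 * ?N ?s)"
    using b[OF smooth_lap[OF d] smooth_lap[OF s]] mm[OF L2_norm_lap_le[OF d] L2_norm_lap_le[OF s]] by linarith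
  moreover have "\<bar>\<integral>x. ?d x * lap ?s x \<partial>\<sigma>\<bar> \<le> ?N ?d * (5 * ?N ?s)"
    using b[OF d smooth_lap[OF s]] mm[OF L2_norm_le_H2_norm_smooth[OF d] L2_norm_lap_le[OF s]] by linarith
  moreover have "\<bar>\<integral>x. ?s x * lap ?d x \<partial>\<sigma>\<bar> \<le> ?N ?s * (5 * ?N ?d)"
    using b[OF s smooth_lap[OF d]] mm[OF L2_norm_le_H2_norm_smooth[OF s] L2_norm_lap_le[OF d]] by linarith
  ultimately have "\<bar>L2_inner u (paneitz_S4 u) - L2_inner v (paneitz_S4 v)\<bar> \<le> 35 * ?N ?d * ?N ?s"
    unfolding eq by (simp add: algebra_simps)
  also have "\<dots> \<le> 35 * ?N ?d * (1 + ?N u + ?N v)"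
  proof (rule mult_left_mono)
    show "?N ?s \<le> 1 + ?N u + ?N v" using H2_norm_smooth_add[OF uv] by simp
  qed (simp add: H2_norm_smooth_nonneg)
  finally show "\<bar>L2_inner u (paneitz_S4 u) - L2_inner v (paneitz_S4 v)\<bar> \<le> 35 * ?N ?d * (1 + ?N u + ?N v)" .
qed simp

subsection \<open>Zonal integrals and the Riesz kernel\<close>

lemma inner_S4_bounds:
  assumes "x \<in> S4" "y \<in> S4"
  shows "x \<bullet> y \<le> 1" "- 1 \<le> x \<bullet> y"
  using Cauchy_Schwarz_ineq2[of x y] assms by auto

lemma tang_deriv_inner:
  assumes "y \<in> S4"
  shows "tang_deriv i (\<lambda>y. x \<bullet> y) y = x $ i - y $ i * (x \<bullet> y)"
proof -
  have y: "y \<noteq> 0" using assms by auto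
  have "tang_deriv i (\<lambda>y. x \<bullet> y) y = (\<Sum>j\<in>UNIV. tang_deriv i (\<lambda>y. x $ j * y $ j) y)"
    unfolding inner_vec_def inner_real_def
    by (intro tang_deriv_sum smooth_S4_mult smooth_S4_const smooth_S4_component y)
  also have "\<dots> = (\<Sum>j\<in>UNIV. x $ j * ((if i = j then 1 else 0) - y $ i * y $ j))"
    by (simp only: tang_deriv_cmult[OF smooth_S4_component y] tang_deriv_component[OF assms])
  also have "\<dots> = (\<Sum>j\<in>UNIV. (if i = j then x $ j else 0) - y $ i * (x $ j * y $ j))"
    by (intro sum.cong refl) (auto simp: algebra_simps)
  also have "\<dots> = x $ i - y $ i * (\<Sum>j\<in>UNIV. x $ j * y $ j)"
    unfolding sum_subtractf sum_distrib_left[symmetric] by simp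
  finally show ?thesis by (simp add: inner_vec_def)
qed

lemma sum_tang_deriv_inner_square:
  assumes "x \<in> S4" "y \<in> S4"
  shows "(\<Sum>i\<in>UNIV. tang_deriv i (\<lambda>y. x \<bullet> y) y * tang_deriv i (\<lambda>y. x \<bullet> y) y) = 1 - (x \<bullet> y)\<^sup>2"
proof -
  have "(\<Sum>i\<in>UNIV. tang_deriv i (\<lambda>y. x \<bullet> y) y * tang_deriv i (\<lambda>y. x \<bullet> y) y)
    = (\<Sum>i\<in>UNIV. x $ i * x $ i - (2 * (x \<bullet> y)) * (x $ i * y $ i) + (x \<bullet> y)\<^sup>2 * (y $ i * y $ i))"
    by (intro sum.cong refl) (simp add: tang_deriv_inner[OF assms(2)] algebra_simps power2_eq_square)
  also have "\<dots> = (\<Sum>i\<in>UNIV. x $ i * x $ i) - (2 * (x \<bullet> y)) * (\<Sum>i\<in>UNIV. x $ i * y $ i)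
      + (x \<bullet> y)\<^sup>2 * (\<Sum>i\<in>UNIV. y $ i * y $ i)"
    unfolding sum.distrib sum_subtractf sum_distrib_left[symmetric] by simp
  also have "(\<Sum>i\<in>UNIV. x $ i * y $ i) = x \<bullet> y" by (simp add: inner_vec_def)
  finally show ?thesis
    by (simp only: sum_S4_squares[OF assms(1)] sum_S4_squares[OF assms(2)])
       (simp add: power2_eq_square algebra_simps)
qed

lemma lap_inner:
  assumes "y \<in> S4"
  shows "lap (\<lambda>y. x \<bullet> y) y = - 4 * (x \<bullet> y)"
proof -
  have y: "y \<noteq> 0" using assms by auto
  have "tang_deriv k (tang_deriv k (\<lambda>y. x \<bullet> y)) y
      = - (x \<bullet> y) + (y $ k * y $ k) * (x \<bullet> y) - y $ k * tang_deriv k (\<lambda>y. x \<bullet> y) y" for k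
  proof -
    have "tang_deriv k (tang_deriv k (\<lambda>y. x \<bullet> y)) y = tang_deriv k (\<lambda>y. x $ k - y $ k * (x \<bullet> y)) y"
      by (rule tang_deriv_cong[OF tang_deriv_inner y])
    also have "\<dots> = - tang_deriv k (\<lambda>y. y $ k * (x \<bullet> y)) y"
      using tang_deriv_diff[OF smooth_S4_const smooth_S4_mult[OF smooth_S4_component smooth_S4_inner] y]
      by simp
    also have "tang_deriv k (\<lambda>y. y $ k * (x \<bullet> y)) y
       = y $ k * tang_deriv k (\<lambda>y. x \<bullet> y) y + tang_deriv k (\<lambda>y. y $ k) y * (x \<bullet> y)"
      by (rule tang_deriv_mult[OF smooth_S4_component smooth_S4_inner assms])
    finally show ?thesis
      by (simp add: tang_deriv_component[OF assms] algebra_simps)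
  qed
  then have "lap (\<lambda>y. x \<bullet> y) y = (\<Sum>k\<in>UNIV. - (x \<bullet> y) + (y $ k * y $ k) * (x \<bullet> y)
      - y $ k * tang_deriv k (\<lambda>y. x \<bullet> y) y)"
    by (simp add: lap_def)
  also have "\<dots> = - 5 * (x \<bullet> y) + (\<Sum>k\<in>UNIV. y $ k * y $ k) * (x \<bullet> y)
      - (\<Sum>k\<in>UNIV. y $ k * tang_deriv k (\<lambda>y. x \<bullet> y) y)"
    unfolding sum.distrib sum_subtractf sum_distrib_right by simp
  finally show ?thesis
    using sum_S4_squares[OF assms] tang_deriv_normal[OF smooth_S4_inner y] by simp
qed

lemma tang_deriv_power:
  assumes "smooth_S4 f" "x \<in> S4"
  shows "tang_deriv i (\<lambda>x. f x ^ n) x = real n * f x ^ (n - 1) * tang_deriv i f x"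
proof (induction n)
  case (Suc n)
  have "tang_deriv i (\<lambda>x. f x ^ Suc n) x = f x * tang_deriv i (\<lambda>x. f x ^ n) x + tang_deriv i f x * f x ^ n"
    using tang_deriv_mult[OF assms(1) smooth_S4_power[OF assms(1), of n] assms(2)] by simp
  then show ?case unfolding Suc by (cases n) (auto simp: algebra_simps)
qed simp

text \<open>Green's formula for \<open>x \<bullet> y\<close> against its \<open>n\<close>-th power:
  \<open>lap\<close> multiplies the former by \<open>- 4\<close>, and its gradient has squared
  length \<open>1 - (x \<bullet> y)\<^sup>2\<close>. For \<open>n = 0\<close> the truncated
  \<open>n - 1\<close> carries the factor \<open>0\<close>, and the first moment vanishes.\<close>

lemma zonal_moment_rec:
  assumes "x \<in> S4"
  shows "(real n + 4) * (\<integral>y. (x \<bullet> y) ^ Suc n \<partial>\<sigma>) = real n * (\<integral>y. (x \<bullet> y) ^ (n - 1) \<partial>\<sigma>)"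
proof -
  have pw: "smooth_S4 (\<lambda>y. (x \<bullet> y) ^ k)" for k
    by (intro smooth_S4_power smooth_S4_inner)
  note ipw = smooth_S4_integrable[OF pw]
  have "- 4 * (\<integral>y. (x \<bullet> y) ^ Suc n \<partial>\<sigma>) = (\<integral>y. lap (\<lambda>y. x \<bullet> y) y * (x \<bullet> y) ^ n \<partial>\<sigma>)"
    unfolding Bochner_Integration.integral_mult_right_zero[symmetric]
    by (intro Bochner_Integration.integral_cong refl) (simp add: lap_inner)
  also have "\<dots> = - (\<integral>y. (\<Sum>k\<in>UNIV. tang_deriv k (\<lambda>y. x \<bullet> y) y * tang_deriv k (\<lambda>y. (x \<bullet> y) ^ n) y) \<partial>\<sigma>)"
    by (rule integral_lap_mult[OF smooth_S4_inner pw])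
  also have "(\<integral>y. (\<Sum>k\<in>UNIV. tang_deriv k (\<lambda>y. x \<bullet> y) y * tang_deriv k (\<lambda>y. (x \<bullet> y) ^ n) y) \<partial>\<sigma>)
     = (\<integral>y. real n * (x \<bullet> y) ^ (n - 1) - real n * (x \<bullet> y) ^ Suc n \<partial>\<sigma>)"
  proof (intro Bochner_Integration.integral_cong refl)
    fix y assume "y \<in> space \<sigma>"
    then have y: "y \<in> S4" by simp
    have "(\<Sum>k\<in>UNIV. tang_deriv k (\<lambda>y. x \<bullet> y) y * tang_deriv k (\<lambda>y. (x \<bullet> y) ^ n) y)
      = real n * (x \<bullet> y) ^ (n - 1) * (\<Sum>k\<in>UNIV. tang_deriv k (\<lambda>y. x \<bullet> y) y * tang_deriv k (\<lambda>y. x \<bullet> y) y)"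
      unfolding tang_deriv_power[OF smooth_S4_inner y] sum_distrib_left
      by (intro sum.cong refl) (simp add: algebra_simps)
    also have "\<dots> = real n * (x \<bullet> y) ^ (n - 1) - real n * (x \<bullet> y) ^ Suc n"
      unfolding sum_tang_deriv_inner_square[OF assms y]
      by (cases n) (auto simp: algebra_simps power2_eq_square)
    finally show "(\<Sum>k\<in>UNIV. tang_deriv k (\<lambda>y. x \<bullet> y) y * tang_deriv k (\<lambda>y. (x \<bullet> y) ^ n) y)
      = real n * (x \<bullet> y) ^ (n - 1) - real n * (x \<bullet> y) ^ Suc n" .
  qed
  also have "\<dots> = real n * (\<integral>y. (x \<bullet> y) ^ (n - 1) \<partial>\<sigma>) - real n * (\<integral>y. (x \<bullet> y) ^ Suc n \<partial>\<sigma>)"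
    using ipw by (simp del: power_Suc)
  finally show ?thesis by (simp add: algebra_simps)
qed

text \<open>The recursion descends in steps of two to the total measure and the vanishing first
  moment. The closed form is \<open>2 * pi\<^sup>2\<close> times the one in
  \<open>integral_power_weight\<close>.\<close>

lemma zonal_moment:
  assumes "x \<in> S4"
  shows "(\<integral>y. (x \<bullet> y) ^ n \<partial>\<sigma>) = 4 * pi\<^sup>2 * (1 + (- 1) ^ n) / ((real n + 1) * (real n + 3))"
proof (induction n rule: less_induct)
  case (less n)
  consider "n = 0" | "n = 1" | m where "n = Suc (Suc m)"
    by (metis One_nat_def not0_implies_Suc)
  then show ?case
  proof cases
    case 1
    then show ?thesis using measure_S4 by simp
  next
    case 2
    then show ?thesis using zonal_moment_rec[OF assms, of 0] by simp
  next
    case 3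
    have "(real (Suc m) + 4) * (\<integral>y. (x \<bullet> y) ^ n \<partial>\<sigma>) = real (Suc m) * (\<integral>y. (x \<bullet> y) ^ m \<partial>\<sigma>)"
      using zonal_moment_rec[OF assms, of "Suc m"] 3 by simp
    also have "\<dots> = real (Suc m) * (4 * pi\<^sup>2 * (1 + (- 1) ^ m) / ((real m + 1) * (real m + 3)))"
      using less[of m] 3 by simp
    also have "\<dots> = (real (Suc m) + 4) * (4 * pi\<^sup>2 * (1 + (- 1) ^ n) / ((real n + 1) * (real n + 3)))"
      using 3 by (simp add: divide_simps) (simp add: algebra_simps)
    finally show ?thesis
      by (rule mult_left_cancel[THEN iffD1, rotated]) linarith
  qed
qed

lemma integral_power_weight:
  "((\<lambda>t. t ^ n * (1 - t\<^sup>2)) has_integral 2 * (1 + (- 1) ^ n) / ((real n + 1) * (real n + 3))) {- 1..1 :: real}"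
proof -
  let ?F = "\<lambda>t :: real. t ^ (n + 1) / (real n + 1) - t ^ (n + 3) / (real n + 3)"
  have "((\<lambda>t. t ^ n * (1 - t\<^sup>2)) has_integral ?F 1 - ?F (- 1)) {- 1..1}"
  proof (rule fundamental_theorem_of_calculus)
    fix t :: real
    have "(?F has_real_derivative (real (n + 1) * t ^ n / (real n + 1) - real (n + 3) * t ^ (n + 2) / (real n + 3))) (at t within {- 1..1})"
      by (rule derivative_eq_intros refl | simp add: numeral_eq_Suc)+
    also have "real (n + 1) * t ^ n / (real n + 1) = t ^ n"
      by (simp add: nonzero_divide_eq_eq add_nonneg_eq_0_iff)
    also have "real (n + 3) * t ^ (n + 2) / (real n + 3) = t ^ (n + 2)"
      by (simp add: nonzero_divide_eq_eq add_nonneg_eq_0_iff)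
    also have "t ^ n - t ^ (n + 2) = t ^ n * (1 - t\<^sup>2)"
      by (simp add: power_add algebra_simps power2_eq_square)
    finally show "(?F has_vector_derivative t ^ n * (1 - t\<^sup>2)) (at t within {- 1..1})"
      by (simp add: has_real_derivative_iff_has_vector_derivative)
  qed simp
  also have "?F 1 - ?F (- 1) = 2 * (1 + (- 1) ^ n) / ((real n + 1) * (real n + 3))"
    by (simp add: divide_simps) (simp add: numeral_eq_Suc algebra_simps)
  finally show ?thesis .
qed

lemma continuous_on_zonal:
  assumes "continuous_on {- 1..1} u" "x \<in> S4"
  shows "continuous_on S4 (\<lambda>y. u (x \<bullet> y))"
  by (rule continuous_on_compose2[OF assms(1)]) (use inner_S4_bounds[OF assms(2)] in \<open>auto intro!: continuous_intros\<close>)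

text \<open>\<open>1 - t\<^sup>2\<close> is, up to a constant, the density of the height
  \<open>x \<bullet> y\<close>, and \<open>2 * pi\<^sup>2\<close> is the measure of the unit
  three-sphere. Instead of slicing the sphere, the two sides are compared on monomials and extended
  by polynomial approximation.\<close>

lemma zonal_integral:
  fixes u :: "real \<Rightarrow> real"
  assumes u: "continuous_on {- 1..1} u" and x: "x \<in> S4"
  shows "(\<integral>y. u (x \<bullet> y) \<partial>\<sigma>) = 2 * pi\<^sup>2 * integral {- 1..1} (\<lambda>t. u t * (1 - t\<^sup>2))"
proof -
  let ?J = "\<lambda>u. 2 * pi\<^sup>2 * integral {- 1..1} (\<lambda>t. u t * (1 - t\<^sup>2))"
  have poly: "(\<integral>y. (\<Sum>i\<le>n. a i * (x \<bullet> y) ^ i) \<partial>\<sigma>) = ?J (\<lambda>t. \<Sum>i\<le>n. a i * t ^ i)" for a :: "nat \<Rightarrow> real" and n :: nat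
  proof -
    have "(\<integral>y. (\<Sum>i\<le>n. a i * (x \<bullet> y) ^ i) \<partial>\<sigma>) = (\<Sum>i\<le>n. a i * (\<integral>y. (x \<bullet> y) ^ i \<partial>\<sigma>))"
      by (subst Bochner_Integration.integral_sum)
         (auto intro!: smooth_S4_integrable smooth_S4_mult smooth_S4_power)
    also have "\<dots> = 2 * pi\<^sup>2 * (\<Sum>i\<le>n. a i * (2 * (1 + (- 1) ^ i) / ((real i + 1) * (real i + 3))))"
      unfolding zonal_moment[OF x] sum_distrib_left by (intro sum.cong refl) simp
    also have "((\<lambda>t. \<Sum>i\<le>n. a i * (t ^ i * (1 - t\<^sup>2))) has_integral
       (\<Sum>i\<le>n. a i * (2 * (1 + (- 1) ^ i) / ((real i + 1) * (real i + 3))))) {- 1..1}"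
      by (intro has_integral_sum has_integral_mult_right integral_power_weight) simp
    then have "(\<Sum>i\<le>n. a i * (2 * (1 + (- 1) ^ i) / ((real i + 1) * (real i + 3))))
       = integral {- 1..1} (\<lambda>t. \<Sum>i\<le>n. a i * (t ^ i * (1 - t\<^sup>2)))"
      by (simp add: integral_unique)
    also have "(\<lambda>t. \<Sum>i\<le>n. a i * (t ^ i * (1 - t\<^sup>2))) = (\<lambda>t. (\<Sum>i\<le>n. a i * t ^ i) * (1 - t\<^sup>2))"
      by (simp add: sum_distrib_right mult.assoc)
    finally show ?thesis .
  qed
  have w: "(\<lambda>t. u t * (1 - t\<^sup>2)) integrable_on {- 1..1}" if "continuous_on {- 1..1} u" for u :: "real \<Rightarrow> real"
    by (intro integrable_continuous_real continuous_intros that)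
  \<comment> \<open>A uniform error \<open>e\<close> costs the total measure
    \<open>8 * pi\<^sup>2 / 3\<close> on the sphere and at most \<open>2 * pi\<^sup>2 * 2\<close> on
    the interval.\<close>
  have "\<bar>(\<integral>y. u (x \<bullet> y) \<partial>\<sigma>) - ?J u\<bar> \<le> (8 * pi\<^sup>2 / 3 + 4 * pi\<^sup>2) * e" if e: "e > 0" for e
  proof -
    obtain p where p: "real_polynomial_function p" "\<And>t. t \<in> {- 1..1} \<Longrightarrow> \<bar>u t - p t\<bar> < e"
      using Stone_Weierstrass_real_polynomial_function[OF compact_Icc u e] by blast
    obtain a n where an: "p = (\<lambda>t. \<Sum>i\<le>n. a i * t ^ i)"
      using p(1) unfolding real_polynomial_function_iff_sum by blast
    have cp: "continuous_on {- 1..1} p" unfolding an by (intro continuous_intros)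
    note iu = continuous_on_S4_integrable[OF continuous_on_zonal[OF u x]]
    note ip = continuous_on_S4_integrable[OF continuous_on_zonal[OF cp x]]
    have "\<bar>(\<integral>y. u (x \<bullet> y) \<partial>\<sigma>) - (\<integral>y. p (x \<bullet> y) \<partial>\<sigma>)\<bar> = \<bar>\<integral>y. u (x \<bullet> y) - p (x \<bullet> y) \<partial>\<sigma>\<bar>"
      using iu ip by simp
    also have "\<dots> \<le> (\<integral>y. \<bar>u (x \<bullet> y) - p (x \<bullet> y)\<bar> \<partial>\<sigma>)"
      by (rule integral_abs_bound)
    also have "\<dots> \<le> (\<integral>y. e \<partial>\<sigma>)"
      using p(2) inner_S4_bounds[OF x] iu ip
      by (intro integral_mono) (auto intro!: less_imp_le)
    also have "\<dots> = 8 * pi\<^sup>2 / 3 * e" using measure_S4 by simp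
    finally have 1: "\<bar>(\<integral>y. u (x \<bullet> y) \<partial>\<sigma>) - (\<integral>y. p (x \<bullet> y) \<partial>\<sigma>)\<bar> \<le> 8 * pi\<^sup>2 / 3 * e" .
    have "\<bar>integral {- 1..1} (\<lambda>t. u t * (1 - t\<^sup>2)) - integral {- 1..1} (\<lambda>t. p t * (1 - t\<^sup>2))\<bar>
      = norm (integral {- 1..1} (\<lambda>t. u t * (1 - t\<^sup>2) - p t * (1 - t\<^sup>2)))"
      using Henstock_Kurzweil_Integration.integral_diff[OF w[OF u] w[OF cp]] by simp
    also have "\<dots> \<le> integral {- 1..1 :: real} (\<lambda>t. e)"
    proof (rule integral_norm_bound_integral)
      fix t :: real assume t: "t \<in> {- 1..1}"
      then have "0 \<le> 1 - t\<^sup>2" "1 - t\<^sup>2 \<le> 1" by (auto simp: abs_square_le_1 abs_le_iff)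
      then have "\<bar>u t - p t\<bar> * (1 - t\<^sup>2) \<le> e * 1"
        using p(2)[OF t] by (intro mult_mono) auto
      then show "norm (u t * (1 - t\<^sup>2) - p t * (1 - t\<^sup>2)) \<le> e"
        using \<open>0 \<le> 1 - t\<^sup>2\<close> by (simp add: left_diff_distrib[symmetric] abs_mult)
    qed (use w[OF u] w[OF cp] in \<open>auto intro: integrable_diff\<close>)
    also have "\<dots> = 2 * e" by simp
    finally have "\<bar>?J u - ?J p\<bar> \<le> 2 * pi\<^sup>2 * (2 * e)"
      unfolding right_diff_distrib[symmetric] abs_mult by (intro mult_mono) auto
    moreover have "(\<integral>y. p (x \<bullet> y) \<partial>\<sigma>) = ?J p" unfolding an by (rule poly)
    moreover have "(8 * pi\<^sup>2 / 3 + 4 * pi\<^sup>2) * e = 8 * pi\<^sup>2 / 3 * e + 2 * pi\<^sup>2 * (2 * e)"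
      by (simp add: algebra_simps)
    ultimately show ?thesis using 1 by linarith
  qed
  note B = this
  have "\<bar>(\<integral>y. u (x \<bullet> y) \<partial>\<sigma>) - ?J u\<bar> \<le> 0"
  proof (rule field_le_epsilon)
    fix e :: real assume "e > 0"
    then have "e / (8 * pi\<^sup>2 / 3 + 4 * pi\<^sup>2) > 0" by (intro divide_pos_pos add_pos_pos) auto
    from B[OF this] show "\<bar>(\<integral>y. u (x \<bullet> y) \<partial>\<sigma>) - ?J u\<bar> \<le> 0 + e" by simp
  qed
  then show ?thesis by simp
qed

text \<open>Even powers of \<open>x \<bullet> y\<close> dominate the indicator of \<open>x\<close>,
  and their integrals tend to \<open>0\<close> by \<open>zonal_moment\<close>.\<close>

lemma emeasure_sphere_singleton:
  assumes "x \<in> S4"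
  shows "emeasure \<sigma> {x} = 0"
proof -
  have s: "{x} \<in> sets \<sigma>" using assms by (auto simp: sets_restrict_space)
  have "measure \<sigma> {x} \<le> 8 * pi\<^sup>2 / (real n + 1)" for n
  proof -
    have "measure \<sigma> {x} = (\<integral>y. indicat_real {x} y \<partial>\<sigma>)"
      using s assms by simp
    also have "\<dots> \<le> (\<integral>y. (x \<bullet> y) ^ (2 * n) \<partial>\<sigma>)"
    proof (rule integral_mono)
      show "indicat_real {x} y \<le> (x \<bullet> y) ^ (2 * n)" for y
        using assms by (auto simp: indicator_def power_mult dot_square_norm)
      show "integrable \<sigma> (indicat_real {x})" using s by (simp add: sphere.emeasure_eq_measure less_top[symmetric])
    qed (intro smooth_S4_integrable smooth_S4_power smooth_S4_inner)
    also have "\<dots> = 8 * pi\<^sup>2 / ((2 * real n + 1) * (2 * real n + 3))"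
      by (simp add: zonal_moment[OF assms])
    also have "\<dots> \<le> 8 * pi\<^sup>2 / (real n + 1)"
    proof (rule divide_left_mono)
      show "real n + 1 \<le> (2 * real n + 1) * (2 * real n + 3)" by (simp add: algebra_simps)
      have "0 < (2 * real n + 1) * (2 * real n + 3)" by (intro mult_pos_pos) auto
      then show "0 < (2 * real n + 1) * (2 * real n + 3) * (real n + 1)" by (intro mult_pos_pos) auto
    qed simp
    finally show ?thesis .
  qed
  moreover have "(\<lambda>n. 8 * pi\<^sup>2 / (real n + 1)) \<longlonglongrightarrow> 0"
    using LIMSEQ_Suc[OF lim_const_over_n[of "8 * pi\<^sup>2"]] by (simp add: add.commute)
  ultimately have "measure \<sigma> {x} \<le> 0"
    by (intro LIMSEQ_le_const) auto
  then show ?thesis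
    by (simp add: sphere.emeasure_eq_measure measure_le_0_iff)
qed

lemma AE_sphere_neq: "x \<in> S4 \<Longrightarrow> AE y in \<sigma>. y \<noteq> x"
  using emeasure_sphere_singleton by (intro AE_I[of _ _ "{x}"]) (auto simp: sets_restrict_space)

section \<open>The Riesz kernel as a zonal function and its total mass\<close>

lemma dist_S4_square:
  assumes "x \<in> S4" "y \<in> S4"
  shows "(dist x y)\<^sup>2 = 2 - 2 * (x \<bullet> y)"
  using assms by (simp add: dist_norm power2_norm_eq_inner inner_diff norm_eq_1 inner_commute)

lemma dist_S4_powr:
  assumes "x \<in> S4" "y \<in> S4"
  shows "dist x y powr (- \<alpha>) = (2 - 2 * (x \<bullet> y)) powr (- \<alpha> / 2)"
proof -
  have "(2 - 2 * (x \<bullet> y)) powr (- \<alpha> / 2) = ((dist x y) powr 2) powr (- \<alpha> / 2)"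
    by (simp add: dist_S4_square[OF assms])
  also have "\<dots> = dist x y powr (- \<alpha>)" by (simp only: powr_powr) simp
  finally show ?thesis by simp
qed

text \<open>The explicit value of the definite description \<open>mu0 \<alpha>\<close>;
  \<open>mu0_eq\<close> identifies the two for \<open>0 < \<alpha> < 4\<close>. Its simple pole at
  \<open>\<alpha> = 4\<close> governs the growth in \<open>riesz_mass_le\<close>.\<close>

definition riesz_mass :: "real \<Rightarrow> real" where
  "riesz_mass \<alpha> = 2 powr (6 - \<alpha>) * pi\<^sup>2 / ((6 - \<alpha>) * (4 - \<alpha>))"

lemma riesz_weight_integral:
  assumes "\<alpha> < 4"
  shows "((\<lambda>t. (2 - 2 * t) powr (- \<alpha> / 2) * (1 - t\<^sup>2)) has_integral riesz_mass \<alpha> / (2 * pi\<^sup>2)) {- 1..1 :: real}"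
proof -
  define b where "b = \<alpha> / 2"
  have b: "b < 2" using assms by (simp add: b_def)
  \<comment> \<open>The integrand is \<open>2 powr (- b) * (1 - t) powr (1 - b) * (1 + t)\<close>,
    and \<open>1 + t = 2 - (1 - t)\<close> splits it into two powers. For \<open>b > 1\<close> it
    blows up at \<open>t = 1\<close> while the primitive stays continuous, hence the interior form
    of the fundamental theorem.\<close>
  let ?G = "\<lambda>t :: real. - (2 powr (- b) * (2 * (1 - t) powr (2 - b) / (2 - b) - (1 - t) powr (3 - b) / (3 - b)))"
  have "((\<lambda>t. (2 - 2 * t) powr (- \<alpha> / 2) * (1 - t\<^sup>2)) has_integral ?G 1 - ?G (- 1)) {- 1..1}"
  proof (rule fundamental_theorem_of_calculus_interior)
    show "continuous_on {- 1..1} ?G"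
      using b by (auto intro!: continuous_intros continuous_on_powr')
    fix t :: real assume t: "t \<in> {- 1<..<1}"
    have "(?G has_real_derivative 2 powr (- b) * (2 * (1 - t) powr (1 - b) - (1 - t) powr (2 - b))) (at t)"
    proof -
      have D: "((\<lambda>t. (1 - t) powr c) has_real_derivative - (c * (1 - t) powr (c - 1))) (at t)" for c
        using t by (auto intro!: derivative_eq_intros)
      have "(?G has_real_derivative - (2 powr (- b) * (2 * - ((2 - b) * (1 - t) powr (2 - b - 1)) / (2 - b)
          - - ((3 - b) * (1 - t) powr (3 - b - 1)) / (3 - b)))) (at t)"
        by (intro DERIV_minus DERIV_cmult DERIV_diff DERIV_cdivide D)
      moreover have "- (2 powr (- b) * ((1 - t) powr (2 - b) - 2 * (1 - t) powr (1 - b)))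
          = 2 powr (- b) * (2 * (1 - t) powr (1 - b) - (1 - t) powr (2 - b))"
        by (simp add: algebra_simps)
      moreover have "2 - b - 1 = 1 - b" "3 - b - 1 = 2 - b" by simp_all
      moreover have "2 - b \<noteq> 0" "3 - b \<noteq> 0" using b by auto
      ultimately show ?thesis by simp
    qed
    also have "2 powr (- b) * (2 * (1 - t) powr (1 - b) - (1 - t) powr (2 - b)) = (2 - 2 * t) powr (- \<alpha> / 2) * (1 - t\<^sup>2)"
    proof -
      have "(2 - 2 * t) powr (- \<alpha> / 2) = (2 * (1 - t)) powr (- b)" by (simp add: b_def algebra_simps)
      also have "\<dots> = 2 powr (- b) * (1 - t) powr (- b)" using t by (subst powr_mult) auto
      finally have 1: "(2 - 2 * t) powr (- \<alpha> / 2) = 2 powr (- b) * (1 - t) powr (- b)" .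
      have 2: "(1 - t) powr (1 - b) = (1 - t) powr (- b) * (1 - t)"
        using t powr_add[of "1 - t" "- b" 1] by simp
      have 3: "(1 - t) powr (2 - b) = (1 - t) powr (- b) * (1 - t)\<^sup>2"
        using t powr_add[of "1 - t" "- b" 2] by simp
      show ?thesis unfolding 1 2 3 by (simp add: power2_eq_square algebra_simps)
    qed
    finally show "(?G has_vector_derivative (2 - 2 * t) powr (- \<alpha> / 2) * (1 - t\<^sup>2)) (at t)"
      by (simp add: has_real_derivative_iff_has_vector_derivative)
  qed simp
  also have "?G 1 - ?G (- 1) = riesz_mass \<alpha> / (2 * pi\<^sup>2)"
  proof -
    have 1: "2 powr (2 - b) = 2 powr (- b) * 4" using powr_add[of 2 "- b" 2] by simp
    have 2: "2 powr (3 - b) = 2 powr (- b) * 8" using powr_add[of 2 "- b" 3] by simp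
    have 3: "2 powr (6 - \<alpha>) = 2 powr (- b) * 2 powr (- b) * 64"
      using powr_add[of 2 "- b + - b" 6] powr_add[of 2 "- b" "- b"] by (simp add: b_def)
    have 4: "6 - \<alpha> = 2 * (3 - b)" "4 - \<alpha> = 2 * (2 - b)" by (simp_all add: b_def)
    show ?thesis
      unfolding riesz_mass_def 3 unfolding 4 using b
      by (simp add: 1 2 divide_simps) (simp add: algebra_simps)
  qed
  finally show ?thesis .
qed

text \<open>Adding \<open>d n > 0\<close> to the squared distance makes the kernel continuous, so
  \<open>zonal_integral\<close> applies, and the kernels increase with \<open>n\<close>. Since
  \<open>0 powr (- \<alpha>)\<close> is \<open>0\<close>, the limit fails where the points coincide;
  there the weight \<open>1 - t\<^sup>2\<close> vanishes on the interval, and on the sphere a single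
  point is null.\<close>

lemma has_bochner_integral_riesz_kernel:
  assumes x: "x \<in> S4" and a: "0 < \<alpha>" "\<alpha> < 4"
  shows "has_bochner_integral \<sigma> (\<lambda>y. dist x y powr (- \<alpha>)) (riesz_mass \<alpha>)"
proof -
  define d where "d n = 1 / real (Suc n)" for n
  have d0: "d n > 0" for n by (simp add: d_def)
  have dmono: "d n \<le> d m" if "m \<le> n" for m n
    using that by (simp add: d_def frac_le)
  have dlim: "d \<longlonglongrightarrow> 0" unfolding d_def by (rule lim_1_over_n[THEN LIMSEQ_Suc])
  define u where "u n t = (2 - 2 * t + d n) powr (- \<alpha> / 2)" for n t
  have u: "continuous_on {- 1..1} (u n)" for n
    unfolding u_def using d0[of n] by (auto intro!: continuous_intros simp: add_nonneg_eq_0_iff)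
  have u_le: "u n t \<le> (2 - 2 * t) powr (- \<alpha> / 2)" if "t < 1" for n t
    unfolding u_def using that d0[of n] a by (intro powr_mono2') auto
  have u_lim: "(\<lambda>n. u n t) \<longlonglongrightarrow> (2 - 2 * t) powr (- \<alpha> / 2)" if "t < 1" for t
  proof -
    have "(\<lambda>n. (2 - 2 * t + d n) powr (- \<alpha> / 2)) \<longlonglongrightarrow> (2 - 2 * t + 0) powr (- \<alpha> / 2)"
      using that by (intro tendsto_powr tendsto_add tendsto_const dlim) auto
    then show ?thesis by (simp add: u_def)
  qed
  have u_mono: "u m t \<le> u n t" if "m \<le> n" "t \<le> 1" for m n t
    unfolding u_def using that d0[of n] dmono[OF that(1)] a by (intro powr_mono2') auto
  have w: "0 \<le> 1 - t\<^sup>2" if "t \<in> {- 1..1}" for t :: real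
    using that by (simp add: abs_square_le_1 abs_le_iff)
  have "(\<lambda>n. integral {- 1..1} (\<lambda>t. u n t * (1 - t\<^sup>2)))
     \<longlonglongrightarrow> integral {- 1..1} (\<lambda>t. (2 - 2 * t) powr (- \<alpha> / 2) * (1 - t\<^sup>2))"
  proof (rule dominated_convergence(2))
    show "(\<lambda>t. u n t * (1 - t\<^sup>2)) integrable_on {- 1..1}" for n
      by (intro integrable_continuous_real continuous_intros u)
    show "(\<lambda>t. (2 - 2 * t) powr (- \<alpha> / 2) * (1 - t\<^sup>2)) integrable_on {- 1..1}"
      using riesz_weight_integral[OF a(2)] by (rule has_integral_integrable)
    fix t :: real assume t: "t \<in> {- 1..1}"
    show "norm (u n t * (1 - t\<^sup>2)) \<le> (2 - 2 * t) powr (- \<alpha> / 2) * (1 - t\<^sup>2)" for n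
    proof (cases "t = 1")
      case False
      then have "\<bar>u n t\<bar> \<le> (2 - 2 * t) powr (- \<alpha> / 2)" using u_le[of t n] t by (simp add: u_def)
      then show ?thesis using w[OF t] by (simp add: abs_mult mult_right_mono)
    qed simp
    show "(\<lambda>n. u n t * (1 - t\<^sup>2)) \<longlonglongrightarrow> (2 - 2 * t) powr (- \<alpha> / 2) * (1 - t\<^sup>2)"
    proof (cases "t = 1")
      case False
      then show ?thesis using u_lim[of t] t by (intro tendsto_mult tendsto_const) auto
    qed simp
  qed
  then have "(\<lambda>n. 2 * pi\<^sup>2 * integral {- 1..1} (\<lambda>t. u n t * (1 - t\<^sup>2))) \<longlonglongrightarrow> 2 * pi\<^sup>2 * (riesz_mass \<alpha> / (2 * pi\<^sup>2))"
    unfolding integral_unique[OF riesz_weight_integral[OF a(2)]] by (intro tendsto_mult tendsto_const)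
  then have lim: "(\<lambda>n. \<integral>y. u n (x \<bullet> y) \<partial>\<sigma>) \<longlonglongrightarrow> riesz_mass \<alpha>"
    unfolding zonal_integral[OF u x] by simp
  have lt: "x \<bullet> y < 1" if "y \<in> S4" "y \<noteq> x" for y
  proof -
    have "0 < (dist x y)\<^sup>2" using that(2) by simp
    then show ?thesis using dist_S4_square[OF x that(1)] by simp
  qed
  show ?thesis
  proof (rule has_bochner_integral_monotone_convergence[where f = "\<lambda>n y. u n (x \<bullet> y)"])
    show "integrable \<sigma> (\<lambda>y. u n (x \<bullet> y))" for n
      by (intro continuous_on_S4_integrable continuous_on_zonal u x)
    show "AE y in \<sigma>. mono (\<lambda>n. u n (x \<bullet> y))"
      using inner_S4_bounds[OF x] by (intro AE_I2) (auto intro!: monoI u_mono)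
    show "AE y in \<sigma>. (\<lambda>n. u n (x \<bullet> y)) \<longlonglongrightarrow> dist x y powr (- \<alpha>)"
      using AE_sphere_neq[OF x] AE_space
    proof eventually_elim
      case (elim y)
      then show ?case using u_lim[OF lt] dist_S4_powr[OF x] by simp
    qed
    show "(\<lambda>n. \<integral>y. u n (x \<bullet> y) \<partial>\<sigma>) \<longlonglongrightarrow> riesz_mass \<alpha>" by (rule lim)
    show "(\<lambda>y. dist x y powr (- \<alpha>)) \<in> borel_measurable \<sigma>" by measurable
  qed
qed

lemma mu0_eq:
  assumes "0 < \<alpha>" "\<alpha> < 4"
  shows "mu0 \<alpha> = riesz_mass \<alpha>"
proof -
  have "(\<integral>y. dist x y powr (- \<alpha>) \<partial>\<sigma>) = riesz_mass \<alpha>" if "x \<in> S4" for x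
    using has_bochner_integral_riesz_kernel[OF that assms] by (rule has_bochner_integral_integral_eq)
  moreover have "axis 1 1 \<in> S4" by (simp add: norm_axis_1)
  ultimately show ?thesis
    unfolding mu0_def by (intro the_equality) (blast, metis)
qed

lemma riesz_mass_pos: "\<alpha> < 4 \<Longrightarrow> riesz_mass \<alpha> > 0"
  by (simp add: riesz_mass_def)

subsection \<open>A pointwise bound by the Riesz potential of the Laplacian\<close>

text \<open>The factor of \<open>f\<close> on the right is \<open>lap w\<close>; using Green's
  formula a second time, for \<open>x \<bullet> y\<close>, avoids second derivatives of
  \<open>w\<close>. As \<open>1 - x \<bullet> y\<close> is half the squared distance,
  \<open>w\<close> regularises a kernel of the order of the Green function in dimension
  four.\<close>

lemma green_identity:
  assumes x: "x \<in> S4" and f: "smooth_S4 f" and c: "c > 1"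
  defines "w \<equiv> \<lambda>y. inverse (c - x \<bullet> y)"
  shows "(\<integral>y. lap f y * w y \<partial>\<sigma>) = (\<integral>y. f y * (2 * (1 - (x \<bullet> y)\<^sup>2) * w y ^ 3 - 4 * (x \<bullet> y) * (w y)\<^sup>2) \<partial>\<sigma>)"
proof -
  let ?T = "\<lambda>y. x \<bullet> y"
  let ?G = "\<lambda>y. \<Sum>k\<in>UNIV. tang_deriv k f y * tang_deriv k ?T y"
  have pos: "c - x \<bullet> y > 0" if "y \<in> S4" for y
    using inner_S4_bounds(1)[OF x that] c by simp
  have smc: "smooth_S4 (\<lambda>y. c - x \<bullet> y)"
    by (intro smooth_S4_diff smooth_S4_const smooth_S4_inner)
  have smw: "smooth_S4 w"
    unfolding w_def using pos by (intro smooth_S4_inverse smc) force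
  have smG: "smooth_S4 ?G"
    by (intro smooth_S4_sum smooth_S4_mult smooth_S4_tang_deriv smooth_S4_inner f)
  have smw2: "smooth_S4 (\<lambda>y. (w y)\<^sup>2)" by (intro smooth_S4_power smw)
  have smfw: "smooth_S4 (\<lambda>y. f y * (w y)\<^sup>2)" by (intro smooth_S4_mult f smw2)
  have Dw: "tang_deriv k w y = (w y)\<^sup>2 * tang_deriv k ?T y" if y: "y \<in> S4" for k y
  proof -
    have "tang_deriv k w y = - tang_deriv k (\<lambda>y. c - x \<bullet> y) y / (c - x \<bullet> y)\<^sup>2"
      unfolding w_def using pos[OF y] by (intro tang_deriv_inverse smc y) auto
    also have "tang_deriv k (\<lambda>y. c - x \<bullet> y) y = - tang_deriv k ?T y"
      using tang_deriv_diff[OF smooth_S4_const smooth_S4_inner S4_neq_0[OF y]] by simp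
    finally show ?thesis by (simp add: w_def field_simps power_inverse)
  qed
  have Dfw: "tang_deriv k (\<lambda>y. f y * (w y)\<^sup>2) y
     = (w y)\<^sup>2 * tang_deriv k f y + 2 * f y * w y ^ 3 * tang_deriv k ?T y" if y: "y \<in> S4" for k y
    unfolding tang_deriv_mult[OF f smw2 y] tang_deriv_power[OF smw y] Dw[OF y]
    by (simp add: algebra_simps power2_eq_square power3_eq_cube)
  have 1: "(\<integral>y. lap f y * w y \<partial>\<sigma>) = - (\<integral>y. (w y)\<^sup>2 * ?G y \<partial>\<sigma>)"
    unfolding integral_lap_mult[OF f smw]
  proof (intro arg_cong[of _ _ uminus] Bochner_Integration.integral_cong refl)
    fix y assume "y \<in> space \<sigma>"
    then have y: "y \<in> S4" by simp
    show "(\<Sum>k\<in>UNIV. tang_deriv k f y * tang_deriv k w y) = (w y)\<^sup>2 * ?G y"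
      unfolding Dw[OF y] sum_distrib_left by (intro sum.cong refl) (simp add: algebra_simps)
  qed
  have "(\<integral>y. lap ?T y * (f y * (w y)\<^sup>2) \<partial>\<sigma>)
     = - (\<integral>y. (w y)\<^sup>2 * ?G y + 2 * f y * w y ^ 3 * (1 - (x \<bullet> y)\<^sup>2) \<partial>\<sigma>)"
    unfolding integral_lap_mult[OF smooth_S4_inner smfw]
  proof (intro arg_cong[of _ _ uminus] Bochner_Integration.integral_cong refl)
    fix y assume "y \<in> space \<sigma>"
    then have y: "y \<in> S4" by simp
    have "(\<Sum>k\<in>UNIV. tang_deriv k ?T y * tang_deriv k (\<lambda>y. f y * (w y)\<^sup>2) y)
      = (w y)\<^sup>2 * ?G y + 2 * f y * w y ^ 3 * (\<Sum>k\<in>UNIV. tang_deriv k ?T y * tang_deriv k ?T y)"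
      unfolding Dfw[OF y] sum_distrib_left sum.distrib[symmetric]
      by (intro sum.cong refl) (simp add: algebra_simps)
    then show "(\<Sum>k\<in>UNIV. tang_deriv k ?T y * tang_deriv k (\<lambda>y. f y * (w y)\<^sup>2) y)
      = (w y)\<^sup>2 * ?G y + 2 * f y * w y ^ 3 * (1 - (x \<bullet> y)\<^sup>2)"
      unfolding sum_tang_deriv_inner_square[OF x y] .
  qed
  also have "\<dots> = - (\<integral>y. (w y)\<^sup>2 * ?G y \<partial>\<sigma>) - (\<integral>y. 2 * f y * w y ^ 3 * (1 - (x \<bullet> y)\<^sup>2) \<partial>\<sigma>)"
    by (subst Bochner_Integration.integral_add)
       (auto intro!: smooth_S4_integrable smooth_S4_mult smooth_S4_power smooth_S4_diff smG smw f
          smooth_S4_inner smooth_S4_const)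
  finally have "(\<integral>y. lap f y * w y \<partial>\<sigma>)
     = (\<integral>y. 2 * f y * w y ^ 3 * (1 - (x \<bullet> y)\<^sup>2) \<partial>\<sigma>) + (\<integral>y. lap ?T y * (f y * (w y)\<^sup>2) \<partial>\<sigma>)"
    unfolding 1 by simp
  also have "\<dots> = (\<integral>y. 2 * f y * w y ^ 3 * (1 - (x \<bullet> y)\<^sup>2) + lap ?T y * (f y * (w y)\<^sup>2) \<partial>\<sigma>)"
    by (intro Bochner_Integration.integral_add[symmetric] smooth_S4_integrable smooth_S4_mult
        smooth_S4_power smooth_S4_diff smw f smooth_S4_inner smooth_S4_const smooth_lap)
  also have "\<dots> = (\<integral>y. f y * (2 * (1 - (x \<bullet> y)\<^sup>2) * w y ^ 3 - 4 * (x \<bullet> y) * (w y)\<^sup>2) \<partial>\<sigma>)"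
    by (intro Bochner_Integration.integral_cong refl) (simp add: lap_inner algebra_simps)
  finally show ?thesis .
qed

lemma lap_const: "lap (\<lambda>x. c) x = 0"
proof -
  have "tang_deriv k (\<lambda>x. c) = (\<lambda>x. 0)" for k by (simp add: fun_eq_iff)
  then show ?thesis by (simp add: lap_def)
qed

lemma one_minus_inner: "x \<in> S4 \<Longrightarrow> y \<in> S4 \<Longrightarrow> 1 - x \<bullet> y = (dist x y)\<^sup>2 / 2"
  using dist_S4_square[of x y] by simp

lemma integrable_mult_riesz_kernel:
  assumes "x \<in> S4" "0 < \<beta>" "\<beta> < 4" "continuous_on S4 u"
  shows "integrable \<sigma> (\<lambda>y. u y * dist x y powr (- \<beta>))"
proof -
  obtain B where B: "B > 0" "\<And>y. y \<in> S4 \<Longrightarrow> \<bar>u y\<bar> \<le> B"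
    using continuous_on_S4_bounded[OF assms(4)] by blast
  have i: "integrable \<sigma> (\<lambda>y. dist x y powr (- \<beta>))"
    using has_bochner_integral_riesz_kernel[OF assms(1-3)] by (simp add: has_bochner_integral_iff)
  have "integrable \<sigma> (\<lambda>y. B * dist x y powr (- \<beta>))" using i by simp
  moreover have [measurable]: "u \<in> borel_measurable \<sigma>" by (rule continuous_on_S4_measurable[OF assms(4)])
  have "(\<lambda>y. u y * dist x y powr (- \<beta>)) \<in> borel_measurable \<sigma>" by measurable
  moreover have "AE y in \<sigma>. norm (u y * dist x y powr (- \<beta>)) \<le> norm (B * dist x y powr (- \<beta>))"
    using B by (intro AE_I2) (auto simp: abs_mult intro!: mult_right_mono)
  ultimately show ?thesis by (rule Bochner_Integration.integrable_bound)
qed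

text \<open>In \<open>green_pointwise_bound\<close> the weight of \<open>f\<close> is at most
  \<open>4 * w\<close>, against \<open>w\<close> for \<open>lap f\<close>; hence the
  \<open>4\<close>.\<close>

definition green_density :: "(real^5 \<Rightarrow> real) \<Rightarrow> real^5 \<Rightarrow> real" where
  "green_density f y = 4 * \<bar>f y\<bar> + \<bar>lap f y\<bar>"

lemma continuous_on_green_density:
  "smooth_S4 f \<Longrightarrow> continuous_on S4 (green_density f)"
  unfolding green_density_def[abs_def]
  by (intro continuous_intros smooth_S4_continuous_on smooth_lap)

text \<open>
  With \<open>s = 1 - x \<bullet> y\<close> and \<open>w = 1 / (s + \<epsilon>)\<close>, Green's identity reads
  \<open>\<integral> f * 4 \<epsilon> w\<^sup>3 = \<integral> f * (2 s\<^sup>2 + 4 s \<epsilon>) w\<^sup>3 - \<integral> lap f * w\<close>.  The weights \<open>4 \<epsilon> w\<^sup>3\<close> concentrate at \<open>x\<close>, and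
  their mass stays bounded below, as one sees by inserting \<open>f = 1\<close>.
\<close>

lemma green_pointwise_bound:
  assumes x: "x \<in> S4" and f: "smooth_S4 f"
  shows "\<bar>f x\<bar> \<le> 81 / (8 * pi\<^sup>2) * (\<integral>y. green_density f y * dist x y powr (- 2) \<partial>\<sigma>)"
proof -
  define A where "A = (\<integral>y. green_density f y * dist x y powr (- 2) \<partial>\<sigma>)"
  \<comment> \<open>Lower bound for the mass of the concentrating weight: \<open>s \<le> 2\<close>
    and \<open>\<epsilon> \<le> 1\<close> give \<open>w \<ge> 1 / 3\<close>, so
    \<open>\<tau> \<ge> 2 / 27 * s\<^sup>2\<close>, and the integral of \<open>s\<^sup>2\<close> is
    at least \<open>8 * pi\<^sup>2 / 3\<close>.\<close>
  define c where "c = 16 * pi\<^sup>2 / 81"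
  have c0: "c > 0" by (simp add: c_def)
  define s where "s y = 1 - x \<bullet> y" for y
  have s0: "0 \<le> s y" "s y \<le> 2" if "y \<in> S4" for y
    using inner_S4_bounds[OF x that] by (auto simp: s_def)
  have fc: "continuous_on S4 f" by (rule smooth_S4_continuous_on[OF f])
  obtain B where B: "B > 0" "\<And>y. y \<in> S4 \<Longrightarrow> \<bar>f y\<bar> \<le> B"
    using continuous_on_S4_bounded[OF fc] by blast
  have main: "\<bar>f x\<bar> \<le> 2 * A / c + 2 * e" if e: "e > 0" for e
  proof -
    have "\<exists>d>0. \<forall>y\<in>S4. dist y x < d \<longrightarrow> dist (f y) (f x) < e"
      using fc x e unfolding continuous_on_iff by blast
    then obtain d where d: "d > 0" "\<And>y. y \<in> S4 \<Longrightarrow> dist y x < d \<Longrightarrow> dist (f y) (f x) < e" by blast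
    \<comment> \<open>Away from \<open>x\<close>, where \<open>s \<ge> d\<^sup>2 / 2\<close>, the
      oscillation \<open>2 * B\<close> of \<open>f\<close> is covered by \<open>M * s ^ 3\<close>.
      The cube matches \<open>w ^ 3\<close> in \<open>\<rho>\<close>: since
      \<open>s * w \<le> 1\<close>, the far part adds only \<open>4 * M * \<epsilon>\<close> to the
      integrand.\<close>
    define M where "M = 2 * B / (d\<^sup>2 / 2) ^ 3"
    have M0: "M > 0" using B(1) d(1) by (simp add: M_def)
    have fxy: "\<bar>f y - f x\<bar> \<le> e + M * s y ^ 3" if y: "y \<in> S4" for y
    proof (cases "dist y x < d")
      case True
      then have "\<bar>f y - f x\<bar> \<le> e" using d(2)[OF y] by (simp add: dist_real_def)
      moreover have "0 \<le> M * s y ^ 3" using M0 s0[OF y] by simp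
      ultimately show ?thesis by linarith
    next
      case False
      then have "d\<^sup>2 \<le> (dist x y)\<^sup>2" using d(1) by (intro power_mono) (auto simp: dist_commute)
      then have "d\<^sup>2 / 2 \<le> s y" unfolding s_def one_minus_inner[OF x y] by simp
      then have "(d\<^sup>2 / 2) ^ 3 \<le> s y ^ 3" by (intro power_mono) auto
      then have "2 * B \<le> M * s y ^ 3" using d(1) B(1) by (simp add: M_def field_simps)
      moreover have "\<bar>f y - f x\<bar> \<le> 2 * B" using B(2)[OF y] B(2)[OF x] by linarith
      ultimately show ?thesis using e by linarith
    qed
    \<comment> \<open>Chosen so that the far part, integrated over the whole sphere, is at most
      \<open>e * c\<close>.\<close>
    define \<epsilon> where "\<epsilon> = min 1 (e * c / (4 * M * (8 * pi\<^sup>2 / 3)))"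
    have eps: "\<epsilon> > 0" "\<epsilon> \<le> 1" "4 * M * (8 * pi\<^sup>2 / 3) * \<epsilon> \<le> e * c"
    proof -
      have p: "4 * M * (8 * pi\<^sup>2 / 3) > 0" using M0 by simp
      then show "\<epsilon> > 0" "\<epsilon> \<le> 1" using e c0 by (auto simp: \<epsilon>_def)
      have "\<epsilon> \<le> e * c / (4 * M * (8 * pi\<^sup>2 / 3))" by (simp add: \<epsilon>_def)
      then show "4 * M * (8 * pi\<^sup>2 / 3) * \<epsilon> \<le> e * c" using p by (simp only: pos_le_divide_eq mult.commute)
    qed
    define w where "w y = inverse (s y + \<epsilon>)" for y
    have w_alt: "w = (\<lambda>y. inverse (1 + \<epsilon> - x \<bullet> y))" by (simp add: w_def s_def fun_eq_iff algebra_simps)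
    have se: "s y + \<epsilon> > 0" if "y \<in> S4" for y using s0[OF that] eps(1) by simp
    have w0: "w y > 0" if "y \<in> S4" for y using se[OF that] by (simp add: w_def)
    have sw: "(s y + \<epsilon>) * w y = 1" if "y \<in> S4" for y using se[OF that] by (simp add: w_def)
    have sms: "smooth_S4 s" unfolding s_def[abs_def] by (intro smooth_S4_diff smooth_S4_const smooth_S4_inner)
    have smw: "smooth_S4 w"
      unfolding w_def[abs_def] using se by (intro smooth_S4_inverse smooth_S4_add sms smooth_S4_const) force
    define \<rho> where "\<rho> y = 4 * \<epsilon> * w y ^ 3" for y
    have sm\<rho>: "smooth_S4 \<rho>" unfolding \<rho>_def[abs_def] by (intro smooth_S4_mult smooth_S4_const smooth_S4_power smw)
    have \<rho>0: "\<rho> y \<ge> 0" if "y \<in> S4" for y using w0[OF that] eps(1) by (simp add: \<rho>_def)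
    define \<tau> where "\<tau> y = (2 * (s y)\<^sup>2 + 4 * s y * \<epsilon>) * w y ^ 3" for y
    have sm\<tau>: "smooth_S4 \<tau>"
      unfolding \<tau>_def[abs_def] by (intro smooth_S4_mult smooth_S4_add smooth_S4_const smooth_S4_power smw sms)
    have key: "(\<integral>y. u y * \<rho> y \<partial>\<sigma>) = (\<integral>y. u y * \<tau> y \<partial>\<sigma>) - (\<integral>y. lap u y * w y \<partial>\<sigma>)" if u: "smooth_S4 u" for u
    proof -
      have "(\<integral>y. lap u y * w y \<partial>\<sigma>) = (\<integral>y. u y * (2 * (1 - (x \<bullet> y)\<^sup>2) * w y ^ 3 - 4 * (x \<bullet> y) * (w y)\<^sup>2) \<partial>\<sigma>)"
        unfolding w_alt using eps(1) by (intro green_identity x u) simp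
      also have "\<dots> = (\<integral>y. u y * \<tau> y - u y * \<rho> y \<partial>\<sigma>)"
      proof (intro Bochner_Integration.integral_cong refl)
        fix y assume "y \<in> space \<sigma>"
        then have y: "y \<in> S4" by simp
        have t: "x \<bullet> y = 1 - s y" by (simp add: s_def)
        have w2: "(w y)\<^sup>2 = (s y + \<epsilon>) * w y ^ 3"
          using sw[OF y] by (metis mult.assoc mult.left_neutral mult.commute power2_eq_square power3_eq_cube)
        have "2 * (1 - (1 - s y)\<^sup>2) * w y ^ 3 - 4 * (1 - s y) * ((s y + \<epsilon>) * w y ^ 3) = \<tau> y - \<rho> y"
          unfolding \<tau>_def \<rho>_def by algebra
        then show "u y * (2 * (1 - (x \<bullet> y)\<^sup>2) * w y ^ 3 - 4 * (x \<bullet> y) * (w y)\<^sup>2) = u y * \<tau> y - u y * \<rho> y"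
          unfolding t w2 by (simp add: right_diff_distrib)
      qed
      also have "\<dots> = (\<integral>y. u y * \<tau> y \<partial>\<sigma>) - (\<integral>y. u y * \<rho> y \<partial>\<sigma>)"
        by (intro Bochner_Integration.integral_diff smooth_S4_integrable smooth_S4_mult u sm\<tau> sm\<rho>)
      finally show ?thesis by simp
    qed
    define m where "m = (\<integral>y. \<rho> y \<partial>\<sigma>)"
    have "m = (\<integral>y. \<tau> y \<partial>\<sigma>)"
      using key[OF smooth_S4_const[of 1]] by (simp add: m_def lap_const)
    moreover have "(\<integral>y. 2 / 27 * (1 - 2 * (x \<bullet> y) + (x \<bullet> y)\<^sup>2) \<partial>\<sigma>) \<le> (\<integral>y. \<tau> y \<partial>\<sigma>)"
    proof (intro integral_mono smooth_S4_integrable smooth_S4_mult smooth_S4_const smooth_S4_add smooth_S4_diff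
        smooth_S4_power smooth_S4_inner sm\<tau>)
      fix y assume "y \<in> space \<sigma>"
      then have y: "y \<in> S4" by simp
      have "1 / 3 \<le> w y" unfolding w_def using s0[OF y] eps by (simp add: field_simps)
      then have "(1 / 3) ^ 3 \<le> w y ^ 3" by (intro power_mono) auto
      then have "(2 * (s y)\<^sup>2) * (1 / 3) ^ 3 \<le> (2 * (s y)\<^sup>2 + 4 * s y * \<epsilon>) * w y ^ 3"
        using s0[OF y] eps(1) by (intro mult_mono) auto
      moreover have "(s y)\<^sup>2 = 1 - 2 * (x \<bullet> y) + (x \<bullet> y)\<^sup>2" by (simp add: s_def power2_diff)
      ultimately show "2 / 27 * (1 - 2 * (x \<bullet> y) + (x \<bullet> y)\<^sup>2) \<le> \<tau> y"
        by (simp add: \<tau>_def power3_eq_cube)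
    qed
    moreover have "(\<integral>y. 2 / 27 * (1 - 2 * (x \<bullet> y) + (x \<bullet> y)\<^sup>2) \<partial>\<sigma>) \<ge> c"
    proof -
      have i: "integrable \<sigma> (\<lambda>y. x \<bullet> y)" "integrable \<sigma> (\<lambda>y. (x \<bullet> y)\<^sup>2)"
        by (intro smooth_S4_integrable smooth_S4_power smooth_S4_inner)+
      have "(\<integral>y. 1 - 2 * (x \<bullet> y) + (x \<bullet> y)\<^sup>2 \<partial>\<sigma>) = 8 * pi\<^sup>2 / 3 - 2 * (\<integral>y. x \<bullet> y \<partial>\<sigma>) + (\<integral>y. (x \<bullet> y)\<^sup>2 \<partial>\<sigma>)"
        using i measure_S4 by simp
      also have "\<dots> = 8 * pi\<^sup>2 / 3 + (\<integral>y. (x \<bullet> y)\<^sup>2 \<partial>\<sigma>)"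
        using zonal_moment[OF x, of 1] by simp
      also have "\<dots> \<ge> 8 * pi\<^sup>2 / 3" by simp
      finally show ?thesis
        unfolding Bochner_Integration.integral_mult_right_zero c_def by linarith
    qed
    ultimately have mc: "m \<ge> c" by simp
    define k where "k y = dist x y powr (- 2)" for y
    have wk: "w y \<le> 2 * k y" if y: "y \<in> S4" "y \<noteq> x" for y
    proof -
      have sy: "s y = (dist x y)\<^sup>2 / 2" unfolding s_def by (rule one_minus_inner[OF x y(1)])
      have "(dist x y)\<^sup>2 > 0" using y(2) by simp
      then have "s y > 0" unfolding sy by (rule half_gt_zero)
      have "k y = inverse ((dist x y)\<^sup>2)" by (simp add: k_def powr_minus)
      then have "2 * k y = inverse (s y)" unfolding sy by (simp add: inverse_eq_divide)
      moreover have "w y \<le> inverse (s y)"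
        unfolding w_def using \<open>s y > 0\<close> eps(1) by (intro le_imp_inverse_le) auto
      ultimately show ?thesis by simp
    qed
    have ik: "integrable \<sigma> (\<lambda>y. green_density f y * k y)"
      unfolding k_def by (intro integrable_mult_riesz_kernel x continuous_on_green_density f) auto
    have "\<bar>\<integral>y. f y * \<rho> y \<partial>\<sigma>\<bar> = \<bar>\<integral>y. f y * \<tau> y - lap f y * w y \<partial>\<sigma>\<bar>"
      unfolding key[OF f]
      by (subst Bochner_Integration.integral_diff) (auto intro!: smooth_S4_integrable smooth_S4_mult f sm\<tau> smw smooth_lap)
    also have "\<dots> \<le> (\<integral>y. \<bar>f y * \<tau> y - lap f y * w y\<bar> \<partial>\<sigma>)"
      by (rule integral_abs_bound)
    also have "\<dots> \<le> (\<integral>y. 2 * (green_density f y * k y) \<partial>\<sigma>)"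
    proof (intro integral_mono_AE)
      show "integrable \<sigma> (\<lambda>y. \<bar>f y * \<tau> y - lap f y * w y\<bar>)"
        by (intro integrable_abs smooth_S4_integrable smooth_S4_diff smooth_S4_mult f sm\<tau> smw smooth_lap)
      show "integrable \<sigma> (\<lambda>y. 2 * (green_density f y * k y))" using ik by simp
      show "AE y in \<sigma>. \<bar>f y * \<tau> y - lap f y * w y\<bar> \<le> 2 * (green_density f y * k y)"
        using AE_sphere_neq[OF x] AE_space
      proof eventually_elim
        case (elim y)
        then have y: "y \<in> S4" by simp
        have "\<tau> y \<le> 4 * (s y + \<epsilon>)\<^sup>2 * w y ^ 3"
          unfolding \<tau>_def using s0[OF y] eps(1) w0[OF y]
          by (intro mult_right_mono) (auto simp: power2_eq_square algebra_simps)
        also have "\<dots> = 4 * w y * ((s y + \<epsilon>) * w y)\<^sup>2" by (simp add: power2_eq_square power3_eq_cube)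
        finally have "\<tau> y \<le> 4 * w y" unfolding sw[OF y] by simp
        moreover have "\<tau> y \<ge> 0" unfolding \<tau>_def using s0[OF y] eps(1) w0[OF y] by simp
        ultimately have "\<bar>f y * \<tau> y - lap f y * w y\<bar> \<le> \<bar>f y\<bar> * (4 * w y) + \<bar>lap f y\<bar> * w y"
          using w0[OF y] by (intro order_trans[OF abs_triangle_ineq4] add_mono) (auto simp: abs_mult intro!: mult_left_mono)
        also have "\<dots> = green_density f y * w y" by (simp add: green_density_def algebra_simps)
        also have "\<dots> \<le> green_density f y * (2 * k y)"
          using wk[OF y elim(1)] by (intro mult_left_mono) (auto simp: green_density_def)
        finally show ?case by simp
      qed
    qed
    also have "\<dots> = 2 * A" by (simp add: A_def k_def)
    finally have up: "\<bar>\<integral>y. f y * \<rho> y \<partial>\<sigma>\<bar> \<le> 2 * A" .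
    have i\<rho>: "integrable \<sigma> \<rho>" "integrable \<sigma> (\<lambda>y. f y * \<rho> y)"
      by (intro smooth_S4_integrable smooth_S4_mult sm\<rho> f)+
    have "\<bar>(\<integral>y. f y * \<rho> y \<partial>\<sigma>) - f x * m\<bar> = \<bar>\<integral>y. (f y - f x) * \<rho> y \<partial>\<sigma>\<bar>"
      using i\<rho> by (simp add: m_def left_diff_distrib)
    also have "\<dots> \<le> (\<integral>y. \<bar>(f y - f x) * \<rho> y\<bar> \<partial>\<sigma>)" by (rule integral_abs_bound)
    also have "\<dots> \<le> (\<integral>y. e * \<rho> y + 4 * M * \<epsilon> \<partial>\<sigma>)"
    proof (rule integral_mono)
      show "integrable \<sigma> (\<lambda>y. \<bar>(f y - f x) * \<rho> y\<bar>)"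
        by (intro integrable_abs smooth_S4_integrable smooth_S4_diff smooth_S4_mult f sm\<rho> smooth_S4_const)
      show "integrable \<sigma> (\<lambda>y. e * \<rho> y + 4 * M * \<epsilon>)" using i\<rho>(1) by simp
      fix y assume "y \<in> space \<sigma>"
      then have y: "y \<in> S4" by simp
      have "\<bar>(f y - f x) * \<rho> y\<bar> \<le> (e + M * s y ^ 3) * \<rho> y"
        using fxy[OF y] \<rho>0[OF y] by (simp add: abs_mult mult_right_mono)
      also have "\<dots> = e * \<rho> y + 4 * M * \<epsilon> * (s y * w y) ^ 3"
        by (simp add: \<rho>_def algebra_simps power_mult_distrib)
      also have "(s y * w y) ^ 3 \<le> 1"
      proof (rule power_le_one)
        show "0 \<le> s y * w y" using s0[OF y] w0[OF y] by simp
        have "0 \<le> \<epsilon> * w y" using w0[OF y] eps(1) by simp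
        then show "s y * w y \<le> 1" using sw[OF y] by (simp add: distrib_right)
      qed
      then have "4 * M * \<epsilon> * (s y * w y) ^ 3 \<le> 4 * M * \<epsilon> * 1"
        using M0 eps(1) by (intro mult_left_mono) auto
      finally show "\<bar>(f y - f x) * \<rho> y\<bar> \<le> e * \<rho> y + 4 * M * \<epsilon>" by simp
    qed
    also have "\<dots> = e * m + 4 * M * (8 * pi\<^sup>2 / 3) * \<epsilon>"
      using i\<rho>(1) measure_S4 by (simp add: m_def)
    finally have "\<bar>(\<integral>y. f y * \<rho> y \<partial>\<sigma>) - f x * m\<bar> \<le> e * m + e * c" using eps(3) by linarith
    \<comment> \<open>All errors are turned into multiples of \<open>m\<close>, which can then be
      divided out although only its lower bound is known.\<close>
    moreover have "e * c \<le> e * m" using mc e by simp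
    ultimately have "\<bar>f x * m\<bar> \<le> 2 * A + 2 * e * m" using up by linarith
    moreover have "2 * A \<le> 2 * A / c * m"
    proof -
      have "0 \<le> 2 * A" using up by linarith
      then have "2 * A / c * c \<le> 2 * A / c * m" using mc c0 by (intro mult_left_mono) auto
      then show ?thesis using c0 by simp
    qed
    ultimately have "\<bar>f x\<bar> * m \<le> (2 * A / c + 2 * e) * m"
      using mc c0 by (simp add: abs_mult distrib_right)
    then show ?thesis using mc c0 by simp
  qed
  have "\<bar>f x\<bar> \<le> 2 * A / c"
  proof (rule field_le_epsilon)
    fix e :: real assume "e > 0"
    then show "\<bar>f x\<bar> \<le> 2 * A / c + e" using main[of "e / 2"] by simp
  qed
  then show ?thesis by (simp add: A_def c_def)
qed

subsection \<open>Exponential integrability\<close>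

lemma measurable_dist_sphere_pair [measurable]:
  "(\<lambda>z. dist (fst z) (snd z)) \<in> borel_measurable (\<sigma> \<Otimes>\<^sub>M \<sigma>)"
proof -
  have "(\<lambda>z. fst z) \<in> borel_measurable (\<sigma> \<Otimes>\<^sub>M \<sigma>)" "(\<lambda>z. snd z) \<in> borel_measurable (\<sigma> \<Otimes>\<^sub>M \<sigma>)"
    using measurable_compose[OF measurable_fst measurable_sphere_ident]
      measurable_compose[OF measurable_snd measurable_sphere_ident] by auto
  then show ?thesis by measurable
qed

text \<open>The tangent to \<open>t ^ m\<close> at the weighted mean \<open>a = Q / P\<close> stays
  below the curve, by Bernoulli's inequality for \<open>t / a\<close>; integrate it against
  \<open>p\<close>. The degenerate case is \<open>Q = 0\<close>, which \<open>P = 0\<close>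
  forces.\<close>

lemma jensen_power:
  fixes p w :: "'a \<Rightarrow> real"
  assumes p: "integrable M p" and pw: "integrable M (\<lambda>x. p x * w x)" and pwm: "integrable M (\<lambda>x. p x * w x ^ m)"
    and nn: "\<And>x. x \<in> space M \<Longrightarrow> p x \<ge> 0" "\<And>x. x \<in> space M \<Longrightarrow> w x \<ge> 0" and m: "m \<ge> 1"
  shows "(\<integral>x. p x * w x \<partial>M) ^ m \<le> (\<integral>x. p x \<partial>M) ^ (m - 1) * (\<integral>x. p x * w x ^ m \<partial>M)"
proof -
  define P where "P = (\<integral>x. p x \<partial>M)"
  define Q where "Q = (\<integral>x. p x * w x \<partial>M)"
  have P0: "P \<ge> 0" unfolding P_def using nn by (intro integral_nonneg_AE) auto
  have R0: "(\<integral>x. p x * w x ^ m \<partial>M) \<ge> 0" using nn by (intro integral_nonneg_AE) auto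
  have Q0: "Q \<ge> 0" unfolding Q_def using nn by (intro integral_nonneg_AE) auto
  show ?thesis
  proof (cases "Q = 0")
    case True
    then show ?thesis using m P0 R0 by (cases m) (auto simp: Q_def[symmetric] P_def[symmetric])
  next
    case False
    have "P \<noteq> 0"
    proof
      assume "P = 0"
      then have "AE x in M. p x = 0"
        using integral_nonneg_eq_0_iff_AE[OF p] nn unfolding P_def by auto
      then have "Q = (\<integral>x. 0 \<partial>M)"
        unfolding Q_def using pw by (intro integral_cong_AE) auto
      with False show False by simp
    qed
    with P0 have Ppos: "P > 0" by simp
    define a where "a = Q / P"
    have a: "a > 0" using Q0 False Ppos by (simp add: a_def)
    have tangent: "a ^ m + real m * a ^ (m - 1) * (t - a) \<le> t ^ m" if "t \<ge> 0" for t
    proof -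
      have "1 + real m * (t / a - 1) \<le> (1 + (t / a - 1)) ^ m"
        using that a by (intro Bernoulli_inequality) simp
      then have "a ^ m * (1 + real m * (t / a - 1)) \<le> a ^ m * (t / a) ^ m"
        using a by (intro mult_left_mono) auto
      moreover have "a ^ m * (t / a) ^ m = t ^ m" using a by (simp add: power_divide)
      moreover have "a ^ m * (1 + real m * (t / a - 1)) = a ^ m + real m * a ^ (m - 1) * (t - a)"
        using a m by (cases m) (auto simp: field_simps)
      ultimately show ?thesis by simp
    qed
    have "(\<integral>x. (a ^ m - real m * a ^ (m - 1) * a) * p x + real m * a ^ (m - 1) * (p x * w x) \<partial>M)
        \<le> (\<integral>x. p x * w x ^ m \<partial>M)"
    proof (rule integral_mono)
      fix x assume x: "x \<in> space M"
      show "(a ^ m - real m * a ^ (m - 1) * a) * p x + real m * a ^ (m - 1) * (p x * w x) \<le> p x * w x ^ m"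
        using mult_left_mono[OF tangent[OF nn(2)[OF x]] nn(1)[OF x]] by (simp add: algebra_simps)
    qed (use p pw pwm in auto)
    moreover have "(\<integral>x. (a ^ m - real m * a ^ (m - 1) * a) * p x + real m * a ^ (m - 1) * (p x * w x) \<partial>M)
        = (a ^ m - real m * a ^ (m - 1) * a) * P + real m * a ^ (m - 1) * Q"
      using p pw by (simp add: P_def Q_def)
    moreover have "Q = a * P" using Ppos by (simp add: a_def)
    ultimately have "a ^ m * P \<le> (\<integral>x. p x * w x ^ m \<partial>M)" by (simp add: algebra_simps)
    then have "P ^ (m - 1) * (a ^ m * P) \<le> P ^ (m - 1) * (\<integral>x. p x * w x ^ m \<partial>M)"
      using P0 by (intro mult_left_mono) auto
    moreover have "P ^ (m - 1) * (a ^ m * P) = Q ^ m"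
      using m unfolding \<open>Q = a * P\<close> by (cases m) (auto simp: power_mult_distrib)
    ultimately show ?thesis by (simp add: P_def Q_def)
  qed
qed

text \<open>At distance \<open>2 / m\<close> from its simple pole the mass is of order
  \<open>m\<close>. Raised to the power \<open>m\<close> this linear loss becomes
  \<open>m ^ m\<close>, which the factorial in the exponential series can absorb.\<close>

lemma riesz_mass_le:
  assumes "m \<ge> 1"
  shows "riesz_mass (4 - 2 / real m) \<le> 4 * pi\<^sup>2 * real m"
proof -
  define a where "a = 2 / real m"
  have a: "0 < a" "a \<le> 2" using assms by (auto simp: a_def field_simps)
  have "2 powr (2 + a) \<le> 2 powr (4 :: real)" using a by (intro powr_mono) auto
  then have p: "2 powr (2 + a) \<le> 16" by simp
  have "riesz_mass (4 - a) = 2 powr (2 + a) * pi\<^sup>2 / ((2 + a) * a)" by (simp add: riesz_mass_def)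
  also have "\<dots> \<le> 16 * pi\<^sup>2 / (2 * a)"
    using a p by (intro frac_le mult_right_mono) auto
  also have "\<dots> = 4 * pi\<^sup>2 * real m" using assms by (simp add: a_def field_simps)
  finally show ?thesis by (simp add: a_def)
qed

text \<open>
  Cauchy--Schwarz with the splitting \<open>d powr (- 2) = d powr (- 1 / m) * d powr (1 / m - 2)\<close> of the
  kernel costs a factor of order \<open>m\<close> only; Jensen's inequality then restores the kernel \<open>d powr (- 2)\<close>.
\<close>

lemma power_pointwise_bound:
  assumes x: "x \<in> S4" and f: "smooth_S4 f" and m: "m \<ge> 1"
  shows "f x ^ (2 * m) \<le> ((81 / (8 * pi\<^sup>2))\<^sup>2 * (4 * pi\<^sup>2 * real m)) ^ m
      * ((\<integral>y. (green_density f y)\<^sup>2 \<partial>\<sigma>) ^ (m - 1) * (\<integral>y. (green_density f y)\<^sup>2 * dist x y powr (- 2) \<partial>\<sigma>))"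
proof -
  let ?h = "green_density f"
  let ?K = "81 / (8 * pi\<^sup>2)"
  have hc: "continuous_on S4 ?h" by (rule continuous_on_green_density[OF f])
  have hc2: "continuous_on S4 (\<lambda>y. (?h y)\<^sup>2)" by (intro continuous_intros hc)
  define a where "a = 1 / real m"
  have a: "0 < a" "a \<le> 1" using m by (auto simp: a_def)
  have wm: "(dist x y powr (- (2 * a))) ^ m = dist x y powr (- 2)" for y
    using m by (cases "dist x y = 0") (simp_all add: powr_power a_def)
  have sq: "(dist x y powr b)\<^sup>2 = dist x y powr (2 * b)" for y b
    by (cases "dist x y = 0") (simp_all add: powr_power)
  let ?w = "\<lambda>y. dist x y powr (- (2 * a))"
  have [measurable]: "?h \<in> borel_measurable \<sigma>" by (rule continuous_on_S4_measurable[OF hc])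
  have [measurable]: "(\<lambda>y. dist x y powr b) \<in> borel_measurable \<sigma>" for b by measurable
  have i1: "integrable \<sigma> (\<lambda>y. (?h y)\<^sup>2 * ?w y)"
    using a by (intro integrable_mult_riesz_kernel x hc2) auto
  have i2: "has_bochner_integral \<sigma> (\<lambda>y. dist x y powr (- (4 - 2 * a))) (riesz_mass (4 - 2 * a))"
    using a by (intro has_bochner_integral_riesz_kernel x) auto
  have split: "?h y * dist x y powr (- 2) = (?h y * dist x y powr (- a)) * dist x y powr (- (2 - a))" for y
    by (simp add: powr_add[symmetric] mult.assoc)
  have e1: "(?h y * dist x y powr (- a))\<^sup>2 = (?h y)\<^sup>2 * ?w y" for y
    by (simp add: power_mult_distrib sq)
  have e2: "(dist x y powr (- (2 - a)))\<^sup>2 = dist x y powr (- (4 - 2 * a))" for y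
    unfolding sq by (simp add: algebra_simps)
  have "\<bar>\<integral>y. ?h y * dist x y powr (- 2) \<partial>\<sigma>\<bar>
     \<le> sqrt (\<integral>y. (?h y * dist x y powr (- a))\<^sup>2 \<partial>\<sigma>) * sqrt (\<integral>y. (dist x y powr (- (2 - a)))\<^sup>2 \<partial>\<sigma>)"
    unfolding split using i1 i2
    by (intro integral_Cauchy_Schwarz) (auto simp only: e1 e2 has_bochner_integral_iff, measurable)
  then have "\<bar>\<integral>y. ?h y * dist x y powr (- 2) \<partial>\<sigma>\<bar>\<^sup>2
     \<le> (sqrt (\<integral>y. (?h y)\<^sup>2 * ?w y \<partial>\<sigma>) * sqrt (riesz_mass (4 - 2 * a)))\<^sup>2"
    unfolding e1 e2 has_bochner_integral_integral_eq[OF i2] by (rule power_mono) simp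
  then have cs: "(\<integral>y. ?h y * dist x y powr (- 2) \<partial>\<sigma>)\<^sup>2
     \<le> (\<integral>y. (?h y)\<^sup>2 * ?w y \<partial>\<sigma>) * riesz_mass (4 - 2 * a)"
    using a riesz_mass_pos[of "4 - 2 * a"] by (simp add: power_mult_distrib)
  have W0: "(\<integral>y. (?h y)\<^sup>2 * ?w y \<partial>\<sigma>) \<ge> 0" by (intro integral_nonneg_AE) auto
  have "\<bar>f x\<bar>\<^sup>2 \<le> (?K * (\<integral>y. ?h y * dist x y powr (- 2) \<partial>\<sigma>))\<^sup>2"
    by (intro power_mono green_pointwise_bound x f) auto
  also have "\<dots> = ?K\<^sup>2 * (\<integral>y. ?h y * dist x y powr (- 2) \<partial>\<sigma>)\<^sup>2" by (rule power_mult_distrib)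
  also have "\<dots> \<le> ?K\<^sup>2 * ((\<integral>y. (?h y)\<^sup>2 * ?w y \<partial>\<sigma>) * riesz_mass (4 - 2 * a))"
    by (intro mult_left_mono cs) auto
  also have "\<dots> \<le> ?K\<^sup>2 * ((\<integral>y. (?h y)\<^sup>2 * ?w y \<partial>\<sigma>) * (4 * pi\<^sup>2 * real m))"
    using riesz_mass_le[OF m] W0 by (intro mult_left_mono) (auto simp: a_def)
  finally have "(\<bar>f x\<bar>\<^sup>2) ^ m \<le> ((?K\<^sup>2 * (4 * pi\<^sup>2 * real m)) * (\<integral>y. (?h y)\<^sup>2 * ?w y \<partial>\<sigma>)) ^ m"
    by (intro power_mono) (auto simp: algebra_simps)
  also have "\<dots> = (?K\<^sup>2 * (4 * pi\<^sup>2 * real m)) ^ m * (\<integral>y. (?h y)\<^sup>2 * ?w y \<partial>\<sigma>) ^ m"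
    by (rule power_mult_distrib)
  also have "(\<integral>y. (?h y)\<^sup>2 * ?w y \<partial>\<sigma>) ^ m \<le> (\<integral>y. (?h y)\<^sup>2 \<partial>\<sigma>) ^ (m - 1) * (\<integral>y. (?h y)\<^sup>2 * ?w y ^ m \<partial>\<sigma>)"
  proof (rule jensen_power)
    show "integrable \<sigma> (\<lambda>y. (?h y)\<^sup>2)" by (rule continuous_on_S4_integrable[OF hc2])
    show "integrable \<sigma> (\<lambda>y. (?h y)\<^sup>2 * ?w y ^ m)"
      unfolding wm by (intro integrable_mult_riesz_kernel x hc2) auto
  qed (use i1 m in auto)
  also have "(\<integral>y. (?h y)\<^sup>2 * ?w y ^ m \<partial>\<sigma>) = (\<integral>y. (?h y)\<^sup>2 * dist x y powr (- 2) \<partial>\<sigma>)"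
    unfolding wm ..
  finally show ?thesis by (simp add: power_mult mult_left_mono)
qed

text \<open>Integrate \<open>power_pointwise_bound\<close> in \<open>x\<close> and exchange the
  integrals by Tonelli: the kernel integrated in \<open>x\<close> is \<open>riesz_mass 2\<close> for
  every \<open>y\<close>.\<close>

lemma integral_power_bound:
  assumes f: "smooth_S4 f" and m: "m \<ge> 1"
  shows "(\<integral>x. f x ^ (2 * m) \<partial>\<sigma>)
    \<le> ((81 / (8 * pi\<^sup>2))\<^sup>2 * (4 * pi\<^sup>2 * real m) * (\<integral>y. (green_density f y)\<^sup>2 \<partial>\<sigma>)) ^ m * (8 * pi\<^sup>2 / 3)"
proof -
  let ?h = "green_density f"
  define C where "C = ((81 / (8 * pi\<^sup>2))\<^sup>2 * (4 * pi\<^sup>2 * real m)) ^ m * (\<integral>y. (?h y)\<^sup>2 \<partial>\<sigma>) ^ (m - 1)"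
  have H0: "(\<integral>y. (?h y)\<^sup>2 \<partial>\<sigma>) \<ge> 0" by simp
  have C0: "C \<ge> 0" unfolding C_def using H0 by (intro mult_nonneg_nonneg zero_le_power) auto
  have hc2: "continuous_on S4 (\<lambda>y. (?h y)\<^sup>2)"
    by (intro continuous_intros continuous_on_green_density f)
  have [measurable]: "(\<lambda>y. (?h y)\<^sup>2) \<in> borel_measurable \<sigma>" by (rule continuous_on_S4_measurable[OF hc2])
  have ik: "integrable \<sigma> (\<lambda>y. (?h y)\<^sup>2 * dist x y powr (- 2))" if "x \<in> S4" for x
    by (intro integrable_mult_riesz_kernel that hc2) auto
  have "ennreal (\<integral>x. f x ^ (2 * m) \<partial>\<sigma>) = (\<integral>\<^sup>+x. ennreal (f x ^ (2 * m)) \<partial>\<sigma>)"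
    by (intro nn_integral_eq_integral[symmetric] smooth_S4_integrable smooth_S4_power f) (simp add: power_mult)
  also have "\<dots> \<le> (\<integral>\<^sup>+x. ennreal C * (\<integral>\<^sup>+y. ennreal ((?h y)\<^sup>2 * dist x y powr (- 2)) \<partial>\<sigma>) \<partial>\<sigma>)"
  proof (rule nn_integral_mono)
    fix x assume "x \<in> space \<sigma>"
    then have x: "x \<in> S4" by simp
    have "ennreal (f x ^ (2 * m)) \<le> ennreal (C * (\<integral>y. (?h y)\<^sup>2 * dist x y powr (- 2) \<partial>\<sigma>))"
      using power_pointwise_bound[OF x f m] by (intro ennreal_leI) (simp add: C_def mult.assoc)
    also have "\<dots> = ennreal C * ennreal (\<integral>y. (?h y)\<^sup>2 * dist x y powr (- 2) \<partial>\<sigma>)"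
      by (intro ennreal_mult C0 integral_nonneg_AE) auto
    also have "ennreal (\<integral>y. (?h y)\<^sup>2 * dist x y powr (- 2) \<partial>\<sigma>) = (\<integral>\<^sup>+y. ennreal ((?h y)\<^sup>2 * dist x y powr (- 2)) \<partial>\<sigma>)"
      by (intro nn_integral_eq_integral[symmetric] ik x) auto
    finally show "ennreal (f x ^ (2 * m)) \<le> ennreal C * (\<integral>\<^sup>+y. ennreal ((?h y)\<^sup>2 * dist x y powr (- 2)) \<partial>\<sigma>)" .
  qed
  also have "\<dots> = ennreal C * (\<integral>\<^sup>+x. (\<integral>\<^sup>+y. ennreal ((?h y)\<^sup>2 * dist x y powr (- 2)) \<partial>\<sigma>) \<partial>\<sigma>)"
    by (intro nn_integral_cmult sphere.borel_measurable_nn_integral) measurable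
  also have "(\<integral>\<^sup>+x. (\<integral>\<^sup>+y. ennreal ((?h y)\<^sup>2 * dist x y powr (- 2)) \<partial>\<sigma>) \<partial>\<sigma>)
     = (\<integral>\<^sup>+y. (\<integral>\<^sup>+x. ennreal ((?h y)\<^sup>2 * dist x y powr (- 2)) \<partial>\<sigma>) \<partial>\<sigma>)"
    by (intro sphere_pair.Fubini'[symmetric]) measurable
  also have "\<dots> = (\<integral>\<^sup>+y. ennreal ((?h y)\<^sup>2 * riesz_mass 2) \<partial>\<sigma>)"
  proof (intro nn_integral_cong)
    fix y assume "y \<in> space \<sigma>"
    then have y: "y \<in> S4" by simp
    have k: "has_bochner_integral \<sigma> (\<lambda>x. dist y x powr (- 2)) (riesz_mass 2)"
      by (intro has_bochner_integral_riesz_kernel y) auto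
    have "(\<integral>\<^sup>+x. ennreal ((?h y)\<^sup>2 * dist x y powr (- 2)) \<partial>\<sigma>) = ennreal (\<integral>x. (?h y)\<^sup>2 * dist y x powr (- 2) \<partial>\<sigma>)"
      using k unfolding dist_commute[of _ y] has_bochner_integral_iff
      by (intro nn_integral_eq_integral) auto
    then show "(\<integral>\<^sup>+x. ennreal ((?h y)\<^sup>2 * dist x y powr (- 2)) \<partial>\<sigma>) = ennreal ((?h y)\<^sup>2 * riesz_mass 2)"
      using k by (simp add: has_bochner_integral_iff)
  qed
  also have "\<dots> = ennreal (\<integral>y. (?h y)\<^sup>2 * riesz_mass 2 \<partial>\<sigma>)"
    using continuous_on_S4_integrable[OF hc2] riesz_mass_pos[of 2]
    by (intro nn_integral_eq_integral) auto
  also have "\<dots> = ennreal ((\<integral>y. (?h y)\<^sup>2 \<partial>\<sigma>) * riesz_mass 2)" by simp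
  also have "ennreal C * \<dots> = ennreal (C * ((\<integral>y. (?h y)\<^sup>2 \<partial>\<sigma>) * riesz_mass 2))"
    using C0 H0 riesz_mass_pos[of 2] by (intro ennreal_mult[symmetric]) auto
  finally have "(\<integral>x. f x ^ (2 * m) \<partial>\<sigma>) \<le> C * ((\<integral>y. (?h y)\<^sup>2 \<partial>\<sigma>) * riesz_mass 2)"
    using C0 H0 riesz_mass_pos[of 2] by (subst (asm) ennreal_le_iff) auto
  also have "\<dots> = ((81 / (8 * pi\<^sup>2))\<^sup>2 * (4 * pi\<^sup>2 * real m) * (\<integral>y. (?h y)\<^sup>2 \<partial>\<sigma>)) ^ m * riesz_mass 2"
  proof -
    obtain n where n: "m = Suc n" using m by (cases m) auto
    show ?thesis unfolding C_def n power_mult_distrib by simp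
  qed
  \<comment> \<open>\<open>riesz_mass 2 = 2 * pi\<^sup>2\<close> is enlarged to the measure of the
    sphere, so that the same bound also fits \<open>m = 0\<close> in
    \<open>exp_integrability_smooth\<close>.\<close>
  also have "\<dots> \<le> ((81 / (8 * pi\<^sup>2))\<^sup>2 * (4 * pi\<^sup>2 * real m) * (\<integral>y. (?h y)\<^sup>2 \<partial>\<sigma>)) ^ m * (8 * pi\<^sup>2 / 3)"
    using H0 by (intro mult_left_mono zero_le_power mult_nonneg_nonneg) (auto simp: riesz_mass_def)
  finally show ?thesis .
qed

text \<open>\<open>82 = 32 + 2 * 5\<^sup>2\<close>, from
  \<open>(a + b)\<^sup>2 \<le> 2 * a\<^sup>2 + 2 * b\<^sup>2\<close> and the factor \<open>5\<close>
  in \<open>L2_norm_lap_le\<close>.\<close>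

lemma integral_green_density_square:
  assumes f: "smooth_S4 f" and N: "H2_norm_smooth f \<le> N"
  shows "(\<integral>y. (green_density f y)\<^sup>2 \<partial>\<sigma>) \<le> 82 * N\<^sup>2"
proof -
  have sl: "smooth_S4 (lap f)" using f by simp
  have i: "integrable \<sigma> (\<lambda>y. (f y)\<^sup>2)" "integrable \<sigma> (\<lambda>y. (lap f y)\<^sup>2)"
    by (intro smooth_S4_integrable smooth_S4_power f sl)+
  have sq: "(4 * \<bar>a\<bar> + \<bar>b\<bar>)\<^sup>2 \<le> 32 * a\<^sup>2 + 2 * b\<^sup>2" for a b :: real
    using zero_le_power2[of "4 * \<bar>a\<bar> - \<bar>b\<bar>"] by (simp add: power2_sum power2_diff power_mult_distrib)
  have "(\<integral>y. (green_density f y)\<^sup>2 \<partial>\<sigma>) \<le> (\<integral>y. 32 * (f y)\<^sup>2 + 2 * (lap f y)\<^sup>2 \<partial>\<sigma>)"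
    using i by (intro integral_mono continuous_on_S4_integrable continuous_intros continuous_on_green_density
         smooth_S4_continuous_on f sl) (auto simp: green_density_def sq)
  also have "\<dots> = 32 * (\<integral>y. (f y)\<^sup>2 \<partial>\<sigma>) + 2 * (\<integral>y. (lap f y)\<^sup>2 \<partial>\<sigma>)" using i by simp
  also have "\<dots> \<le> 32 * N\<^sup>2 + 2 * (5 * N)\<^sup>2"
  proof (intro add_mono mult_left_mono)
    have "L2_norm f \<le> N" using L2_norm_le_H2_norm_smooth[OF f] N by linarith
    then show "(\<integral>y. (f y)\<^sup>2 \<partial>\<sigma>) \<le> N\<^sup>2"
      by (rule sqrt_le_D)
    have "L2_norm (lap f) \<le> 5 * N" using L2_norm_lap_le[OF f] N by linarith
    then show "(\<integral>y. (lap f y)\<^sup>2 \<partial>\<sigma>) \<le> (5 * N)\<^sup>2"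
      by (rule sqrt_le_D)
  qed auto
  also have "\<dots> = 82 * N\<^sup>2" by (simp add: power_mult_distrib)
  finally show ?thesis .
qed

section \<open>From power bounds to exponential integrability\<close>

lemma power_le_fact_exp:
  fixes t :: real
  assumes "t \<ge> 0"
  shows "t ^ n \<le> fact n * exp t"
proof -
  have s: "(\<lambda>n. t ^ n /\<^sub>R fact n) sums exp t" by (rule exp_converges)
  have "(\<Sum>n\<in>{n}. t ^ n /\<^sub>R fact n) \<le> (\<Sum>n. t ^ n /\<^sub>R fact n)"
    using s assms by (intro sum_le_suminf) (auto simp: sums_iff)
  then have "t ^ n / fact n \<le> exp t"
    using s by (simp add: sums_iff divide_inverse mult.commute)
  then show ?thesis by (simp add: field_simps)
qed

text \<open>A crude form of Stirling's formula, from a single term of the exponential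
  series.\<close>

lemma power_self_le_fact_exp: "real m ^ m \<le> fact m * exp 1 ^ m"
  using power_le_fact_exp[of "real m" m] exp_of_nat_mult[of m "1 :: real"] by simp

text \<open>Chosen so that \<open>mt_const * A * exp 1 = 1 / 2\<close>, where
  \<open>(A * m) ^ m\<close> bounds the normalised moments in
  \<open>exp_integrability_smooth\<close>; the exponential series is then dominated by a geometric
  one.\<close>

definition mt_const :: real where
  "mt_const = 1 / (2 * ((81 / (8 * pi\<^sup>2))\<^sup>2 * (4 * pi\<^sup>2) * 82) * exp 1)"

lemma mt_const_pos: "mt_const > 0"
  by (simp add: mt_const_def)

text \<open>The moment of order \<open>2 * m\<close> costs \<open>(A * m) ^ m\<close>, which
  \<open>fact m\<close> compensates up to \<open>exp 1 ^ m\<close>, so the terms of the series decay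
  like \<open>(1 / 2) ^ m\<close>. The bound is twice the measure of the sphere.\<close>

lemma exp_integrability_smooth:
  assumes f: "smooth_S4 f" and N: "H2_norm_smooth f \<le> N" "N > 0"
  shows "(\<integral>x. exp (mt_const * (f x / N)\<^sup>2) \<partial>\<sigma>) \<le> 16 * pi\<^sup>2 / 3"
proof -
  define A where "A = (81 / (8 * pi\<^sup>2))\<^sup>2 * (4 * pi\<^sup>2) * 82"
  have A: "A > 0" by (simp add: A_def)
  define E where "E x = mt_const * (f x / N)\<^sup>2" for x
  have E0: "E x \<ge> 0" for x using mt_const_pos by (simp add: E_def)
  have smt: "smooth_S4 (\<lambda>x. f x / N)"
    using smooth_S4_mult[OF f smooth_S4_const[of "inverse N"]] by (simp add: divide_inverse)
  have smE: "smooth_S4 E"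
    unfolding E_def[abs_def] by (intro smooth_S4_mult smooth_S4_const smooth_S4_power smt)
  have pow: "(\<integral>x. (f x / N) ^ (2 * m) \<partial>\<sigma>) \<le> (A * real m) ^ m * (8 * pi\<^sup>2 / 3)" for m
  proof (cases "m = 0")
    case True
    then show ?thesis using measure_S4 by simp
  next
    case False
    then have m: "m \<ge> 1" by simp
    have "(\<integral>x. (f x / N) ^ (2 * m) \<partial>\<sigma>) = (\<integral>x. f x ^ (2 * m) \<partial>\<sigma>) / N ^ (2 * m)"
      by (simp add: power_divide)
    also have "\<dots> \<le> (((81 / (8 * pi\<^sup>2))\<^sup>2 * (4 * pi\<^sup>2 * real m) * (82 * N\<^sup>2)) ^ m * (8 * pi\<^sup>2 / 3)) / N ^ (2 * m)"
    proof (intro divide_right_mono order_trans[OF integral_power_bound[OF f m]] mult_right_mono power_mono mult_left_mono)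
      show "(\<integral>y. (green_density f y)\<^sup>2 \<partial>\<sigma>) \<le> 82 * N\<^sup>2" by (rule integral_green_density_square[OF f N(1)])
    qed (use N in auto)
    also have "(81 / (8 * pi\<^sup>2))\<^sup>2 * (4 * pi\<^sup>2 * real m) * (82 * N\<^sup>2) = (A * real m) * N\<^sup>2"
      by (simp add: A_def)
    also have "((A * real m) * N\<^sup>2) ^ m * (8 * pi\<^sup>2 / 3) / N ^ (2 * m) = (A * real m) ^ m * (8 * pi\<^sup>2 / 3)"
      using N(2) by (simp add: power_mult_distrib[of _ "N\<^sup>2"] power_mult)
    finally show ?thesis .
  qed
  have summand: "(\<integral>x. E x ^ m / fact m \<partial>\<sigma>) \<le> (1 / 2) ^ m * (8 * pi\<^sup>2 / 3)" for m
  proof -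
    have "(\<integral>x. E x ^ m / fact m \<partial>\<sigma>) = mt_const ^ m / fact m * (\<integral>x. (f x / N) ^ (2 * m) \<partial>\<sigma>)"
      by (simp add: E_def power_mult_distrib power_mult)
    also have "\<dots> \<le> mt_const ^ m / fact m * ((A * real m) ^ m * (8 * pi\<^sup>2 / 3))"
      using mt_const_pos by (intro mult_left_mono pow) auto
    also have "\<dots> = (mt_const * A) ^ m * (8 * pi\<^sup>2 / 3) / fact m * real m ^ m"
      unfolding power_mult_distrib by (simp add: ac_simps)
    also have "\<dots> \<le> (mt_const * A) ^ m * (8 * pi\<^sup>2 / 3) / fact m * (fact m * exp 1 ^ m)"
      using mt_const_pos A by (intro mult_left_mono power_self_le_fact_exp) auto
    also have "\<dots> = (mt_const * A * exp 1) ^ m * (8 * pi\<^sup>2 / 3)"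
      by (simp add: power_mult_distrib)
    also have "mt_const * A * exp 1 = 1 / 2"
      using A unfolding mt_const_def A_def[symmetric] by simp
    finally show ?thesis .
  qed
  have "(\<lambda>n. \<integral>x. (\<Sum>m<n. E x ^ m / fact m) \<partial>\<sigma>) \<longlonglongrightarrow> (\<integral>x. exp (E x) \<partial>\<sigma>)"
  proof (rule integral_dominated_convergence[where w = "\<lambda>x. exp (E x)"])
    have s: "(\<lambda>n. E x ^ n / fact n) sums exp (E x)" for x
      using exp_converges[of "E x"] by (simp add: divide_inverse mult.commute)
    show "AE x in \<sigma>. (\<lambda>n. \<Sum>m<n. E x ^ m / fact m) \<longlonglongrightarrow> exp (E x)"
      using s by (simp add: sums_def)
    have "(\<Sum>m<n. E x ^ m / fact m) \<le> exp (E x)" for n x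
      using s[of x] E0[of x] sum_le_suminf[of "\<lambda>n. E x ^ n / fact n" "{..<n}"] by (simp add: sums_iff)
    then show "AE x in \<sigma>. norm (\<Sum>m<n. E x ^ m / fact m) \<le> exp (E x)" for n
      using E0 by (intro AE_I2) (simp add: abs_of_nonneg sum_nonneg)
    show "integrable \<sigma> (\<lambda>x. exp (E x))"
      by (intro continuous_on_S4_integrable continuous_intros smooth_S4_continuous_on smE)
    show "(\<lambda>x. exp (E x)) \<in> borel_measurable \<sigma>"
      by (intro continuous_on_S4_measurable continuous_intros smooth_S4_continuous_on smE)
    show "(\<lambda>x. \<Sum>m<n. E x ^ m / fact m) \<in> borel_measurable \<sigma>" for n
      by (intro continuous_on_S4_measurable continuous_intros smooth_S4_continuous_on smE) auto
  qed
  moreover have "(\<integral>x. (\<Sum>m<n. E x ^ m / fact m) \<partial>\<sigma>) \<le> 16 * pi\<^sup>2 / 3" for n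
  proof -
    have "(\<integral>x. (\<Sum>m<n. E x ^ m / fact m) \<partial>\<sigma>) = (\<Sum>m<n. \<integral>x. E x ^ m / fact m \<partial>\<sigma>)"
      by (intro Bochner_Integration.integral_sum integrable_divide smooth_S4_integrable smooth_S4_power smE)
    also have "\<dots> \<le> (\<Sum>m<n. (1 / 2) ^ m * (8 * pi\<^sup>2 / 3))" by (intro sum_mono summand)
    also have "\<dots> = (\<Sum>m<n. (1 / 2) ^ m) * (8 * pi\<^sup>2 / 3)" by (simp only: sum_distrib_right)
    also have "(\<Sum>m<n. (1 / 2 :: real) ^ m) \<le> (\<Sum>m. (1 / 2) ^ m)"
      by (intro sum_le_suminf summable_geometric) auto
    also have "(\<Sum>m. (1 / 2 :: real) ^ m) = 2" by (subst suminf_geometric) auto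
    finally show ?thesis by (simp add: mult_right_mono)
  qed
  ultimately show ?thesis
    unfolding E_def[symmetric] by (intro LIMSEQ_le_const2) auto
qed

text \<open>Fatou's lemma along an almost everywhere convergent subsequence of approximants. The
  inequality with \<open>N\<close> is strict so that their norms are eventually below
  \<open>N\<close>; with a nonnegative integral, integrability becomes part of the
  conclusion.\<close>

lemma exp_integrability:
  assumes f: "f \<in> H2_S4" and N: "H2_norm f < N"
  shows "(\<integral>\<^sup>+x. ennreal (exp (mt_const * (f x / N)\<^sup>2)) \<partial>\<sigma>) \<le> ennreal (16 * pi\<^sup>2 / 3)"
proof -
  have fL: "f \<in> L2_S4" using f by (simp add: H2_S4_def)
  obtain \<phi> where \<phi>: "H2_approx \<phi> f" using f by (auto simp: H2_S4_def)
  note sm = H2_approxD(1)[OF \<phi>]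
  have lim: "(\<lambda>n. H2_norm_smooth (\<phi> n)) \<longlonglongrightarrow> H2_norm f" by (rule H2_norm_tendsto[OF f \<phi>])
  have "H2_norm f \<ge> 0"
    by (rule LIMSEQ_le_const[OF lim]) (use H2_norm_smooth_nonneg in blast)
  then have N0: "N > 0" using N by linarith
  have ev: "\<forall>\<^sub>F n in sequentially. H2_norm_smooth (\<phi> n) < N"
    by (rule order_tendstoD(2)[OF lim N])
  have "\<exists>r. strict_mono r \<and> (AE x in \<sigma>. (\<lambda>n. (\<phi> (r n) x - f x)\<^sup>2) \<longlonglongrightarrow> 0)"
    using H2_approxD(3)[OF \<phi>]
    by (intro tendsto_L1_AE_subseq L2_S4_D L2_diff smooth_S4_L2 sm fL) simp
  then obtain r where r: "strict_mono r" "AE x in \<sigma>. (\<lambda>n. (\<phi> (r n) x - f x)\<^sup>2) \<longlonglongrightarrow> 0" by blast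
  have ev': "\<forall>\<^sub>F n in sequentially. H2_norm_smooth (\<phi> (r n)) < N"
    using eventually_subseq[OF r(1) ev] .
  let ?e = "\<lambda>g x. ennreal (exp (mt_const * (g x / N)\<^sup>2))"
  have [measurable]: "\<phi> n \<in> borel_measurable \<sigma>" for n by (rule smooth_S4_measurable[OF sm])
  have "AE x in \<sigma>. ?e f x = liminf (\<lambda>n. ?e (\<phi> (r n)) x)"
    using r(2)
  proof eventually_elim
    case (elim x)
    then have "(\<lambda>n. \<bar>\<phi> (r n) x - f x\<bar>) \<longlonglongrightarrow> 0" using tendsto_real_sqrt by fastforce
    then have "(\<lambda>n. \<phi> (r n) x) \<longlonglongrightarrow> f x"
      by (simp add: tendsto_rabs_zero_iff LIM_zero_iff)
    then have "(\<lambda>n. ?e (\<phi> (r n)) x) \<longlonglongrightarrow> ?e f x"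
      by (intro tendsto_ennrealI tendsto_intros) (use N0 in auto)
    then show ?case by (rule lim_imp_Liminf[symmetric, rotated]) simp
  qed
  then have "(\<integral>\<^sup>+x. ?e f x \<partial>\<sigma>) = (\<integral>\<^sup>+x. liminf (\<lambda>n. ?e (\<phi> (r n)) x) \<partial>\<sigma>)"
    by (rule nn_integral_cong_AE)
  also have "\<dots> \<le> liminf (\<lambda>n. \<integral>\<^sup>+x. ?e (\<phi> (r n)) x \<partial>\<sigma>)"
    by (intro nn_integral_liminf) measurable
  also have "\<dots> \<le> liminf (\<lambda>n. ennreal (16 * pi\<^sup>2 / 3))"
  proof (rule Liminf_mono)
    show "\<forall>\<^sub>F n in sequentially. (\<integral>\<^sup>+x. ?e (\<phi> (r n)) x \<partial>\<sigma>) \<le> ennreal (16 * pi\<^sup>2 / 3)"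
      using ev'
    proof eventually_elim
      case (elim n)
      have "continuous_on S4 (\<lambda>x. exp (mt_const * (\<phi> (r n) x / N)\<^sup>2))"
        using N0 by (intro continuous_intros smooth_S4_continuous_on sm) auto
      then have "(\<integral>\<^sup>+x. ?e (\<phi> (r n)) x \<partial>\<sigma>) = ennreal (\<integral>x. exp (mt_const * (\<phi> (r n) x / N)\<^sup>2) \<partial>\<sigma>)"
        by (intro nn_integral_eq_integral continuous_on_S4_integrable) auto
      also have "\<dots> \<le> ennreal (16 * pi\<^sup>2 / 3)"
        using elim N0 by (intro ennreal_leI exp_integrability_smooth sm) auto
      finally show ?case .
    qed
  qed
  also have "\<dots> = ennreal (16 * pi\<^sup>2 / 3)" by (simp add: Liminf_const)
  finally show ?thesis .
qed

subsection \<open>The Riesz quadratic form\<close>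

abbreviation pairm :: "((real^5) \<times> (real^5)) measure" where "pairm \<equiv> \<sigma> \<Otimes>\<^sub>M \<sigma>"

definition riesz_kernel :: "real \<Rightarrow> (real^5) \<times> (real^5) \<Rightarrow> real" where
  "riesz_kernel \<alpha> z = dist (fst z) (snd z) powr (- \<alpha>)"

lemma riesz_kernel_nonneg: "riesz_kernel \<alpha> z \<ge> 0"
  by (simp add: riesz_kernel_def)

lemma measurable_riesz_kernel [measurable]: "riesz_kernel \<alpha> \<in> borel_measurable pairm"
  unfolding riesz_kernel_def[abs_def] by measurable

lemma measurable_fst_sphere: "u \<in> borel_measurable \<sigma> \<Longrightarrow> (\<lambda>z. u (fst z)) \<in> borel_measurable pairm"
  by (rule measurable_compose[OF measurable_fst])

lemma measurable_snd_sphere: "u \<in> borel_measurable \<sigma> \<Longrightarrow> (\<lambda>z. u (snd z)) \<in> borel_measurable pairm"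
  by (rule measurable_compose[OF measurable_snd])

text \<open>The kernel integrates in its second variable to the constant
  \<open>riesz_mass \<alpha>\<close>, so functions of one variable see only a multiple of the
  surface measure. All bounds on the product are reduced to such marginals.\<close>

lemma has_bochner_integral_riesz_fst:
  assumes a: "0 < \<alpha>" "\<alpha> < 4" and u: "integrable \<sigma> u"
  shows "has_bochner_integral pairm (\<lambda>z. u (fst z) * riesz_kernel \<alpha> z) (riesz_mass \<alpha> * (\<integral>x. u x \<partial>\<sigma>))"
proof -
  note k = has_bochner_integral_riesz_kernel[OF _ a, unfolded has_bochner_integral_iff]
  have um: "u \<in> borel_measurable \<sigma>" using u by (rule borel_measurable_integrable)
  have int: "integrable pairm (\<lambda>z. u (fst z) * riesz_kernel \<alpha> z)"
  proof (rule sphere_pair.Fubini_integrable)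
    show "(\<lambda>z. u (fst z) * riesz_kernel \<alpha> z) \<in> borel_measurable pairm"
      using measurable_fst_sphere[OF um] by measurable
    have "(\<integral>y. norm (u (fst (x, y)) * riesz_kernel \<alpha> (x, y)) \<partial>\<sigma>) = riesz_mass \<alpha> * \<bar>u x\<bar>" if "x \<in> S4" for x
      using k[OF that] by (simp add: abs_mult riesz_kernel_def)
    then have "integrable \<sigma> (\<lambda>x. \<integral>y. norm (u (fst (x, y)) * riesz_kernel \<alpha> (x, y)) \<partial>\<sigma>)
        \<longleftrightarrow> integrable \<sigma> (\<lambda>x. riesz_mass \<alpha> * \<bar>u x\<bar>)"
      by (intro Bochner_Integration.integrable_cong refl) simp
    then show "integrable \<sigma> (\<lambda>x. \<integral>y. norm (u (fst (x, y)) * riesz_kernel \<alpha> (x, y)) \<partial>\<sigma>)"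
      using u by simp
    show "AE x in \<sigma>. integrable \<sigma> (\<lambda>y. u (fst (x, y)) * riesz_kernel \<alpha> (x, y))"
      using k by (intro AE_I2) (simp add: riesz_kernel_def)
  qed
  have "integral\<^sup>L pairm (\<lambda>z. u (fst z) * riesz_kernel \<alpha> z)
     = (\<integral>x. (\<integral>y. u (fst (x, y)) * riesz_kernel \<alpha> (x, y) \<partial>\<sigma>) \<partial>\<sigma>)"
    by (rule sphere_pair.integral_fst'[OF int, symmetric])
  also have "\<dots> = (\<integral>x. riesz_mass \<alpha> * u x \<partial>\<sigma>)"
    using k by (intro Bochner_Integration.integral_cong refl) (simp add: riesz_kernel_def)
  finally show ?thesis using int by (simp add: has_bochner_integral_iff)
qed

text \<open>By symmetry of the kernel, after swapping the two factors of the product.\<close>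

lemma has_bochner_integral_riesz_snd:
  assumes a: "0 < \<alpha>" "\<alpha> < 4" and u: "integrable \<sigma> u"
  shows "has_bochner_integral pairm (\<lambda>z. u (snd z) * riesz_kernel \<alpha> z) (riesz_mass \<alpha> * (\<integral>x. u x \<partial>\<sigma>))"
proof -
  have f: "integrable pairm (\<lambda>z. u (fst z) * riesz_kernel \<alpha> z)"
    "integral\<^sup>L pairm (\<lambda>z. u (fst z) * riesz_kernel \<alpha> z) = riesz_mass \<alpha> * (\<integral>x. u x \<partial>\<sigma>)"
    using has_bochner_integral_riesz_fst[OF assms] by (auto simp: has_bochner_integral_iff)
  have e: "(\<lambda>(x, y). u (fst (y, x)) * riesz_kernel \<alpha> (y, x)) = (\<lambda>z. u (snd z) * riesz_kernel \<alpha> z)"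
    by (auto simp: fun_eq_iff riesz_kernel_def dist_commute)
  have "integrable pairm (\<lambda>z. u (snd z) * riesz_kernel \<alpha> z)"
    using sphere_pair.integrable_product_swap[OF f(1)] unfolding e .
  moreover have "integral\<^sup>L pairm (\<lambda>z. u (snd z) * riesz_kernel \<alpha> z) = riesz_mass \<alpha> * (\<integral>x. u x \<partial>\<sigma>)"
    using sphere_pair.integral_product_swap[of "\<lambda>z. u (fst z) * riesz_kernel \<alpha> z"]
      borel_measurable_integrable[OF f(1)] unfolding e f(2) by simp
  ultimately show ?thesis by (simp add: has_bochner_integral_iff)
qed

section \<open>The Riesz form, its Schur bound and the form of the linearised operator\<close>

definition riesz_form :: "real \<Rightarrow> (real^5 \<Rightarrow> real) \<Rightarrow> (real^5 \<Rightarrow> real) \<Rightarrow> real" where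
  "riesz_form \<alpha> f g = (\<integral>z. f (fst z) * g (snd z) * riesz_kernel \<alpha> z \<partial>pairm)"

text \<open>Schur's estimate: split the kernel into two square roots and apply Cauchy-Schwarz on the
  product; each factor leaves a marginal integral.\<close>

lemma
  assumes a: "0 < \<alpha>" "\<alpha> < 4" and f: "f \<in> L2_S4" and g: "g \<in> L2_S4"
  shows integrable_riesz_form: "integrable pairm (\<lambda>z. f (fst z) * g (snd z) * riesz_kernel \<alpha> z)"
    and riesz_form_bound: "\<bar>riesz_form \<alpha> f g\<bar> \<le> riesz_mass \<alpha> * (L2_norm f * L2_norm g)"
proof -
  let ?u = "\<lambda>z. f (fst z) * sqrt (riesz_kernel \<alpha> z)" and ?v = "\<lambda>z. g (snd z) * sqrt (riesz_kernel \<alpha> z)"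
  have u2: "(?u z)\<^sup>2 = (f (fst z))\<^sup>2 * riesz_kernel \<alpha> z" and v2: "(?v z)\<^sup>2 = (g (snd z))\<^sup>2 * riesz_kernel \<alpha> z" for z
    using riesz_kernel_nonneg by (auto simp: power_mult_distrib)
  have uv: "?u z * ?v z = f (fst z) * g (snd z) * riesz_kernel \<alpha> z" for z
  proof -
    have "sqrt (riesz_kernel \<alpha> z) * sqrt (riesz_kernel \<alpha> z) = riesz_kernel \<alpha> z"
      using riesz_kernel_nonneg by simp
    then show ?thesis by (metis mult.assoc mult.left_commute)
  qed
  have m: "?u \<in> borel_measurable pairm" "?v \<in> borel_measurable pairm"
    using measurable_fst_sphere[OF L2_S4_D(1)[OF f]] measurable_snd_sphere[OF L2_S4_D(1)[OF g]]
    by measurable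
  have i: "has_bochner_integral pairm (\<lambda>z. (?u z)\<^sup>2) (riesz_mass \<alpha> * (\<integral>x. (f x)\<^sup>2 \<partial>\<sigma>))"
      "has_bochner_integral pairm (\<lambda>z. (?v z)\<^sup>2) (riesz_mass \<alpha> * (\<integral>x. (g x)\<^sup>2 \<partial>\<sigma>))"
    unfolding u2 v2
    by (rule has_bochner_integral_riesz_fst[OF a L2_S4_D(2)[OF f]],
        rule has_bochner_integral_riesz_snd[OF a L2_S4_D(2)[OF g]])
  then have i': "integrable pairm (\<lambda>z. (?u z)\<^sup>2)" "integrable pairm (\<lambda>z. (?v z)\<^sup>2)"
    by (auto simp only: has_bochner_integral_iff)
  show "integrable pairm (\<lambda>z. f (fst z) * g (snd z) * riesz_kernel \<alpha> z)"
    using integrable_mult_L2[OF m i'] unfolding uv .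
  have "\<bar>riesz_form \<alpha> f g\<bar> \<le> sqrt (riesz_mass \<alpha> * (\<integral>x. (f x)\<^sup>2 \<partial>\<sigma>)) * sqrt (riesz_mass \<alpha> * (\<integral>x. (g x)\<^sup>2 \<partial>\<sigma>))"
    using integral_Cauchy_Schwarz[OF m i']
    unfolding uv has_bochner_integral_integral_eq[OF i(1)] has_bochner_integral_integral_eq[OF i(2)] riesz_form_def .
  also have "\<dots> = (sqrt (riesz_mass \<alpha>) * sqrt (riesz_mass \<alpha>)) * (L2_norm f * L2_norm g)"
    unfolding real_sqrt_mult by (simp add: ac_simps)
  also have "sqrt (riesz_mass \<alpha>) * sqrt (riesz_mass \<alpha>) = riesz_mass \<alpha>"
    using riesz_mass_pos[OF a(2)] by simp
  finally show "\<bar>riesz_form \<alpha> f g\<bar> \<le> riesz_mass \<alpha> * (L2_norm f * L2_norm g)" .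
qed

lemma riesz_form_diff:
  assumes a: "0 < \<alpha>" "\<alpha> < 4" and f: "f \<in> L2_S4" and g: "g \<in> L2_S4"
  shows "riesz_form \<alpha> f f - riesz_form \<alpha> g g = riesz_form \<alpha> (\<lambda>x. f x - g x) f + riesz_form \<alpha> g (\<lambda>x. f x - g x)"
proof -
  note i = integrable_riesz_form[OF a]
  note d = L2_diff[OF f g]
  have "riesz_form \<alpha> f f - riesz_form \<alpha> g g
     = (\<integral>z. f (fst z) * f (snd z) * riesz_kernel \<alpha> z - g (fst z) * g (snd z) * riesz_kernel \<alpha> z \<partial>pairm)"
    unfolding riesz_form_def by (rule Bochner_Integration.integral_diff[OF i[OF f f] i[OF g g], symmetric])
  also have "\<dots> = (\<integral>z. (f (fst z) - g (fst z)) * f (snd z) * riesz_kernel \<alpha> z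
      + g (fst z) * (f (snd z) - g (snd z)) * riesz_kernel \<alpha> z \<partial>pairm)"
    by (intro Bochner_Integration.integral_cong refl) (simp add: algebra_simps)
  also have "\<dots> = riesz_form \<alpha> (\<lambda>x. f x - g x) f + riesz_form \<alpha> g (\<lambda>x. f x - g x)"
    unfolding riesz_form_def by (rule Bochner_Integration.integral_add[OF i[OF d f] i[OF g d]])
  finally show ?thesis .
qed

text \<open>The form of the Riesz operator plus \<open>mu0 \<alpha>\<close>. It is also the integral
  of \<open>(f x + f y)\<^sup>2 / 2\<close> against the kernel, that is, the quadratic term of
  \<open>I_fun\<close>; this is why \<open>L_op\<close> is the second variation.\<close>

definition riesz_quad :: "real \<Rightarrow> (real^5 \<Rightarrow> real) \<Rightarrow> real" where
  "riesz_quad \<alpha> f = riesz_form \<alpha> f f + riesz_mass \<alpha> * (\<integral>x. (f x)\<^sup>2 \<partial>\<sigma>)"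

lemma riesz_quad_bound:
  assumes "0 < \<alpha>" "\<alpha> < 4" "f \<in> L2_S4"
  shows "\<bar>riesz_quad \<alpha> f\<bar> \<le> 2 * riesz_mass \<alpha> * (\<integral>x. (f x)\<^sup>2 \<partial>\<sigma>)"
proof -
  have "L2_norm f * L2_norm f = (\<integral>x. (f x)\<^sup>2 \<partial>\<sigma>)" by simp
  then have "\<bar>riesz_form \<alpha> f f\<bar> \<le> riesz_mass \<alpha> * (\<integral>x. (f x)\<^sup>2 \<partial>\<sigma>)"
    using riesz_form_bound[OF assms assms(3)] by simp
  moreover have "\<bar>riesz_mass \<alpha> * (\<integral>x. (f x)\<^sup>2 \<partial>\<sigma>)\<bar> = riesz_mass \<alpha> * (\<integral>x. (f x)\<^sup>2 \<partial>\<sigma>)"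
    using riesz_mass_pos[OF assms(2)] by simp
  ultimately show ?thesis unfolding riesz_quad_def by linarith
qed

lemma riesz_quad_diff:
  assumes a: "0 < \<alpha>" "\<alpha> < 4" and f: "f \<in> L2_S4" and g: "g \<in> L2_S4"
  shows "\<bar>riesz_quad \<alpha> f - riesz_quad \<alpha> g\<bar>
    \<le> 2 * riesz_mass \<alpha> * (L2_norm (\<lambda>x. f x - g x) * (L2_norm f + L2_norm g))"
proof -
  let ?d = "\<lambda>x. f x - g x"
  note d = L2_diff[OF f g]
  have "(\<integral>x. (f x)\<^sup>2 \<partial>\<sigma>) - (\<integral>x. (g x)\<^sup>2 \<partial>\<sigma>) = (\<integral>x. (f x)\<^sup>2 - (g x)\<^sup>2 \<partial>\<sigma>)"
    by (rule Bochner_Integration.integral_diff[OF L2_S4_D(2)[OF f] L2_S4_D(2)[OF g], symmetric])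
  also have "\<dots> = (\<integral>x. ?d x * f x + ?d x * g x \<partial>\<sigma>)"
    by (intro Bochner_Integration.integral_cong refl) (simp add: power2_eq_square algebra_simps)
  also have "\<dots> = (\<integral>x. ?d x * f x \<partial>\<sigma>) + (\<integral>x. ?d x * g x \<partial>\<sigma>)"
    by (rule Bochner_Integration.integral_add[OF L2_mult_integrable[OF d f] L2_mult_integrable[OF d g]])
  finally have "\<bar>(\<integral>x. (f x)\<^sup>2 \<partial>\<sigma>) - (\<integral>x. (g x)\<^sup>2 \<partial>\<sigma>)\<bar> \<le> L2_norm ?d * L2_norm f + L2_norm ?d * L2_norm g"
    using L2_Cauchy_Schwarz[OF d f] L2_Cauchy_Schwarz[OF d g] by linarith
  then have "riesz_mass \<alpha> * \<bar>(\<integral>x. (f x)\<^sup>2 \<partial>\<sigma>) - (\<integral>x. (g x)\<^sup>2 \<partial>\<sigma>)\<bar>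
      \<le> riesz_mass \<alpha> * (L2_norm ?d * L2_norm f + L2_norm ?d * L2_norm g)"
    using riesz_mass_pos[OF a(2)] by (intro mult_left_mono) auto
  then have 1: "\<bar>riesz_mass \<alpha> * (\<integral>x. (f x)\<^sup>2 \<partial>\<sigma>) - riesz_mass \<alpha> * (\<integral>x. (g x)\<^sup>2 \<partial>\<sigma>)\<bar>
      \<le> riesz_mass \<alpha> * (L2_norm ?d * L2_norm f) + riesz_mass \<alpha> * (L2_norm g * L2_norm ?d)"
    using riesz_mass_pos[OF a(2)]
    by (simp add: right_diff_distrib[symmetric] abs_mult distrib_left mult.commute[of "L2_norm g"])
  have 2: "\<bar>riesz_form \<alpha> f f - riesz_form \<alpha> g g\<bar>
      \<le> riesz_mass \<alpha> * (L2_norm ?d * L2_norm f) + riesz_mass \<alpha> * (L2_norm g * L2_norm ?d)"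
    unfolding riesz_form_diff[OF a f g]
    using riesz_form_bound[OF a d f] riesz_form_bound[OF a g d] by linarith
  have "2 * riesz_mass \<alpha> * (L2_norm ?d * (L2_norm f + L2_norm g))
     = 2 * (riesz_mass \<alpha> * (L2_norm ?d * L2_norm f) + riesz_mass \<alpha> * (L2_norm g * L2_norm ?d))"
    by (simp only: distrib_left ac_simps)
  moreover have "\<bar>p1 + q1 - (p2 + q2)\<bar> \<le> T" if "\<bar>q1 - q2\<bar> \<le> X" "\<bar>p1 - p2\<bar> \<le> X" "T = 2 * X"
    for p1 p2 q1 q2 X T :: real
    using that by linarith
  ultimately show ?thesis unfolding riesz_quad_def using 1 2 by blast
qed

lemma L2_inner_L_op:
  assumes a: "0 < \<alpha>" "\<alpha> < 4" and f: "smooth_S4 f"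
  shows "L2_inner (L_op \<alpha> f) f = L2_inner f (paneitz_S4 f) - kappa \<alpha> * riesz_quad \<alpha> f"
proof -
  note int = integrable_riesz_form[OF a smooth_S4_L2[OF f] smooth_S4_L2[OF f]]
  have R: "(\<integral>y. f (fst (x, y)) * f (snd (x, y)) * riesz_kernel \<alpha> (x, y) \<partial>\<sigma>) = f x * riesz \<alpha> f x" for x
    by (simp add: riesz_def riesz_kernel_def mult.assoc mult.commute[of "f _" "dist _ _ powr _"])
  have iR: "integrable \<sigma> (\<lambda>x. f x * riesz \<alpha> f x)"
    using sphere_pair.integrable_fst'[OF int] unfolding R .
  have eR: "(\<integral>x. f x * riesz \<alpha> f x \<partial>\<sigma>) = riesz_form \<alpha> f f"
    using sphere_pair.integral_fst'[OF int] unfolding R riesz_form_def .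
  have i2: "integrable \<sigma> (\<lambda>x. (f x)\<^sup>2)" by (rule L2_S4_D(2)[OF smooth_S4_L2[OF f]])
  have iP': "integrable \<sigma> (\<lambda>x. f x * (lap (lap f) x - 2 * lap f x))"
    by (intro smooth_S4_integrable smooth_S4_mult smooth_S4_diff smooth_S4_const smooth_lap f)
  have "integrable \<sigma> (\<lambda>x. f x * paneitz_S4 f x) \<longleftrightarrow> integrable \<sigma> (\<lambda>x. f x * (lap (lap f) x - 2 * lap f x))"
    by (intro Bochner_Integration.integrable_cong refl) (simp add: paneitz_S4_eq f)
  then have iP: "integrable \<sigma> (\<lambda>x. f x * paneitz_S4 f x)" using iP' by simp
  have "L2_inner (L_op \<alpha> f) f
     = (\<integral>x. f x * paneitz_S4 f x - kappa \<alpha> * (f x * riesz \<alpha> f x + riesz_mass \<alpha> * (f x)\<^sup>2) \<partial>\<sigma>)"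
    unfolding L2_inner_def L_op_def mu0_eq[OF a]
    by (intro Bochner_Integration.integral_cong refl) (simp add: power2_eq_square algebra_simps)
  also have "\<dots> = (\<integral>x. f x * paneitz_S4 f x \<partial>\<sigma>)
     - kappa \<alpha> * ((\<integral>x. f x * riesz \<alpha> f x \<partial>\<sigma>) + riesz_mass \<alpha> * (\<integral>x. (f x)\<^sup>2 \<partial>\<sigma>))"
    using iP iR i2 by simp
  finally show ?thesis by (simp add: L2_inner_def eR riesz_quad_def)
qed

text \<open>The Riesz part is continuous already in L^2, by \<open>riesz_quad_diff\<close>, so along
  any approximating sequence it converges to its value at \<open>f\<close>.\<close>

lemma L_form_eq:
  assumes a: "0 < \<alpha>" "\<alpha> < 4" and f: "f \<in> H2_S4"
  shows "L_form \<alpha> f = paneitz_form f - kappa \<alpha> * riesz_quad \<alpha> f"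
  unfolding L_form_def
proof (rule H2_extend_eqI[OF f])
  fix \<phi> assume \<phi>: "H2_approx \<phi> f"
  note sm = H2_approxD(1)[OF \<phi>]
  have fL: "f \<in> L2_S4" using f by (simp add: H2_S4_def)
  obtain K where K: "K > 0" "\<forall>\<^sub>F n in sequentially. H2_norm_smooth (\<phi> n) \<le> K"
    using H2_approx_bounded[OF \<phi>] by blast
  have "(\<lambda>n. riesz_quad \<alpha> (\<phi> n) - riesz_quad \<alpha> f) \<longlonglongrightarrow> 0"
  proof (rule tendsto_rabs_zero_cancel, rule tendsto_sandwich[where f = "\<lambda>_. 0"])
    have "(\<lambda>n. L2_norm (\<lambda>x. \<phi> n x - f x)) \<longlonglongrightarrow> 0"
      using tendsto_real_sqrt[OF H2_approxD(3)[OF \<phi>]] by simp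
    then have "(\<lambda>n. 2 * riesz_mass \<alpha> * (L2_norm (\<lambda>x. \<phi> n x - f x) * (K + L2_norm f)))
        \<longlonglongrightarrow> 2 * riesz_mass \<alpha> * (0 * (K + L2_norm f))"
      by (intro tendsto_mult tendsto_const)
    then show "(\<lambda>n. 2 * riesz_mass \<alpha> * (L2_norm (\<lambda>x. \<phi> n x - f x) * (K + L2_norm f))) \<longlonglongrightarrow> 0"
      by simp
    show "\<forall>\<^sub>F n in sequentially. \<bar>riesz_quad \<alpha> (\<phi> n) - riesz_quad \<alpha> f\<bar>
        \<le> 2 * riesz_mass \<alpha> * (L2_norm (\<lambda>x. \<phi> n x - f x) * (K + L2_norm f))"
      using K(2)
    proof eventually_elim
      case (elim n)
      have "L2_norm (\<phi> n) \<le> K" using L2_norm_le_H2_norm_smooth[OF sm] elim by (rule order_trans)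
      then have "2 * riesz_mass \<alpha> * (L2_norm (\<lambda>x. \<phi> n x - f x) * (L2_norm (\<phi> n) + L2_norm f))
         \<le> 2 * riesz_mass \<alpha> * (L2_norm (\<lambda>x. \<phi> n x - f x) * (K + L2_norm f))"
        using riesz_mass_pos[OF a(2)] by (intro mult_left_mono add_right_mono) auto
      then show ?case using riesz_quad_diff[OF a smooth_S4_L2[OF sm] fL] by (rule order_trans[rotated])
    qed
  qed auto
  then have "(\<lambda>n. riesz_quad \<alpha> (\<phi> n)) \<longlonglongrightarrow> riesz_quad \<alpha> f" by (rule LIM_zero_cancel)
  then show "(\<lambda>n. L2_inner (L_op \<alpha> (\<phi> n)) (\<phi> n)) \<longlonglongrightarrow> paneitz_form f - kappa \<alpha> * riesz_quad \<alpha> f"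
    unfolding L2_inner_L_op[OF a sm]
    by (intro tendsto_diff tendsto_mult tendsto_const paneitz_form_tendsto[OF f \<phi>])
qed

subsection \<open>Third order Taylor expansion\<close>

lemma exp_taylor2_bound:
  fixes s :: real
  shows "\<bar>exp s - 1 - s - s\<^sup>2 / 2\<bar> \<le> \<bar>s\<bar> ^ 3 * exp \<bar>s\<bar>"
proof -
  obtain t where t: "\<bar>t\<bar> \<le> \<bar>s\<bar>" "exp s = (\<Sum>m<3. s ^ m / fact m) + exp t / fact 3 * s ^ 3"
    using Maclaurin_exp_le[of s 3] by blast
  then have eq: "exp s - 1 - s - s\<^sup>2 / 2 = exp t * s ^ 3 / 6"
    by (simp add: numeral_eq_Suc)
  have "\<bar>exp s - 1 - s - s\<^sup>2 / 2\<bar> = exp t * \<bar>s\<bar> ^ 3 / 6"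
    unfolding eq by (simp add: abs_mult power_abs)
  also have "\<dots> \<le> exp t * \<bar>s\<bar> ^ 3" by simp
  also have "\<dots> \<le> exp \<bar>s\<bar> * \<bar>s\<bar> ^ 3" using t(1) by (intro mult_right_mono) auto
  finally show ?thesis by (simp add: mult.commute)
qed

text \<open>The larger of the two absolute values controls the sum up to a factor \<open>2\<close>,
  whence \<open>8 = 2 ^ 3\<close>. The purpose is to separate the variables, so that the remainder
  can be integrated through the marginals of the kernel.\<close>

lemma cube_exp_add_bound:
  fixes a b :: real
  shows "\<bar>a + b\<bar> ^ 3 * exp \<bar>a + b\<bar> \<le> 8 * (\<bar>a\<bar> ^ 3 * exp (2 * \<bar>a\<bar>)) + 8 * (\<bar>b\<bar> ^ 3 * exp (2 * \<bar>b\<bar>))"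
proof -
  have *: "\<bar>s\<bar> ^ 3 * exp \<bar>s\<bar> \<le> 8 * (\<bar>c\<bar> ^ 3 * exp (2 * \<bar>c\<bar>))" if "\<bar>s\<bar> \<le> 2 * \<bar>c\<bar>" for s c :: real
  proof -
    have "\<bar>s\<bar> ^ 3 * exp \<bar>s\<bar> \<le> (2 * \<bar>c\<bar>) ^ 3 * exp (2 * \<bar>c\<bar>)"
      using that by (intro mult_mono power_mono) auto
    then show ?thesis by (simp add: power_mult_distrib)
  qed
  show ?thesis
  proof (cases "\<bar>a\<bar> \<le> \<bar>b\<bar>")
    case True
    then have "\<bar>a + b\<bar> ^ 3 * exp \<bar>a + b\<bar> \<le> 8 * (\<bar>b\<bar> ^ 3 * exp (2 * \<bar>b\<bar>))" by (intro *) linarith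
    then show ?thesis by (simp add: add_increasing)
  next
    case False
    then have "\<bar>a + b\<bar> ^ 3 * exp \<bar>a + b\<bar> \<le> 8 * (\<bar>a\<bar> ^ 3 * exp (2 * \<bar>a\<bar>))" by (intro *) linarith
    then show ?thesis by (simp add: add_increasing2)
  qed
qed

lemma linear_le_square:
  fixes l c t :: real
  assumes "l > 0"
  shows "2 * c * t \<le> l * t\<^sup>2 + c\<^sup>2 / l"
proof -
  have "0 \<le> (l * t - c)\<^sup>2 / l" using assms by simp
  also have "\<dots> = l * t\<^sup>2 + c\<^sup>2 / l - 2 * c * t"
    using assms by (simp add: power2_eq_square field_simps)
  finally show ?thesis by simp
qed

text \<open>\<open>6\<close> is \<open>fact 3\<close>, from
  \<open>t ^ 3 \<le> fact 3 * exp t\<close>; the exponential is the price of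
  \<open>3 * t \<le> mt_const * t\<^sup>2 + 9 / (4 * mt_const)\<close>.\<close>

definition cubic_const :: real where
  "cubic_const = 6 * exp (9 / (4 * mt_const))"

lemma cubic_const_pos: "cubic_const > 0"
  by (simp add: cubic_const_def)

text \<open>In the variable \<open>t = \<bar>p\<bar> / N\<close> the cube yields
  \<open>N ^ 3\<close>, and \<open>N \<le> 1\<close> bounds the other factor by
  \<open>exp (2 * t)\<close>. A quadratic exponent dominates a linear one whatever the size of
  \<open>mt_const\<close>.\<close>

lemma cube_exp_le:
  assumes "0 < N" "N \<le> 1"
  shows "\<bar>p\<bar> ^ 3 * exp (2 * \<bar>p\<bar>) \<le> N ^ 3 * cubic_const * exp (mt_const * (p / N)\<^sup>2)"
proof -
  define t where "t = \<bar>p\<bar> / N"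
  have t: "t \<ge> 0" "\<bar>p\<bar> = N * t" using assms by (auto simp: t_def)
  have "t ^ 3 * exp (2 * (N * t)) \<le> (fact 3 * exp t) * exp (2 * t)"
  proof (rule mult_mono)
    show "t ^ 3 \<le> fact 3 * exp t" by (rule power_le_fact_exp[OF t(1)])
    show "exp (2 * (N * t)) \<le> exp (2 * t)" using assms t(1) by (simp add: mult_left_le_one_le)
  qed (use t in auto)
  also have "\<dots> = 6 * exp (3 * t)" by (simp add: exp_add[symmetric] fact_numeral)
  also have "\<dots> \<le> 6 * exp (mt_const * t\<^sup>2 + 9 / (4 * mt_const))"
    using linear_le_square[OF mt_const_pos, of "3 / 2" t] by (simp add: power2_eq_square)
  also have "\<dots> = cubic_const * exp (mt_const * t\<^sup>2)" by (simp add: cubic_const_def exp_add)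
  finally have "N ^ 3 * (t ^ 3 * exp (2 * (N * t))) \<le> N ^ 3 * (cubic_const * exp (mt_const * t\<^sup>2))"
    using assms by (intro mult_left_mono) auto
  moreover have "t\<^sup>2 = (p / N)\<^sup>2" by (simp add: t_def power_divide)
  ultimately show ?thesis unfolding t(2) by (simp add: power_mult_distrib mult.assoc)
qed

text \<open>\<open>N\<close> lies strictly above the norm, as \<open>exp_integrability\<close> asks,
  and stays positive when the norm is \<open>0\<close>, so that \<open>f x / N\<close> is
  meaningful.\<close>

locale small_H2 =
  fixes f :: "real^5 \<Rightarrow> real" and N :: real
  assumes f: "f \<in> H2_S4" and N: "H2_norm f < N" "0 < N" "N \<le> 1"
begin

abbreviation e :: "real^5 \<Rightarrow> real" where
  "e x \<equiv> exp (mt_const * (f x / N)\<^sup>2)"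

lemma fL: "f \<in> L2_S4"
  using f by (simp add: H2_S4_def)

lemma fm [measurable]: "f \<in> borel_measurable \<sigma>"
  by (rule L2_S4_D(1)[OF fL])

lemma e_integrable: "integrable \<sigma> e"
proof (rule integrableI_nonneg)
  show "(\<integral>\<^sup>+x. ennreal (e x) \<partial>\<sigma>) < \<infinity>"
    using exp_integrability[OF f N(1)] by (rule order_le_less_trans) simp
qed auto

lemma e_integral: "(\<integral>x. e x \<partial>\<sigma>) \<le> 16 * pi\<^sup>2 / 3"
  using exp_integrability[OF f N(1)]
  by (subst (asm) nn_integral_eq_integral[OF e_integrable]) (auto simp: ennreal_le_iff)

lemma square_integral: "(\<integral>x. (f x)\<^sup>2 \<partial>\<sigma>) \<le> N\<^sup>2 / mt_const * (16 * pi\<^sup>2 / 3)"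
proof -
  have "(\<integral>x. (f x)\<^sup>2 \<partial>\<sigma>) \<le> (\<integral>x. N\<^sup>2 / mt_const * e x \<partial>\<sigma>)"
  proof (rule integral_mono)
    fix x
    have "mt_const * (f x / N)\<^sup>2 \<le> e x" using exp_ge_add_one_self[of "mt_const * (f x / N)\<^sup>2"] by linarith
    then show "(f x)\<^sup>2 \<le> N\<^sup>2 / mt_const * e x"
      using N(2) mt_const_pos by (simp add: power_divide field_simps)
  qed (use L2_S4_D(2)[OF fL] e_integrable in auto)
  also have "\<dots> = N\<^sup>2 / mt_const * (\<integral>x. e x \<partial>\<sigma>)" by (rule integral_mult_right_zero)
  also have "\<dots> \<le> N\<^sup>2 / mt_const * (16 * pi\<^sup>2 / 3)"
    using mt_const_pos by (intro mult_left_mono e_integral) auto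
  finally show ?thesis .
qed

abbreviation G :: "real^5 \<Rightarrow> real" where
  "G x \<equiv> \<bar>f x\<bar> ^ 3 * exp (2 * \<bar>f x\<bar>)"

lemma G_integrable: "integrable \<sigma> G"
proof (rule Bochner_Integration.integrable_bound)
  show "integrable \<sigma> (\<lambda>x. N ^ 3 * cubic_const * e x)" using e_integrable by simp
  show "AE x in \<sigma>. norm (G x) \<le> norm (N ^ 3 * cubic_const * e x)"
    using cube_exp_le[OF N(2,3)] N(2) cubic_const_pos by (intro AE_I2) (simp add: abs_mult)
qed measurable

lemma G_integral: "(\<integral>x. G x \<partial>\<sigma>) \<le> N ^ 3 * cubic_const * (16 * pi\<^sup>2 / 3)"
proof -
  have "(\<integral>x. G x \<partial>\<sigma>) \<le> (\<integral>x. N ^ 3 * cubic_const * e x \<partial>\<sigma>)"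
    using G_integrable e_integrable by (intro integral_mono cube_exp_le N) auto
  also have "\<dots> = N ^ 3 * cubic_const * (\<integral>x. e x \<partial>\<sigma>)" by (rule integral_mult_right_zero)
  also have "\<dots> \<le> N ^ 3 * cubic_const * (16 * pi\<^sup>2 / 3)"
    using N(2) cubic_const_pos by (intro mult_left_mono e_integral) auto
  finally show ?thesis .
qed

lemma f_integrable: "integrable \<sigma> f"
proof (rule Bochner_Integration.integrable_bound)
  show "integrable \<sigma> (\<lambda>x. 1 + (f x)\<^sup>2)" using L2_S4_D(2)[OF fL] by simp
  have "\<bar>f x\<bar> \<le> 1 + (f x)\<^sup>2" for x
    using linear_le_square[of 1 "1 / 2" "\<bar>f x\<bar>"] by (simp add: power2_eq_square)
  then show "AE x in \<sigma>. norm (f x) \<le> norm (1 + (f x)\<^sup>2)"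
    by (intro AE_I2) (simp add: abs_of_nonneg add_nonneg_nonneg)
qed measurable

text \<open>Second order Taylor expansion in the sum \<open>f x + f y\<close>: the constant gives
  the total mass, the linear terms vanish with the mean, the quadratic ones form
  \<open>riesz_quad\<close>, and the remainder is bounded by the marginal integrals of
  \<open>G\<close>.\<close>

lemma riesz_exp_expansion:
  assumes a: "0 < \<alpha>" "\<alpha> < 4" and mean: "(\<integral>x. f x \<partial>\<sigma>) = 0"
  shows "\<bar>I_fun \<alpha> f - riesz_mass \<alpha> * (8 * pi\<^sup>2 / 3) - riesz_quad \<alpha> f\<bar>
    \<le> 16 * riesz_mass \<alpha> * (N ^ 3 * cubic_const * (16 * pi\<^sup>2 / 3))"
proof -
  define k where "k = riesz_kernel \<alpha>"
  have k0: "k z \<ge> 0" for z by (simp add: k_def riesz_kernel_nonneg)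
  have km [measurable]: "k \<in> borel_measurable pairm" unfolding k_def by measurable
  note F = has_bochner_integral_riesz_fst[OF a, folded k_def] has_bochner_integral_riesz_snd[OF a, folded k_def]
  note iF = F[unfolded has_bochner_integral_iff]
  note f2 = L2_S4_D(2)[OF fL]
  have [measurable]: "(\<lambda>z. f (fst z)) \<in> borel_measurable pairm" "(\<lambda>z. f (snd z)) \<in> borel_measurable pairm"
    by (rule measurable_fst_sphere[OF fm], rule measurable_snd_sphere[OF fm])
  let ?s = "\<lambda>z. f (fst z) + f (snd z)"
  let ?r = "\<lambda>z. (exp (?s z) - 1 - ?s z - (?s z)\<^sup>2 / 2) * k z"
  let ?B = "\<lambda>z. 8 * (G (fst z) * k z) + 8 * (G (snd z) * k z)"
  have one: "has_bochner_integral pairm k (riesz_mass \<alpha> * (8 * pi\<^sup>2 / 3))"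
    using F(1)[of "\<lambda>_. 1"] measure_S4 by simp
  have quad: "has_bochner_integral pairm (\<lambda>z. f (fst z) * f (snd z) * k z) (riesz_form \<alpha> f f)"
    using integrable_riesz_form[OF a fL fL] by (simp add: has_bochner_integral_iff riesz_form_def k_def)
  have B: "has_bochner_integral pairm ?B (8 * (riesz_mass \<alpha> * (\<integral>x. G x \<partial>\<sigma>)) + 8 * (riesz_mass \<alpha> * (\<integral>x. G x \<partial>\<sigma>)))"
    by (intro has_bochner_integral_add has_bochner_integral_mult_right F G_integrable)
  have rB: "\<bar>?r z\<bar> \<le> ?B z" for z
  proof -
    have "\<bar>exp (?s z) - 1 - ?s z - (?s z)\<^sup>2 / 2\<bar> \<le> 8 * G (fst z) + 8 * G (snd z)"
      using exp_taylor2_bound cube_exp_add_bound by (rule order_trans)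
    from mult_right_mono[OF this k0[of z]] show ?thesis
      using k0[of z] by (simp add: abs_mult distrib_right mult.assoc)
  qed
  have ri: "integrable pairm ?r"
  proof (rule Bochner_Integration.integrable_bound)
    show "integrable pairm ?B" using B by (simp only: has_bochner_integral_iff)
    show "AE z in pairm. norm (?r z) \<le> norm (?B z)"
      unfolding real_norm_def using order_trans[OF rB abs_ge_self] by blast
  qed measurable
  \<comment> \<open>The exponential is written as remainder plus Taylor polynomial, bracketed so
    that the rules for sums and multiples deliver integrability and value together.\<close>
  have "has_bochner_integral pairm
      (\<lambda>z. ?r z + (k z + ((f (fst z) * k z + f (snd z) * k z)
        + ((1 / 2) * ((f (fst z))\<^sup>2 * k z + (f (snd z))\<^sup>2 * k z) + f (fst z) * f (snd z) * k z))))
      (integral\<^sup>L pairm ?r + (riesz_mass \<alpha> * (8 * pi\<^sup>2 / 3) + ((riesz_mass \<alpha> * (\<integral>x. f x \<partial>\<sigma>) + riesz_mass \<alpha> * (\<integral>x. f x \<partial>\<sigma>))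
        + ((1 / 2) * (riesz_mass \<alpha> * (\<integral>x. (f x)\<^sup>2 \<partial>\<sigma>) + riesz_mass \<alpha> * (\<integral>x. (f x)\<^sup>2 \<partial>\<sigma>)) + riesz_form \<alpha> f f))))"
    by (intro has_bochner_integral_add has_bochner_integral_mult_right F f2 f_integrable one quad
        has_bochner_integral_integrable ri)
  also have "(\<lambda>z. ?r z + (k z + ((f (fst z) * k z + f (snd z) * k z)
        + ((1 / 2) * ((f (fst z))\<^sup>2 * k z + (f (snd z))\<^sup>2 * k z) + f (fst z) * f (snd z) * k z))))
      = (\<lambda>z. exp (?s z) * k z)"
    by (simp add: fun_eq_iff power2_sum) (simp add: field_simps)
  also have "(\<lambda>z. exp (?s z) * k z) = (\<lambda>(x, y). exp (f x) * exp (f y) / dist x y powr \<alpha>)"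
    by (auto simp: fun_eq_iff k_def riesz_kernel_def exp_add powr_minus divide_inverse)
  also have "integral\<^sup>L pairm ?r + (riesz_mass \<alpha> * (8 * pi\<^sup>2 / 3) + ((riesz_mass \<alpha> * (\<integral>x. f x \<partial>\<sigma>) + riesz_mass \<alpha> * (\<integral>x. f x \<partial>\<sigma>))
        + ((1 / 2) * (riesz_mass \<alpha> * (\<integral>x. (f x)\<^sup>2 \<partial>\<sigma>) + riesz_mass \<alpha> * (\<integral>x. (f x)\<^sup>2 \<partial>\<sigma>)) + riesz_form \<alpha> f f)))
      = integral\<^sup>L pairm ?r + riesz_mass \<alpha> * (8 * pi\<^sup>2 / 3) + riesz_quad \<alpha> f"
    by (simp add: mean riesz_quad_def)
  finally have "I_fun \<alpha> f = integral\<^sup>L pairm ?r + riesz_mass \<alpha> * (8 * pi\<^sup>2 / 3) + riesz_quad \<alpha> f"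
    unfolding I_fun_def by (rule has_bochner_integral_integral_eq)
  then have "\<bar>I_fun \<alpha> f - riesz_mass \<alpha> * (8 * pi\<^sup>2 / 3) - riesz_quad \<alpha> f\<bar> = \<bar>integral\<^sup>L pairm ?r\<bar>"
    by simp
  also have "\<dots> \<le> integral\<^sup>L pairm (\<lambda>z. \<bar>?r z\<bar>)" by (rule integral_abs_bound)
  also have "\<dots> \<le> integral\<^sup>L pairm ?B"
    using ri B rB by (intro integral_mono) (simp_all only: has_bochner_integral_iff integrable_abs)
  also have "\<dots> = 16 * riesz_mass \<alpha> * (\<integral>x. G x \<partial>\<sigma>)"
    using has_bochner_integral_integral_eq[OF B] by simp
  also have "\<dots> \<le> 16 * riesz_mass \<alpha> * (N ^ 3 * cubic_const * (16 * pi\<^sup>2 / 3))"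
    using riesz_mass_pos[OF a(2)] by (intro mult_left_mono G_integral) auto
  finally show ?thesis .
qed

end

section \<open>Assembling the expansion of the functional\<close>

definition quadratic_const :: real where
  "quadratic_const = 4 / mt_const + 32 * cubic_const"

lemma quadratic_const_pos: "quadratic_const > 0"
  using mt_const_pos cubic_const_pos unfolding quadratic_const_def by (intro add_pos_pos) auto

text \<open>The normalisation behind \<open>kappa\<close>: its zero at \<open>\<alpha> = 4\<close>
  cancels the pole of the mass. The right side is twice the coefficient of the logarithm in
  \<open>D_fun\<close>, so half of \<open>kappa \<alpha> * riesz_quad \<alpha> f\<close> matches the
  first order term of that logarithm.\<close>

lemma kappa_riesz_mass:
  assumes "\<alpha> < 4"
  shows "kappa \<alpha> * (riesz_mass \<alpha> * (8 * pi\<^sup>2 / 3)) = 8 * pi\<^sup>2 * (8 - \<alpha>)"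
proof -
  have "2 powr (6 - \<alpha>) * 2 powr (- (8 - \<alpha>)) = 2 powr (- 2 :: real)"
    by (simp add: powr_add[symmetric])
  then have p: "2 powr (6 - \<alpha>) * 2 powr (- (8 - \<alpha>)) = 1 / 4" by (simp add: powr_minus)
  have "kappa \<alpha> * (riesz_mass \<alpha> * (8 * pi\<^sup>2 / 3))
    = 32 * pi\<^sup>2 * (8 - \<alpha>) * (2 powr (6 - \<alpha>) * 2 powr (- (8 - \<alpha>)))"
  proof -
    have "12 * A * B * D / P * v * (u * P / (B * D) * (8 * P / 3)) = 32 * P * A * (u * v)"
      if "B \<noteq> 0" "D \<noteq> 0" "P \<noteq> 0" for A B D P u v :: real
      using that by (simp add: field_simps)
    then show ?thesis unfolding kappa_def riesz_mass_def by this (use assms in auto)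
  qed
  then show ?thesis unfolding p by simp
qed

lemma D_fun_expansion:
  assumes a: "0 < \<alpha>" "\<alpha> < 4" and f: "f \<in> H2_S4" and mean: "(\<integral>x. f x \<partial>\<sigma>) = 0"
    and N_small: "H2_norm f < N" "0 < N" "N \<le> 1" "quadratic_const * N\<^sup>2 \<le> 1 / 2"
  shows "\<bar>D_fun \<alpha> f - 1 / 2 * L_form \<alpha> f\<bar> \<le> 32 * pi\<^sup>2 * (2 * quadratic_const\<^sup>2 + 32 * cubic_const) * N ^ 3"
proof -
  interpret small_H2 f N by unfold_locales (use f N_small in auto)
  define \<mu> where "\<mu> = riesz_mass \<alpha>"
  define Z where "Z = \<mu> * (8 * pi\<^sup>2 / 3)"
  define Q where "Q = riesz_quad \<alpha> f"
  define R where "R = I_fun \<alpha> f - Z - Q"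
  have \<mu>: "\<mu> > 0" unfolding \<mu>_def by (rule riesz_mass_pos[OF a(2)])
  have Z: "Z > 0" using \<mu> by (simp add: Z_def)
  have "\<bar>R\<bar> \<le> 16 * \<mu> * (N ^ 3 * cubic_const * (16 * pi\<^sup>2 / 3))"
    using riesz_exp_expansion[OF a mean] by (simp only: R_def Z_def Q_def \<mu>_def)
  \<comment> \<open>Here, and for \<open>Q\<close> below, \<open>Z\<close> is factored out; the
    bounds on \<open>R / Z\<close> and \<open>Q / Z\<close> are therefore independent of \<alpha>.
    The two factors of \<open>N\<close> so obtained add up to
    \<open>quadratic_const\<close>.\<close>
  also have "\<dots> = 32 * cubic_const * N ^ 3 * Z" by (simp add: Z_def)
  finally have RZ: "\<bar>R / Z\<bar> \<le> 32 * cubic_const * N ^ 3"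
    unfolding abs_divide abs_of_pos[OF Z] by (simp only: pos_divide_le_eq[OF Z])
  have "\<bar>Q\<bar> \<le> 2 * \<mu> * (\<integral>x. (f x)\<^sup>2 \<partial>\<sigma>)"
    unfolding Q_def \<mu>_def by (rule riesz_quad_bound[OF a fL])
  also have "\<dots> \<le> 2 * \<mu> * (N\<^sup>2 / mt_const * (16 * pi\<^sup>2 / 3))"
    using \<mu> by (intro mult_left_mono square_integral) auto
  also have "\<dots> = 4 / mt_const * N\<^sup>2 * Z" by (simp add: Z_def)
  finally have QZ: "\<bar>Q / Z\<bar> \<le> 4 / mt_const * N\<^sup>2"
    unfolding abs_divide abs_of_pos[OF Z] by (simp only: pos_divide_le_eq[OF Z])
  \<comment> \<open>The argument of the logarithm is \<open>1 + x\<close>. As \<open>x\<close> is of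
    order \<open>N\<^sup>2\<close> and at most \<open>1 / 2\<close> in absolute value,
    \<open>ln (1 + x) - x\<close> is of order \<open>N ^ 4\<close>.\<close>
  define x where "x = Q / Z + R / Z"
  have N32: "N ^ 3 \<le> N\<^sup>2" and N43: "N ^ 4 \<le> N ^ 3" using N by (auto intro!: power_decreasing)
  have xb: "\<bar>x\<bar> \<le> quadratic_const * N\<^sup>2"
  proof -
    have "32 * cubic_const * N ^ 3 \<le> 32 * cubic_const * N\<^sup>2"
      using cubic_const_pos by (intro mult_left_mono N32) auto
    then show ?thesis
      using RZ QZ unfolding x_def quadratic_const_def distrib_right by linarith
  qed
  then have "\<bar>x\<bar> \<le> 1 / 2" using N_small(4) by linarith
  then have "\<bar>ln (1 + x) - x\<bar> \<le> 2 * x\<^sup>2" by (rule abs_ln_one_plus_x_minus_x_bound)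
  also have "x\<^sup>2 \<le> (quadratic_const * N\<^sup>2)\<^sup>2"
    using xb quadratic_const_pos by (metis abs_ge_zero power2_abs power_mono)
  also have "(quadratic_const * N\<^sup>2)\<^sup>2 = quadratic_const\<^sup>2 * N ^ 4" by (simp add: power_mult_distrib)
  also have "\<dots> \<le> quadratic_const\<^sup>2 * N ^ 3" by (intro mult_left_mono N43) auto
  finally have lnx: "\<bar>ln (1 + x) - x\<bar> \<le> 2 * (quadratic_const\<^sup>2 * N ^ 3)" by simp
  have I: "I_fun \<alpha> f / (measure \<sigma> S4 * mu0 \<alpha>) = 1 + x"
  proof -
    have "measure \<sigma> S4 * mu0 \<alpha> = Z" unfolding measure_S4 mu0_eq[OF a] Z_def \<mu>_def by simp
    moreover have "I_fun \<alpha> f = Z + Q + R" by (simp add: R_def)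
    ultimately show ?thesis using Z by (simp add: x_def add_divide_distrib)
  qed
  have m0: "mean_S4 f = 0" using mean by (simp add: mean_S4_def)
  have \<kappa>Q: "kappa \<alpha> * Q = 8 * pi\<^sup>2 * (8 - \<alpha>) * (Q / Z)"
  proof -
    have "kappa \<alpha> * Q = kappa \<alpha> * Z * (Q / Z)" using Z by simp
    then show ?thesis using kappa_riesz_mass[OF a(2)] by (simp only: Z_def \<mu>_def)
  qed
  \<comment> \<open>The cancellation as pure algebra: \<open>p\<close> is the Paneitz form,
    \<open>l\<close> the logarithm, \<open>q\<close> and \<open>r\<close> stand for
    \<open>Q / Z\<close> and \<open>R / Z\<close>. \<open>p\<close> drops out, and the remaining
    \<open>l - q\<close> is regrouped so that \<open>ln (1 + x) - x\<close> appears.\<close>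
  have "1 / 2 * p + 8 * A * B * 0 - 4 * A * B * l - 1 / 2 * (p - 8 * A * B * q) = - (4 * A * B) * ((l - (q + r)) + r)"
    for p A B l q r :: real
    by (simp add: algebra_simps)
  then have "D_fun \<alpha> f - 1 / 2 * L_form \<alpha> f
      = - (4 * pi\<^sup>2 * (8 - \<alpha>)) * ((ln (1 + x) - (Q / Z + R / Z)) + R / Z)"
    unfolding D_fun_def L_form_eq[OF a f] I m0 Q_def[symmetric] \<kappa>Q by this
  then have "D_fun \<alpha> f - 1 / 2 * L_form \<alpha> f = - (4 * pi\<^sup>2 * (8 - \<alpha>)) * ((ln (1 + x) - x) + R / Z)"
    unfolding x_def .
  also have "\<bar>\<dots>\<bar> = 4 * pi\<^sup>2 * (8 - \<alpha>) * \<bar>(ln (1 + x) - x) + R / Z\<bar>"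
    using a by (simp add: abs_mult)
  also have "\<dots> \<le> 4 * pi\<^sup>2 * 8 * (2 * (quadratic_const\<^sup>2 * N ^ 3) + 32 * cubic_const * N ^ 3)"
  proof (rule mult_mono)
    show "\<bar>(ln (1 + x) - x) + R / Z\<bar> \<le> 2 * (quadratic_const\<^sup>2 * N ^ 3) + 32 * cubic_const * N ^ 3"
      using lnx RZ by linarith
  qed (use a in auto)
  also have "\<dots> = 32 * pi\<^sup>2 * (2 * quadratic_const\<^sup>2 + 32 * cubic_const) * N ^ 3"
    by (simp add: algebra_simps)
  finally show ?thesis .
qed

theorem lemma6p2:
  fixes K :: "real set"
  assumes "compact K" and "K \<subseteq> {0<..<4}"
  shows "\<exists>\<rho>>0. \<exists>C>0. \<forall>\<alpha>\<in>K. \<forall>\<Psi>\<in>H2_S4.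
           (\<forall>h\<in>H0_S4. L2_inner \<Psi> h = 0) \<longrightarrow> H2_norm \<Psi> \<le> \<rho> \<longrightarrow>
           \<bar>D_fun \<alpha> \<Psi> - 1 / 2 * L_form \<alpha> \<Psi>\<bar> \<le> C * H2_norm \<Psi> ^ 3"
proof -
  \<comment> \<open>For \<open>N \<le> M\<close> the smallness hypotheses of
    \<open>D_fun_expansion\<close> hold. The radius \<open>M / 2\<close> leaves room for values of
    \<open>N\<close> above the norm.\<close>
  define M where "M = min 1 (sqrt (1 / (2 * quadratic_const)))"
  define C where "C = 32 * pi\<^sup>2 * (2 * quadratic_const\<^sup>2 + 32 * cubic_const)"
  have M: "M > 0" "M \<le> 1" using quadratic_const_pos by (auto simp: M_def)
  have "M\<^sup>2 \<le> (sqrt (1 / (2 * quadratic_const)))\<^sup>2"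
    using M(1) by (intro power_mono) (auto simp: M_def)
  then have M2: "quadratic_const * M\<^sup>2 \<le> 1 / 2"
    using quadratic_const_pos by (simp add: field_simps)
  have C: "C > 0" using cubic_const_pos unfolding C_def by (intro mult_pos_pos add_nonneg_pos) auto
  have "\<bar>D_fun \<alpha> \<Psi> - 1 / 2 * L_form \<alpha> \<Psi>\<bar> \<le> C * H2_norm \<Psi> ^ 3"
    if \<alpha>: "\<alpha> \<in> K" and \<Psi>: "\<Psi> \<in> H2_S4" and orth: "\<forall>h\<in>H0_S4. L2_inner \<Psi> h = 0"
      and small: "H2_norm \<Psi> \<le> M / 2" for \<alpha> \<Psi>
  proof -
    have a: "0 < \<alpha>" "\<alpha> < 4" using \<alpha> assms(2) by auto
    have "(\<lambda>x. 1) \<in> H0_S4" by (auto simp: H0_S4_def)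
    then have "L2_inner \<Psi> (\<lambda>x. 1) = 0" using orth by blast
    then have mean: "(\<integral>x. \<Psi> x \<partial>\<sigma>) = 0" by (simp add: L2_inner_def)
    obtain \<phi> where \<phi>: "H2_approx \<phi> \<Psi>" using \<Psi> by (auto simp: H2_S4_def)
    have h0: "H2_norm \<Psi> \<ge> 0"
      by (rule LIMSEQ_le_const[OF H2_norm_tendsto[OF \<Psi> \<phi>]]) (use H2_norm_smooth_nonneg in blast)
    \<comment> \<open>Decreases to the norm while staying strictly above it, so that the limit of
      the bounds is the cube of the norm itself, also when the norm is \<open>0\<close>.\<close>
    define N where "N n = H2_norm \<Psi> + M / 2 * inverse (real (Suc n))" for n
    have bound: "\<bar>D_fun \<alpha> \<Psi> - 1 / 2 * L_form \<alpha> \<Psi>\<bar> \<le> C * N n ^ 3" for n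
      unfolding C_def
    proof (rule D_fun_expansion[OF a \<Psi> mean])
      show "H2_norm \<Psi> < N n" using M(1) by (simp add: N_def)
      then show N0: "0 < N n" using h0 by linarith
      have "M / 2 * inverse (real (Suc n)) \<le> M / 2 * 1"
        using M(1) by (intro mult_left_mono) (auto simp: field_simps)
      then have NM: "N n \<le> M" using small unfolding N_def by linarith
      then show "N n \<le> 1" using M(2) by linarith
      have "quadratic_const * (N n)\<^sup>2 \<le> quadratic_const * M\<^sup>2"
        using quadratic_const_pos NM N0 by (intro mult_left_mono power_mono) auto
      then show "quadratic_const * (N n)\<^sup>2 \<le> 1 / 2" using M2 by linarith
    qed
    have "N \<longlonglongrightarrow> H2_norm \<Psi> + M / 2 * 0"
      unfolding N_def by (intro tendsto_intros LIMSEQ_inverse_real_of_nat)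
    then have "(\<lambda>n. C * N n ^ 3) \<longlonglongrightarrow> C * H2_norm \<Psi> ^ 3"
      by (intro tendsto_intros) simp
    then show ?thesis by (rule LIMSEQ_le_const) (use bound in blast)
  qed
  moreover have "M / 2 > 0" using M(1) by simp
  ultimately show ?thesis using C by blast
qed

end
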